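(* Let $m>n\ge1$, $\mathfrak g=\mathfrak{osp}(2m+1|2n)$ with the data below, and let $\Lambda\in\hat{\mathfrak h}^*$ have level $k\ne0$ and satisfy $(\Lambda|\beta_i)=0$ for $i=1,\dots,n$. Then $L(\Lambda)$ is integrable if and only if $\Lambda=k\Lambda_0+\sum_{i=1}^nk_i\beta_i+\sum_{i=n+1}^mk_i\epsilon_i+c\delta$ for some $c\in\mathbb{C}$ and numbers $k_i$ with $k\in\mathbb{Z}_{>0}$, $k_1\in\frac12\mathbb{Z}_{\ge0}$, $k_i-k_1\in\mathbb{Z}_{\ge0}$ ($2\le i\le m$), $k_m\ge k_{m-1}\ge\dots\ge k_1$, and $k\ge k_m+k_{m-1}$.
   Context: Affine setting: $\mathfrak g$ is a basic Lie superalgebra with nondegenerate invariant supersymmetric form $(\cdot|\cdot)$ and Cartan subalgebra $\mathfrak h\subset\mathfrak g_{\bar0}$, identified with $\mathfrak h^*$. $\hat{\mathfrak g}=\mathfrak g[t,t^{-1}]\oplus\mathbb{C}K\oplus\mathbb{C}d$ with $[at^r,bt^s]=[a,b]t^{r+s}+r\delta_{r,-s}(a|b)K$, $K$ central, $[d,at^r]=rat^r$; $\hat{\mathfrak h}=\mathfrak h\oplus\mathbb{C}K\oplus\mathbb{C}d$, form extended by $(\mathfrak h|\mathbb{C}K+\mathbb{C}d)=0$, $(K|K)=(d|d)=0$, $(K|d)=1$; $\delta,\Lambda_0$ correspond to $K,d$. Given simple roots $\Pi$ of $\mathfrak g$ with highest root $\theta$, positive roots of $\hat{\mathfrak g}$: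 positive roots of $\mathfrak g$ and $\alpha+r\delta$ ($\alpha$ a root or $0$, $r>0$); simple roots $\{\alpha_0=\delta-\theta\}\cup\Pi$. $L(\Lambda)$ is the irreducible highest weight module, level $\Lambda(K)$. $L(\Lambda)$ is $\gamma$-integrable if $\hat{\mathfrak g}_{-\gamma}$ acts locally nilpotently; integrable if $\gamma$-integrable for all positive $\gamma\in\Delta^\#_{\bar0}$ and all $\alpha+r\delta$, $\alpha\in\Delta^\#_{\bar0}$, $r\in\mathbb{Z}_{>0}$, where $\Delta^\#_{\bar0}$ is the root set of $\mathfrak g^\#_{\bar0}$. Data: orthogonal basis $\epsilon_1,\dots,\epsilon_m,\delta_1,\dots,\delta_n$ of $\mathfrak h^*$, $(\epsilon_i|\epsilon_i)=1$, $(\delta_i|\delta_i)=-1$. Even roots: $\epsilon_i-\epsilon_j,\pm(\epsilon_i+\epsilon_j),\pm\epsilon_i$, $\delta_i-\delta_j,\pm(\delta_i+\delta_j),\pm2\delta_i$; odd roots $\pm(\epsilon_i\pm\delta_j),\pm\delta_j$. $\mathfrak g^\#_{\bar0}=\mathfrak{so}(2m+1)$ (roots in the $\epsilon$'s). Simple roots: $\epsilon_m-\epsilon_{m-1},\dots,\epsilon_{n+1}-\epsilon_n,\ \epsilon_n-\delta_n,\ \delta_n-\epsilon_{n-1},\dots,\ \delta_2-\epsilon_1,\ \epsilon_1-\delta_1,\ \delta_1$; $\theta=\epsilon_m+\epsilon_{m-1}$. $\beta_i=\epsilon_i-\delta_i$, $i=1,\dots,n$. *)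

theory Defs
  imports Complex_Main
begin

text \<open>Basis of the superspace C^(2m+1|2n): even vectors e_0, e_i, e_{-i} (1<=i<=m),
  odd vectors f_j, f_{-j} (1<=j<=n).\<close>
datatype idx = E0 | Ep nat | Em nat | Fp nat | Fm nat

type_synonym mat = "idx \<Rightarrow> idx \<Rightarrow> complex"

fun odd_idx :: "idx \<Rightarrow> bool" where
  "odd_idx E0 = False" | "odd_idx (Ep i) = False" | "odd_idx (Em i) = False"
| "odd_idx (Fp j) = True" | "odd_idx (Fm j) = True"

definition idxs :: "nat \<Rightarrow> nat \<Rightarrow> idx set" where
  "idxs m n = {E0} \<union> Ep ` {1..m} \<union> Em ` {1..m} \<union> Fp ` {1..n} \<union> Fm ` {1..n}"

definition zmat :: mat where "zmat = (\<lambda>_ _. 0)"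

definition mmul :: "nat \<Rightarrow> nat \<Rightarrow> mat \<Rightarrow> mat \<Rightarrow> mat" where
  "mmul m n X Y = (\<lambda>i k. \<Sum>j\<in>idxs m n. X i j * Y j k)"

definition evenp :: "mat \<Rightarrow> mat" where
  "evenp X = (\<lambda>i j. if odd_idx i = odd_idx j then X i j else 0)"

definition oddp :: "mat \<Rightarrow> mat" where
  "oddp X = (\<lambda>i j. if odd_idx i \<noteq> odd_idx j then X i j else 0)"

text \<open>Supercommutator [X,Y] = XY - YX + 2 Y_1 X_1 (bilinear extension of
  [X_a,Y_b] = X_a Y_b - (-1)^(ab) Y_b X_a).\<close>
definition sbr :: "nat \<Rightarrow> nat \<Rightarrow> mat \<Rightarrow> mat \<Rightarrow> mat" where
  "sbr m n X Y = (\<lambda>i k. mmul m n X Y i k - mmul m n Y X i k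
                          + 2 * mmul m n (oddp Y) (oddp X) i k)"

fun bf :: "idx \<Rightarrow> idx \<Rightarrow> complex" where
  "bf E0 E0 = 1"
| "bf (Ep i) (Em j) = (if i = j then 1 else 0)"
| "bf (Em i) (Ep j) = (if i = j then 1 else 0)"
| "bf (Fp i) (Fm j) = (if i = j then 1 else 0)"
| "bf (Fm i) (Fp j) = (if i = j then -1 else 0)"
| "bf _ _ = 0"

definition osp_cond :: "nat \<Rightarrow> nat \<Rightarrow> mat \<Rightarrow> bool \<Rightarrow> bool" where
  "osp_cond m n X p = (\<forall>u\<in>idxs m n. \<forall>w\<in>idxs m n.
     (\<Sum>k\<in>idxs m n. X k u * bf k w)
     + (if p \<and> odd_idx u then -1 else 1) * (\<Sum>k\<in>idxs m n. X k w * bf u k) = 0)"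

definition osp :: "nat \<Rightarrow> nat \<Rightarrow> mat \<Rightarrow> bool" where
  "osp m n X = ((\<forall>i j. X i j \<noteq> 0 \<longrightarrow> i \<in> idxs m n \<and> j \<in> idxs m n)
               \<and> osp_cond m n (evenp X) False \<and> osp_cond m n (oddp X) True)"

definition str :: "nat \<Rightarrow> nat \<Rightarrow> mat \<Rightarrow> complex" where
  "str m n X = (\<Sum>i\<in>idxs m n. if odd_idx i then - X i i else X i i)"

text \<open>Invariant supersymmetric form (x|y) = str(xy)/2, normalized so that
  (eps_i|eps_i) = 1, (delta_j|delta_j) = -1.\<close>
definition gform :: "nat \<Rightarrow> nat \<Rightarrow> mat \<Rightarrow> mat \<Rightarrow> complex" where
  "gform m n X Y = str m n (mmul m n X Y) / 2"

text \<open>An element (f, c, e) stands for sum_r f(r) t^r + c K + e d.\<close>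
type_synonym ghat = "(int \<Rightarrow> mat) \<times> complex \<times> complex"

definition msupp :: "(int \<Rightarrow> mat) \<Rightarrow> int set" where
  "msupp f = {r. f r \<noteq> zmat}"

definition ghat_set :: "nat \<Rightarrow> nat \<Rightarrow> ghat set" where
  "ghat_set m n = {x. finite (msupp (fst x)) \<and> (\<forall>r. osp m n (fst x r))}"

definition gzero :: ghat where "gzero = (\<lambda>_. zmat, 0, 0)"

definition gadd :: "ghat \<Rightarrow> ghat \<Rightarrow> ghat" where
  "gadd x y = (\<lambda>r i j. fst x r i j + fst y r i j,
               fst (snd x) + fst (snd y), snd (snd x) + snd (snd y))"

definition gscale :: "complex \<Rightarrow> ghat \<Rightarrow> ghat" where
  "gscale a x = (\<lambda>r i j. a * fst x r i j, a * fst (snd x), a * snd (snd x))"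

definition gbr :: "nat \<Rightarrow> nat \<Rightarrow> ghat \<Rightarrow> ghat \<Rightarrow> ghat" where
  "gbr m n x y =
    (\<lambda>r i j. (\<Sum>s\<in>msupp (fst x). sbr m n (fst x s) (fst y (r - s)) i j)
             + snd (snd x) * of_int r * fst y r i j
             - snd (snd y) * of_int r * fst x r i j,
     (\<Sum>s\<in>msupp (fst x). of_int s * gform m n (fst x s) (fst y (- s))),
     0)"

definition geven :: "ghat \<Rightarrow> bool" where
  "geven x = (\<forall>r. oddp (fst x r) = zmat)"

definition godd :: "ghat \<Rightarrow> bool" where
  "godd x = ((\<forall>r. evenp (fst x r) = zmat) \<and> fst (snd x) = 0 \<and> snd (snd x) = 0)"

definition homog :: "ghat \<Rightarrow> bool" where
  "homog x = (geven x \<or> godd x)"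

definition hhat :: "nat \<Rightarrow> nat \<Rightarrow> ghat set" where
  "hhat m n = {x. (\<forall>r. r \<noteq> 0 \<longrightarrow> fst x r = zmat) \<and> osp m n (fst x 0)
                  \<and> (\<forall>i j. i \<noteq> j \<longrightarrow> fst x 0 i j = 0)}"

text \<open>Elements of hat h^* are represented as functions on hat g (only their values on
  hat h matter).\<close>
definition eps :: "nat \<Rightarrow> ghat \<Rightarrow> complex" where
  "eps i x = fst x 0 (Ep i) (Ep i)"
definition dlt :: "nat \<Rightarrow> ghat \<Rightarrow> complex" where
  "dlt j x = fst x 0 (Fp j) (Fp j)"
definition lam0 :: "ghat \<Rightarrow> complex" where
  "lam0 x = fst (snd x)"
definition delt :: "ghat \<Rightarrow> complex" where
  "delt x = snd (snd x)"
definition beta :: "nat \<Rightarrow> ghat \<Rightarrow> complex" where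
  "beta i = (\<lambda>x. eps i x - dlt i x)"

definition Kel :: ghat where "Kel = (\<lambda>_. zmat, 1, 0)"
definition del :: ghat where "del = (\<lambda>_. zmat, 0, 1)"
definition Eh :: "nat \<Rightarrow> ghat" where
  "Eh i = (\<lambda>r. if r = 0 then (\<lambda>a b. if a = b \<and> a = Ep i then 1
                                   else if a = b \<and> a = Em i then -1 else 0) else zmat, 0, 0)"
definition Fh :: "nat \<Rightarrow> ghat" where
  "Fh j = (\<lambda>r. if r = 0 then (\<lambda>a b. if a = b \<and> a = Fp j then 1
                                   else if a = b \<and> a = Fm j then -1 else 0) else zmat, 0, 0)"

definition hstar :: "nat \<Rightarrow> nat \<Rightarrow> (ghat \<Rightarrow> complex) \<Rightarrow> bool" where
  "hstar m n L = (\<forall>h\<in>hhat m n. \<forall>h'\<in>hhat m n. \<forall>a.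
      L (gadd h h') = L h + L h' \<and> L (gscale a h) = a * L h)"

text \<open>The induced form on hat h^*: eps_i, delta_j orthogonal with (eps_i|eps_i)=1,
  (delta_j|delta_j)=-1, orthogonal to Lambda_0, delta; (Lambda_0|delta)=1,
  (Lambda_0|Lambda_0)=(delta|delta)=0.  Coordinates of L: L(E_i), L(F_j), L(K), L(d).\<close>
definition hsform :: "nat \<Rightarrow> nat \<Rightarrow> (ghat \<Rightarrow> complex) \<Rightarrow> (ghat \<Rightarrow> complex) \<Rightarrow> complex" where
  "hsform m n L M = (\<Sum>i=1..m. L (Eh i) * M (Eh i)) - (\<Sum>j=1..n. L (Fh j) * M (Fh j))
                    + L Kel * M del + L del * M Kel"

definition rootsp :: "nat \<Rightarrow> nat \<Rightarrow> (ghat \<Rightarrow> complex) \<Rightarrow> ghat set" where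
  "rootsp m n a = {x \<in> ghat_set m n. \<forall>h\<in>hhat m n. gbr m n h x = gscale (a h) x}"

definition is_root :: "nat \<Rightarrow> nat \<Rightarrow> (ghat \<Rightarrow> complex) \<Rightarrow> bool" where
  "is_root m n a = ((\<exists>h\<in>hhat m n. a h \<noteq> 0) \<and> (\<exists>x\<in>rootsp m n a. x \<noteq> gzero))"

definition simple_roots :: "nat \<Rightarrow> nat \<Rightarrow> (ghat \<Rightarrow> complex) set" where
  "simple_roots m n =
     {\<lambda>x. delt x - eps m x - eps (m - 1) x}
   \<union> {\<lambda>x. eps (Suc i) x - eps i x | i. n \<le> i \<and> i < m}
   \<union> {\<lambda>x. eps j x - dlt j x | j. 1 \<le> j \<and> j \<le> n}
   \<union> {\<lambda>x. dlt (Suc j) x - eps j x | j. 1 \<le> j \<and> j < n}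
   \<union> {dlt 1}"

definition pos_root :: "nat \<Rightarrow> nat \<Rightarrow> (ghat \<Rightarrow> complex) \<Rightarrow> bool" where
  "pos_root m n a = (is_root m n a \<and>
     (\<exists>c :: (ghat \<Rightarrow> complex) \<Rightarrow> nat. \<forall>h\<in>hhat m n.
        a h = (\<Sum>p\<in>simple_roots m n. of_nat (c p) * p h)))"

text \<open>Roots of g^#_0 = so(2m+1) (the even block on the e-vectors), as functionals on hat h.\<close>
definition sharp_root :: "nat \<Rightarrow> nat \<Rightarrow> (ghat \<Rightarrow> complex) \<Rightarrow> bool" where
  "sharp_root m n a = ((\<exists>h\<in>hhat m n. a h \<noteq> 0) \<and>
     (\<exists>X. X \<noteq> zmat \<and> osp m n X \<and> (\<forall>i j. X i j \<noteq> 0 \<longrightarrow> \<not> odd_idx i \<and> \<not> odd_idx j)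
          \<and> (\<lambda>r. if r = 0 then X else zmat, 0, 0) \<in> rootsp m n a))"

definition gmodule :: "nat \<Rightarrow> nat \<Rightarrow> (complex \<Rightarrow> 'v::ab_group_add \<Rightarrow> 'v) \<Rightarrow> (ghat \<Rightarrow> 'v \<Rightarrow> 'v) \<Rightarrow> bool" where
  "gmodule m n sc \<rho> = (module sc
    \<and> (\<forall>x\<in>ghat_set m n. \<forall>w w'. \<rho> x (w + w') = \<rho> x w + \<rho> x w')
    \<and> (\<forall>x\<in>ghat_set m n. \<forall>a w. \<rho> x (sc a w) = sc a (\<rho> x w))
    \<and> (\<forall>x\<in>ghat_set m n. \<forall>y\<in>ghat_set m n. \<forall>w. \<rho> (gadd x y) w = \<rho> x w + \<rho> y w)
    \<and> (\<forall>x\<in>ghat_set m n. \<forall>a w. \<rho> (gscale a x) w = sc a (\<rho> x w))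
    \<and> (\<forall>x\<in>ghat_set m n. \<forall>y\<in>ghat_set m n. homog x \<longrightarrow> homog y \<longrightarrow> (\<forall>w.
         \<rho> (gbr m n x y) w =
           (if godd x \<and> godd y then \<rho> x (\<rho> y w) + \<rho> y (\<rho> x w)
            else \<rho> x (\<rho> y w) - \<rho> y (\<rho> x w)))))"

definition irreducible_mod :: "nat \<Rightarrow> nat \<Rightarrow> (complex \<Rightarrow> 'v::ab_group_add \<Rightarrow> 'v) \<Rightarrow> (ghat \<Rightarrow> 'v \<Rightarrow> 'v) \<Rightarrow> bool" where
  "irreducible_mod m n sc \<rho> = ((\<exists>w::'v. w \<noteq> 0) \<and>
     (\<forall>W. 0 \<in> W \<and> (\<forall>a\<in>W. \<forall>b\<in>W. a + b \<in> W) \<and> (\<forall>c. \<forall>a\<in>W. sc c a \<in> W)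
          \<and> (\<forall>x\<in>ghat_set m n. \<forall>a\<in>W. \<rho> x a \<in> W) \<longrightarrow> W = {0} \<or> W = UNIV))"

definition hw_vector :: "nat \<Rightarrow> nat \<Rightarrow> (complex \<Rightarrow> 'v::ab_group_add \<Rightarrow> 'v) \<Rightarrow> (ghat \<Rightarrow> 'v \<Rightarrow> 'v)
    \<Rightarrow> (ghat \<Rightarrow> complex) \<Rightarrow> 'v \<Rightarrow> bool" where
  "hw_vector m n sc \<rho> L v = (v \<noteq> 0 \<and> (\<forall>h\<in>hhat m n. \<rho> h v = sc (L h) v)
     \<and> (\<forall>a. pos_root m n a \<longrightarrow> (\<forall>x\<in>rootsp m n a. \<rho> x v = 0)))"

definition gamma_integrable :: "nat \<Rightarrow> nat \<Rightarrow> (ghat \<Rightarrow> 'v::zero \<Rightarrow> 'v) \<Rightarrow> (ghat \<Rightarrow> complex) \<Rightarrow> bool" where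
  "gamma_integrable m n \<rho> g = (\<forall>x\<in>rootsp m n (\<lambda>h. - g h). \<forall>w. \<exists>N. (\<rho> x ^^ N) w = 0)"

definition integrable :: "nat \<Rightarrow> nat \<Rightarrow> (ghat \<Rightarrow> 'v::zero \<Rightarrow> 'v) \<Rightarrow> bool" where
  "integrable m n \<rho> =
     ((\<forall>g. sharp_root m n g \<and> pos_root m n g \<longrightarrow> gamma_integrable m n \<rho> g)
    \<and> (\<forall>a (r::nat). sharp_root m n a \<and> r > 0 \<longrightarrow>
          gamma_integrable m n \<rho> (\<lambda>h. a h + of_nat r * delt h)))"

end

theory Submission
  imports Defs
begin

text \<open>
  Since \<open>(\<Lambda>|\<beta>\<^sub>i) = 0\<close>, the vector obtained by applying the root vector of \<open>-\<beta>\<^sub>i\<close> to the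
  highest weight vector \<open>v\<close> is singular of lower height, hence zero by irreducibility. So \<open>v\<close> is
  also a highest weight vector for each base obtained by the odd reflection that interchanges
  \<open>\<epsilon>\<^sub>i\<close> and \<open>\<delta>\<^sub>i\<close>, and every simple root of the affine algebra of \<open>so(2m+1)\<close> is simple for one of
  these bases. For such a root \<open>\<alpha>\<close> with root vector \<open>f\<close> of weight \<open>-\<alpha>\<close>, sl(2) theory shows
  that \<open>f\<close> is nilpotent on \<open>v\<close> iff \<open>q = \<Lambda>(\<alpha>\<^sup>\<or>)\<close> is a natural number: in that case the vector
  \<open>f\<^bsup>q+1\<^esup> v\<close> is again singular of lower height. The numbers \<open>q\<close> are \<open>2k\<^sub>1\<close>, the differences
  \<open>k\<^sub>i\<^sub>+\<^sub>1 - k\<^sub>i\<close> and \<open>k - k\<^sub>m - k\<^sub>m\<^sub>-\<^sub>1\<close>, which gives the stated conditions. Nilpotency on \<open>v\<close>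
  spreads to the whole module, so the set of weights is stable under the simple reflections;
  as weights are bounded above and reflections move every real root to a positive one, all real
  root vectors of \<open>so(2m+1)\<close> act locally nilpotently.
\<close>

section \<open>The matrix superalgebra\<close>

text \<open>The obstacle is that eps_1 and eps_(i+1) - eps_i with i < n are sums of two odd simple
  roots, so they have height 2 over the given base and a power of their lowering operator applied to
  v is not visibly singular. One interchange of eps_p and delta_p, with p = 1 or p = i + 1, brings
  the height down to 1; interchanges are never composed. Bases enter only through height functions
  on the weights of the natural module, extended by giving delta the height 2(m+n). As theta = eps_m
  + eps_(m-1) has height (m+n) + (m+n-1), the root delta - theta gets height 1. A single element of
  the Cartan subalgebra measures this height, and its eigenvalues replace the order on weights. Root
  vectors are labelled by pairs of indices of the natural module. Most brackets are controlled by
  the positions of their nonzero entries instead of structure constants. Reflections act on the set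
  of weights and are not lifted to operators on the module. Nilpotency is therefore encoded by a
  property of functionals: strings in their direction leave the set of weights.\<close>

fun du :: "idx \<Rightarrow> idx" where
  "du E0 = E0" | "du (Ep i) = Em i" | "du (Em i) = Ep i" | "du (Fp j) = Fm j" | "du (Fm j) = Fp j"

fun eta :: "idx \<Rightarrow> complex" where
  "eta (Fm j) = -1" | "eta E0 = 1" | "eta (Ep i) = 1" | "eta (Em i) = 1" | "eta (Fp j) = 1"

text \<open>For a matrix in osp, the entry at (\<open>du j\<close>, \<open>du i\<close>) is this
  sign times the entry at (i, j). The index \<open>du i\<close> is that of the basis vector dual for
  \<open>bf\<close>, which has the opposite weight, and \<open>eta\<close> records the sign of the
  pairing.\<close>

definition sg :: "idx \<Rightarrow> idx \<Rightarrow> complex" where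
  "sg i j = (if odd_idx j \<and> \<not> odd_idx i then 1 else -1) * eta i * eta j"

lemma du_du [simp]: "du (du i) = i"
  by (cases i) auto

lemma odd_du [simp]: "odd_idx (du i) = odd_idx i"
  by (cases i) auto

lemma du_eq_iff [simp]: "du i = du j \<longleftrightarrow> i = j"
  by (metis du_du)

lemma du_eq_swap: "du i = j \<longleftrightarrow> i = du j"
  by auto

lemma du_idxs [simp]: "du i \<in> idxs m n \<longleftrightarrow> i \<in> idxs m n"
  by (cases i) (auto simp: idxs_def)

lemma finite_idxs [simp]: "finite (idxs m n)"
  by (simp add: idxs_def)

lemma idxs_simps [simp]:
  "E0 \<in> idxs m n" "Ep i \<in> idxs m n \<longleftrightarrow> 1 \<le> i \<and> i \<le> m" "Em i \<in> idxs m n \<longleftrightarrow> 1 \<le> i \<and> i \<le> m"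
  "Fp i \<in> idxs m n \<longleftrightarrow> 1 \<le> i \<and> i \<le> n" "Fm i \<in> idxs m n \<longleftrightarrow> 1 \<le> i \<and> i \<le> n"
  by (auto simp: idxs_def)

lemma sum_idxs_du: "(\<Sum>j\<in>idxs m n. g (du j)) = (\<Sum>j\<in>idxs m n. g j)"
  by (rule sum.reindex_bij_witness[of _ du du]) auto

lemma bf_eq: "bf k w = (if k = du w then eta k else 0)"
  by (cases k; cases w) auto

lemma sg_du: "sg (du j) (du i) * sg i j = 1"
  by (cases i; cases j) (auto simp: sg_def)

text \<open>The identity behind closure under the bracket: up to the Koszul sign of two odd factors,
  \<open>- sg\<close> is multiplicative along composable entries.\<close>

lemma sg_trans:
  "sg i j * sg j k * (if odd_idx i \<noteq> odd_idx j \<and> odd_idx j \<noteq> odd_idx k then -1 else 1) = - sg i k"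
  by (cases i; cases j; cases k) (auto simp: sg_def)

lemma osp_cond_iff:
  "osp_cond m n X p \<longleftrightarrow> (\<forall>i\<in>idxs m n. \<forall>j\<in>idxs m n.
     X i j * eta i + (if p \<and> odd_idx j then -1 else 1) * (X (du j) (du i) * eta j) = 0)"
proof -
  have *: "(\<Sum>k\<in>idxs m n. X k u * bf k w) = X (du w) u * eta (du w)" if "w \<in> idxs m n" for u w
    using that by (simp add: bf_eq if_distrib sum.delta cong: if_cong)
  have **: "(\<Sum>k\<in>idxs m n. X k w * bf u k) = X (du u) w * eta u" if "u \<in> idxs m n" for u w
    using that by (simp add: bf_eq if_distrib sum.delta du_eq_swap[of _ u, symmetric] cong: if_cong)
      (simp add: if_distrib sum.delta' eq_commute[of u] du_eq_swap cong: if_cong)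
  have "osp_cond m n X p \<longleftrightarrow> (\<forall>u\<in>idxs m n. \<forall>w\<in>idxs m n.
     X (du w) u * eta (du w) + (if p \<and> odd_idx u then -1 else 1) * (X (du u) w * eta u) = 0)"
    unfolding osp_cond_def by (intro ball_cong refl) (simp only: * **)
  also have "\<dots> \<longleftrightarrow> (\<forall>i\<in>idxs m n. \<forall>j\<in>idxs m n.
     X i j * eta i + (if p \<and> odd_idx j then -1 else 1) * (X (du j) (du i) * eta j) = 0)"
    by (metis du_du du_idxs)
  finally show ?thesis .
qed

text \<open>Every entry belongs to exactly one of the even and the odd part, so the two conditions
  in \<open>osp\<close> combine into one sign rule per entry.\<close>

lemma osp_iff:
  "osp m n X \<longleftrightarrow> (\<forall>i j. X i j \<noteq> 0 \<longrightarrow> i \<in> idxs m n \<and> j \<in> idxs m n)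
     \<and> (\<forall>i j. X (du j) (du i) = sg i j * X i j)"
proof -
  have eta: "eta j = 1 \<or> eta j = -1" for j by (cases j) auto
  have "(osp_cond m n (evenp X) False \<and> osp_cond m n (oddp X) True)
      \<longleftrightarrow> (\<forall>i\<in>idxs m n. \<forall>j\<in>idxs m n. X (du j) (du i) = sg i j * X i j)"
    unfolding osp_cond_iff ball_conj_distrib[symmetric]
  proof (intro ball_cong refl)
    fix i j
    show "evenp X i j * eta i + (if False \<and> odd_idx j then -1 else 1) * (evenp X (du j) (du i) * eta j) = 0
       \<and> oddp X i j * eta i + (if True \<and> odd_idx j then -1 else 1) * (oddp X (du j) (du i) * eta j) = 0
       \<longleftrightarrow> X (du j) (du i) = sg i j * X i j"
      using eta[of i] eta[of j]
      by (cases "odd_idx i"; cases "odd_idx j"; elim disjE; simp add: evenp_def oddp_def sg_def; algebra)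
  qed
  moreover have "(\<forall>i j. X (du j) (du i) = sg i j * X i j) \<longleftrightarrow>
     (\<forall>i\<in>idxs m n. \<forall>j\<in>idxs m n. X (du j) (du i) = sg i j * X i j)"
    if "\<forall>i j. X i j \<noteq> 0 \<longrightarrow> i \<in> idxs m n \<and> j \<in> idxs m n"
    using that by (metis du_idxs mult_zero_right)
  ultimately show ?thesis unfolding osp_def by auto
qed

lemma ospD: "osp m n X \<Longrightarrow> X i j \<noteq> 0 \<Longrightarrow> i \<in> idxs m n \<and> j \<in> idxs m n"
  by (simp add: osp_iff)

lemma osp_dual: "osp m n X \<Longrightarrow> X (du j) (du i) = sg i j * X i j"
  by (simp add: osp_iff)

lemma osp_zmat: "osp m n zmat"
  by (simp add: osp_iff zmat_def)

lemma osp_add: "osp m n X \<Longrightarrow> osp m n Y \<Longrightarrow> osp m n (\<lambda>i j. X i j + Y i j)"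
  unfolding osp_iff by (simp add: algebra_simps) (metis add_cancel_right_right)

lemma osp_scale: "osp m n X \<Longrightarrow> osp m n (\<lambda>i j. c * X i j)"
  unfolding osp_iff by (auto simp: algebra_simps)

lemma osp_sum: "(\<And>s. s \<in> A \<Longrightarrow> osp m n (X s)) \<Longrightarrow> osp m n (\<lambda>i j. \<Sum>s\<in>A. X s i j)"
proof (induction A rule: infinite_finite_induct)
  case (insert x F)
  then show ?case using osp_add[of m n "X x" "\<lambda>i j. \<Sum>s\<in>F. X s i j"] by simp
qed (use osp_zmat in \<open>auto simp: zmat_def\<close>)

text \<open>The summand with factor 2 turns the minus sign into a plus exactly at those middle
  indices j where both factors are odd entries.\<close>

lemma sbr_entry:
  "sbr m n X Y i k = (\<Sum>j\<in>idxs m n. X i j * Y j k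
     - (if odd_idx i \<noteq> odd_idx j \<and> odd_idx j \<noteq> odd_idx k then -1 else 1) * (Y i j * X j k))"
  unfolding sbr_def mmul_def sum_distrib_left sum_subtractf[symmetric] sum.distrib[symmetric]
  by (intro sum.cong refl) (auto simp: oddp_def)

text \<open>Sign bookkeeping for \<open>osp_sbr\<close>: passing to dual indices reverses each
  product and so exchanges the two terms of the supercommutator. Here s is the Koszul sign, a and b
  are the signs of the factors, and g is that of the result.\<close>

lemma sign_rearrange:
  fixes a b g s :: "'a::comm_ring_1"
  assumes "b * a = - g * s" "s * s = 1"
  shows "(a * x) * (b * y) - s * ((a * z) * (b * w)) = g * (w * z - s * (y * x))"
proof -
  have "(a * x) * (b * y) - s * ((a * z) * (b * w)) = (b * a) * (x * y) - s * ((b * a) * (z * w))"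
    by (simp add: algebra_simps)
  also have "\<dots> = (s * s) * (g * (w * z)) - g * s * (x * y)"
    unfolding assms(1) by (simp add: algebra_simps)
  finally show ?thesis by (simp add: assms(2) algebra_simps)
qed

lemma osp_sbr:
  assumes "osp m n X" "osp m n Y"
  shows "osp m n (sbr m n X Y)"
  unfolding osp_iff
proof (intro conjI allI impI)
  fix i k
  assume "sbr m n X Y i k \<noteq> 0"
  then obtain j where "X i j * Y j k \<noteq> 0 \<or> Y i j * X j k \<noteq> 0"
    unfolding sbr_entry by (metis (no_types, lifting) sum.neutral diff_zero mult_zero_right)
  then show "i \<in> idxs m n" "k \<in> idxs m n" using assms by (auto dest: ospD)
next
  fix i k
  let ?s = "\<lambda>i j k. if odd_idx i \<noteq> odd_idx j \<and> odd_idx j \<noteq> odd_idx k then -1 else 1 :: complex"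
  have "sbr m n X Y (du k) (du i) = (\<Sum>j\<in>idxs m n. X (du k) (du j) * Y (du j) (du i)
     - ?s k j i * (Y (du k) (du j) * X (du j) (du i)))"
    unfolding sbr_entry by (subst sum_idxs_du[symmetric]) simp
  also have "\<dots> = (\<Sum>j\<in>idxs m n. sg i k * (X i j * Y j k - ?s i j k * (Y i j * X j k)))"
  proof (intro sum.cong refl)
    fix j
    have s: "?s k j i = ?s i j k" by auto
    have "sg i j * sg j k = - sg i k * ?s i j k" using sg_trans[of i j k] by (auto split: if_splits)
    moreover have "?s i j k * ?s i j k = 1" by auto
    ultimately show "X (du k) (du j) * Y (du j) (du i) - ?s k j i * (Y (du k) (du j) * X (du j) (du i))
        = sg i k * (X i j * Y j k - ?s i j k * (Y i j * X j k))"
      unfolding s osp_dual[OF assms(1)] osp_dual[OF assms(2)]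
      by (rule sign_rearrange)
  qed
  also have "\<dots> = sg i k * sbr m n X Y i k" unfolding sbr_entry by (simp add: sum_distrib_left)
  finally show "sbr m n X Y (du k) (du i) = sg i k * sbr m n X Y i k" .
qed

text \<open>Twice the projection of the matrix unit at (a, b) onto osp. If b = \<open>du a\<close>,
  both positions coincide, and the matrix is zero for even a and twice a matrix unit for odd
  a.\<close>

definition Bmat :: "idx \<Rightarrow> idx \<Rightarrow> mat" where
  "Bmat a b = (\<lambda>i j. (if i = a \<and> j = b then 1 else 0) + (if i = du b \<and> j = du a then sg a b else 0))"

lemma osp_Bmat:
  assumes "a \<in> idxs m n" "b \<in> idxs m n"
  shows "osp m n (Bmat a b)"
  unfolding osp_iff
proof (intro conjI allI impI)
  fix i j
  define p q where "p \<longleftrightarrow> i = a \<and> j = b" and "q \<longleftrightarrow> i = du b \<and> j = du a"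
  have "(du j = a \<and> du i = b) = q" "(du j = du b \<and> du i = du a) = p" unfolding p_def q_def by (metis du_du)+
  then have 1: "Bmat a b (du j) (du i) = (if q then 1 else 0) + (if p then sg a b else 0)"
    unfolding Bmat_def by (simp only:)
  have 2: "Bmat a b i j = (if p then 1 else 0) + (if q then sg a b else 0)"
    unfolding Bmat_def p_def q_def by (simp only:)
  have "p \<Longrightarrow> sg i j = sg a b" "q \<Longrightarrow> sg i j * sg a b = 1" unfolding p_def q_def by (simp_all only: sg_du)
  then show "Bmat a b (du j) (du i) = sg i j * Bmat a b i j"
    unfolding 1 2 by (cases p; cases q; simp only: if_True if_False) (simp_all add: distrib_left)
qed (use assms in \<open>auto simp: Bmat_def split: if_splits\<close>)

lemma Bmat_nz: "Bmat a b i j \<noteq> 0 \<Longrightarrow> i = a \<and> j = b \<or> i = du b \<and> j = du a"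
  by (auto simp: Bmat_def split: if_splits)

lemma Bmat_sum:
  assumes "a \<in> idxs m n" "b \<in> idxs m n"
  shows "(\<Sum>j\<in>idxs m n. Bmat a b i j * g j) = (if i = a then g b else 0) + (if i = du b then sg a b * g (du a) else 0)"
proof -
  have "(\<Sum>j\<in>idxs m n. Bmat a b i j * g j) = (\<Sum>j\<in>idxs m n. (if j = b then (if i = a then g b else 0) else 0)
     + (if j = du a then (if i = du b then sg a b * g (du a) else 0) else 0))"
    by (intro sum.cong refl) (auto simp: Bmat_def distrib_right)
  then show ?thesis using assms by (simp add: sum.distrib)
qed

text \<open>Each entry is reached from its own label and from the dual label, hence the factor
  1/2.\<close>

lemma Bmat_decomp:
  assumes "osp m n X"
  shows "X i j = (\<Sum>(a,b)\<in>idxs m n \<times> idxs m n. X a b / 2 * Bmat a b i j)"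
proof (cases "i \<in> idxs m n \<and> j \<in> idxs m n")
  case True
  have "(\<Sum>(a,b)\<in>idxs m n \<times> idxs m n. X a b / 2 * Bmat a b i j)
     = (\<Sum>p\<in>idxs m n \<times> idxs m n. (if p = (i,j) then X i j / 2 else 0)
        + (if p = (du j, du i) then X (du j) (du i) / 2 * sg (du j) (du i) else 0))"
  proof (intro sum.cong refl)
    fix p :: "idx \<times> idx"
    obtain a b where p: "p = (a, b)" by (cases p)
    define P Q where "P \<longleftrightarrow> p = (i, j)" and "Q \<longleftrightarrow> p = (du j, du i)"
    have "(i = du b \<and> j = du a) = Q" "(i = a \<and> j = b) = P" unfolding p P_def Q_def by auto
    then have B: "Bmat a b i j = (if P then 1 else 0) + (if Q then sg a b else 0)"
      unfolding Bmat_def by (simp only:)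
    have "P \<Longrightarrow> X a b = X i j" "Q \<Longrightarrow> X a b * sg a b = X (du j) (du i) * sg (du j) (du i)"
      unfolding p P_def Q_def by (simp_all only: prod.inject)
    then have "X a b / 2 * Bmat a b i j = (if P then X i j / 2 else 0)
        + (if Q then X (du j) (du i) / 2 * sg (du j) (du i) else 0)"
      unfolding B by (cases P; cases Q; simp only: if_True if_False) (simp_all add: distrib_left)
    then show "(case p of (a, b) \<Rightarrow> X a b / 2 * Bmat a b i j) = (if p = (i,j) then X i j / 2 else 0)
        + (if p = (du j, du i) then X (du j) (du i) / 2 * sg (du j) (du i) else 0)"
      unfolding P_def Q_def by (simp only: p prod.case)
  qed
  also have "\<dots> = X i j / 2 + X (du j) (du i) / 2 * sg (du j) (du i)"
    using True by (simp add: sum.distrib)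
  also have "X (du j) (du i) / 2 * sg (du j) (du i) = sg (du j) (du i) * sg i j * X i j / 2"
    using osp_dual[OF assms, of j i] by simp
  finally show ?thesis by (simp add: sg_du)
next
  case False
  then have 0: "X i j = 0" using ospD[OF assms] by blast
  have "(\<Sum>(a,b)\<in>idxs m n \<times> idxs m n. X a b / 2 * Bmat a b i j) = 0"
  proof (rule sum.neutral, clarify)
    fix a b assume ab: "a \<in> idxs m n" "b \<in> idxs m n"
    have "Bmat a b i j = 0"
    proof (rule ccontr)
      assume "Bmat a b i j \<noteq> 0"
      from Bmat_nz[OF this] have "i \<in> idxs m n \<and> j \<in> idxs m n" using ab by (metis du_idxs)
      then show False using False by blast
    qed
    then show "X a b / 2 * Bmat a b i j = 0" by simp
  qed
  then show ?thesis using 0 by simp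
qed

text \<open>For a = \<open>Ep i\<close> this says that 2 eps_i is not a root, in contrast to 2
  delta_j.\<close>

lemma osp_even_dual_zero:
  assumes "osp m n X" "\<not> odd_idx a"
  shows "X a (du a) = 0"
  using osp_dual[OF assms(1), of "du a" a] assms(2) by (cases a) (auto simp: sg_def)

section \<open>The affine superalgebra\<close>

lemma ghat_setI: "finite (msupp (fst x)) \<Longrightarrow> (\<And>r. osp m n (fst x r)) \<Longrightarrow> x \<in> ghat_set m n"
  by (simp add: ghat_set_def)

lemma ghat_osp: "x \<in> ghat_set m n \<Longrightarrow> osp m n (fst x r)"
  by (simp add: ghat_set_def)

lemma ghat_fin: "x \<in> ghat_set m n \<Longrightarrow> finite (msupp (fst x))"
  by (simp add: ghat_set_def)

lemma zmat_nz: "X \<noteq> zmat \<longleftrightarrow> (\<exists>i j. X i j \<noteq> 0)"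
  by (auto simp: zmat_def fun_eq_iff)

lemma msupp_iff: "r \<in> msupp f \<longleftrightarrow> (\<exists>i j. f r i j \<noteq> 0)"
  by (auto simp: msupp_def zmat_nz)

lemma ghat_add: "x \<in> ghat_set m n \<Longrightarrow> y \<in> ghat_set m n \<Longrightarrow> gadd x y \<in> ghat_set m n"
proof (rule ghat_setI)
  assume a: "x \<in> ghat_set m n" "y \<in> ghat_set m n"
  have "msupp (fst (gadd x y)) \<subseteq> msupp (fst x) \<union> msupp (fst y)"
    by (auto simp: msupp_iff gadd_def)
  then show "finite (msupp (fst (gadd x y)))" using a[THEN ghat_fin] finite_subset by blast
  show "osp m n (fst (gadd x y) r)" for r
    using osp_add[OF a[THEN ghat_osp]] by (simp add: gadd_def)
qed

lemma ghat_scale: "x \<in> ghat_set m n \<Longrightarrow> gscale c x \<in> ghat_set m n"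
proof (rule ghat_setI)
  assume a: "x \<in> ghat_set m n"
  have "msupp (fst (gscale c x)) \<subseteq> msupp (fst x)"
    by (auto simp: msupp_iff gscale_def)
  then show "finite (msupp (fst (gscale c x)))" using a[THEN ghat_fin] finite_subset by blast
  show "osp m n (fst (gscale c x) r)" for r
    using osp_scale[OF a[THEN ghat_osp]] by (simp add: gscale_def)
qed

lemma gzero_ghat: "gzero \<in> ghat_set m n"
  by (rule ghat_setI) (auto simp: gzero_def msupp_def osp_zmat)

lemma ghat_eqI: "(\<And>r i j. fst x r i j = fst y r i j) \<Longrightarrow> fst (snd x) = fst (snd y) \<Longrightarrow> snd (snd x) = snd (snd y)
  \<Longrightarrow> (x::ghat) = y"
  by (metis ext prod.expand)

lemma gbr_fst:
  "fst (gbr m n x y) r i j = (\<Sum>s\<in>msupp (fst x). sbr m n (fst x s) (fst y (r - s)) i j)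
     + snd (snd x) * of_int r * fst y r i j - snd (snd y) * of_int r * fst x r i j"
  by (simp add: gbr_def)

lemma gbr_K: "fst (snd (gbr m n x y)) = (\<Sum>s\<in>msupp (fst x). of_int s * gform m n (fst x s) (fst y (- s)))"
  by (simp add: gbr_def)

lemma gbr_d: "snd (snd (gbr m n x y)) = 0"
  by (simp add: gbr_def)

lemma sbr_nz:
  assumes "sbr m n X Y i k \<noteq> 0" shows "\<exists>j. X i j \<noteq> 0 \<and> Y j k \<noteq> 0 \<or> Y i j \<noteq> 0 \<and> X j k \<noteq> 0"
proof (rule ccontr)
  assume "\<not> ?thesis"
  then have "X i j * Y j k = 0" "Y i j * X j k = 0" for j by auto
  then have "sbr m n X Y i k = 0" unfolding sbr_entry by (simp only: mult_zero_right diff_zero sum.neutral_const)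
  then show False using assms by simp
qed

lemma gbr_nz:
  assumes "fst (gbr m n x y) r i k \<noteq> 0"
  shows "(\<exists>s j. fst x s i j \<noteq> 0 \<and> fst y (r - s) j k \<noteq> 0) \<or> (\<exists>s j. fst y (r - s) i j \<noteq> 0 \<and> fst x s j k \<noteq> 0)
    \<or> snd (snd x) \<noteq> 0 \<and> fst y r i k \<noteq> 0 \<or> snd (snd y) \<noteq> 0 \<and> fst x r i k \<noteq> 0"
proof (cases "\<exists>s. sbr m n (fst x s) (fst y (r - s)) i k \<noteq> 0")
  case True
  then show ?thesis using sbr_nz by blast
next
  case False
  then show ?thesis using assms unfolding gbr_fst by auto
qed

lemma gform_nz:
  assumes "gform m n X Y \<noteq> 0"
  shows "\<exists>i j. X i j \<noteq> 0 \<and> Y j i \<noteq> 0"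
proof (rule ccontr)
  assume a: "\<not> ?thesis"
  have "mmul m n X Y i i = 0" for i
    unfolding mmul_def using a by (intro sum.neutral) auto
  then have "gform m n X Y = 0" unfolding gform_def str_def by (simp cong: if_cong)
  then show False using assms by simp
qed

lemma gbr_K_nz:
  assumes "fst (snd (gbr m n x y)) \<noteq> 0"
  shows "\<exists>s i j. fst x s i j \<noteq> 0 \<and> fst y (-s) j i \<noteq> 0"
proof -
  obtain s where "gform m n (fst x s) (fst y (- s)) \<noteq> 0"
    using assms unfolding gbr_K by (metis (no_types, lifting) sum.neutral mult_eq_0_iff)
  then show ?thesis using gform_nz by blast
qed

lemma gbr_ghat:
  assumes "x \<in> ghat_set m n" "y \<in> ghat_set m n"
  shows "gbr m n x y \<in> ghat_set m n"
proof (rule ghat_setI)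
  let ?A = "(\<lambda>(r,s). r + s) ` (msupp (fst x) \<times> msupp (fst y)) \<union> msupp (fst x) \<union> msupp (fst y)"
  have "msupp (fst (gbr m n x y)) \<subseteq> ?A"
  proof
    fix r assume "r \<in> msupp (fst (gbr m n x y))"
    then obtain i k where "fst (gbr m n x y) r i k \<noteq> 0" by (auto simp: msupp_iff)
    then have "(\<exists>s. s \<in> msupp (fst x) \<and> r - s \<in> msupp (fst y)) \<or> r \<in> msupp (fst y) \<or> r \<in> msupp (fst x)"
      using gbr_nz[of m n x y r i k] unfolding msupp_iff by blast
    moreover have "r \<in> (\<lambda>(r,s). r + s) ` (msupp (fst x) \<times> msupp (fst y))"
      if "s \<in> msupp (fst x)" "r - s \<in> msupp (fst y)" for s
      using that by (auto intro!: image_eqI[of _ _ "(s, r - s)"])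
    ultimately show "r \<in> ?A" by blast
  qed
  moreover have "finite ?A" using assms ghat_fin by blast
  ultimately show "finite (msupp (fst (gbr m n x y)))" using finite_subset by blast
  fix r
  have "osp m n (\<lambda>i j. (\<Sum>s\<in>msupp (fst x). sbr m n (fst x s) (fst y (r - s)) i j)
       + (snd (snd x) * of_int r) * fst y r i j)"
    using assms by (intro osp_add osp_sum osp_sbr osp_scale ghat_osp)
  from osp_add[OF this, of "\<lambda>i j. (- snd (snd y) * of_int r) * fst x r i j"]
  show "osp m n (fst (gbr m n x y) r)"
    using osp_scale[OF ghat_osp[OF assms(1)], of "- snd (snd y) * of_int r" r] by (simp add: gbr_def)
qed

section \<open>Root vectors, the Cartan subalgebra and coroots\<close>

definition Bt :: "idx \<Rightarrow> idx \<Rightarrow> int \<Rightarrow> ghat" where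
  "Bt a b r = (\<lambda>s. if s = r then Bmat a b else zmat, 0, 0)"

lemma fst_Bt: "fst (Bt a b r) s i j = (if s = r then Bmat a b i j else 0)"
  by (simp add: Bt_def zmat_def)

lemma snd_Bt [simp]: "fst (snd (Bt a b r)) = 0" "snd (snd (Bt a b r)) = 0"
  by (simp_all add: Bt_def)

lemma Bt_ghat:
  assumes "a \<in> idxs m n" "b \<in> idxs m n"
  shows "Bt a b r \<in> ghat_set m n"
proof (rule ghat_setI)
  have "msupp (fst (Bt a b r)) \<subseteq> {r}" by (auto simp: msupp_iff fst_Bt split: if_splits)
  then show "finite (msupp (fst (Bt a b r)))" using finite_subset by blast
  show "osp m n (fst (Bt a b r) s)" for s
    using osp_Bmat[OF assms] osp_zmat by (simp add: Bt_def)
qed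

lemma Bmat_parity: "(odd_idx i = odd_idx j) \<noteq> (odd_idx a = odd_idx b) \<Longrightarrow> Bmat a b i j = 0"
  by (rule ccontr) (auto dest!: Bmat_nz)

lemma geven_Bt: "odd_idx a = odd_idx b \<Longrightarrow> geven (Bt a b r)"
  unfolding geven_def oddp_def zmat_def fst_Bt by (auto simp: fun_eq_iff intro!: Bmat_parity)

lemma godd_Bt: "odd_idx a \<noteq> odd_idx b \<Longrightarrow> godd (Bt a b r)"
  unfolding godd_def evenp_def zmat_def fst_Bt by (auto simp: fun_eq_iff intro!: Bmat_parity)

lemma homog_Bt: "homog (Bt a b r)"
  using geven_Bt godd_Bt unfolding homog_def by blast

lemma sum_msupp_single:
  assumes "\<And>s. s \<noteq> p \<Longrightarrow> f s = zmat" "g zmat p = (0::complex)"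
  shows "(\<Sum>s\<in>msupp f. g (f s) s) = g (f p) p"
proof -
  have "msupp f \<subseteq> {p}" using assms(1) by (auto simp: msupp_def)
  then have "(\<Sum>s\<in>msupp f. g (f s) s) = (\<Sum>s\<in>{p}. g (f s) s)"
    using assms(2) by (intro sum.mono_neutral_left) (auto simp: msupp_def)
  then show ?thesis by simp
qed

lemma sbr_zmat [simp]: "sbr m n zmat Y i k = 0" "sbr m n Y zmat i k = 0"
  by (simp_all add: sbr_entry zmat_def)

lemma gform_zmat [simp]: "gform m n zmat Y = 0" "gform m n Y zmat = 0"
  by (simp_all add: gform_def str_def mmul_def zmat_def cong: if_cong)

lemma hhatD:
  assumes "h \<in> hhat m n"
  shows "r \<noteq> 0 \<Longrightarrow> fst h r = zmat" "osp m n (fst h 0)" "i \<noteq> j \<Longrightarrow> fst h 0 i j = 0"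
  using assms by (auto simp: hhat_def)

lemma hhat_ghat: "h \<in> hhat m n \<Longrightarrow> h \<in> ghat_set m n"
proof (rule ghat_setI)
  assume h: "h \<in> hhat m n"
  have "msupp (fst h) \<subseteq> {0}" using hhatD(1)[OF h] by (auto simp: msupp_def)
  then show "finite (msupp (fst h))" using finite_subset by blast
  show "osp m n (fst h s)" for s
    using hhatD(1,2)[OF h] osp_zmat by (cases "s = 0") auto
qed

lemma geven_hhat: "h \<in> hhat m n \<Longrightarrow> geven h"
  unfolding geven_def
proof
  fix r assume h: "h \<in> hhat m n"
  have "oddp (fst h r) i j = 0" for i j
    using hhatD(1)[OF h, of r] hhatD(3)[OF h, of i j] by (cases "r = 0"; cases "i = j") (auto simp: oddp_def zmat_def)
  then show "oddp (fst h r) = zmat" by (simp add: zmat_def fun_eq_iff)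
qed

text \<open>The value at h of the root of \<open>Bt a b r\<close>: a difference of two weights of
  the natural module plus r times delta.\<close>

definition wt :: "ghat \<Rightarrow> idx \<Rightarrow> idx \<Rightarrow> int \<Rightarrow> complex" where
  "wt h a b r = fst h 0 a a - fst h 0 b b + snd (snd h) * of_int r"

lemma hhat_du: "h \<in> hhat m n \<Longrightarrow> fst h 0 (du i) (du i) = - fst h 0 i i"
  using osp_dual[OF hhatD(2), of h m n i i] by (cases i) (auto simp: sg_def)

lemma hhat_E0 [simp]: "h \<in> hhat m n \<Longrightarrow> fst h 0 E0 E0 = 0"
  using hhat_du[of h m n E0] by simp

lemma gbr_hhat:
  assumes h: "h \<in> hhat m n" and x: "x \<in> ghat_set m n"
  shows "gbr m n h x = (\<lambda>r i k. wt h i k r * fst x r i k, 0, 0)"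
proof (rule ghat_eqI)
  fix r i k
  have "(\<Sum>s\<in>msupp (fst h). sbr m n (fst h s) (fst x (r - s)) i k) = sbr m n (fst h 0) (fst x r) i k"
    using sum_msupp_single[of 0 "fst h" "\<lambda>X s. sbr m n X (fst x (r - s)) i k"] hhatD(1)[OF h] by simp
  also have "\<dots> = (\<Sum>j\<in>idxs m n. (if j = i then fst h 0 i i * fst x r i k else 0)
      - (if j = k then fst x r i k * fst h 0 k k else 0))"
    unfolding sbr_entry by (intro sum.cong refl) (auto simp: hhatD(3)[OF h])
  also have "\<dots> = (fst h 0 i i - fst h 0 k k) * fst x r i k"
  proof (cases "fst x r i k = 0")
    case True then show ?thesis by (simp cong: if_cong)
  next
    case False
    with ospD[OF ghat_osp[OF x]] have "i \<in> idxs m n" "k \<in> idxs m n" by blast+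
    then show ?thesis by (simp add: sum_subtractf algebra_simps)
  qed
  finally have 1: "(\<Sum>s\<in>msupp (fst h). sbr m n (fst h s) (fst x (r - s)) i k)
     = (fst h 0 i i - fst h 0 k k) * fst x r i k" .
  have "snd (snd x) * of_int r * fst h r i k = 0"
    using hhatD(1)[OF h, of r] by (cases "r = 0") (auto simp: zmat_def)
  then show "fst (gbr m n h x) r i k = fst (\<lambda>r i k. wt h i k r * fst x r i k, 0::complex, 0::complex) r i k"
    unfolding gbr_fst 1 by (simp add: wt_def algebra_simps)
next
  have "(\<Sum>s\<in>msupp (fst h). of_int s * gform m n (fst h s) (fst x (- s))) = of_int 0 * gform m n (fst h 0) (fst x (-0))"
    by (rule sum_msupp_single[of 0 "fst h" "\<lambda>X s. of_int s * gform m n X (fst x (- s))"]) (use hhatD(1)[OF h] in auto)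
  then show "fst (snd (gbr m n h x)) = fst (snd (\<lambda>r i k. wt h i k r * fst x r i k, 0, 0))"
    by (simp add: gbr_K)
qed (simp add: gbr_d)

lemma gbr_hhat_Bt:
  assumes h: "h \<in> hhat m n" and ab: "a \<in> idxs m n" "b \<in> idxs m n"
  shows "gbr m n h (Bt a b r) = gscale (wt h a b r) (Bt a b r)"
proof -
  have *: "wt h i k s * fst (Bt a b r) s i k = wt h a b r * fst (Bt a b r) s i k" for s i k
  proof (cases "fst (Bt a b r) s i k = 0")
    case False
    then have "s = r" "Bmat a b i k \<noteq> 0" by (auto simp: fst_Bt split: if_splits)
    with Bmat_nz[of a b i k] have "wt h i k s = wt h a b r"
      by (auto simp: wt_def hhat_du[OF h])
    then show ?thesis by simp
  qed simp
  show ?thesis unfolding gbr_hhat[OF h Bt_ghat[OF ab]] by (simp only: * gscale_def snd_Bt mult_zero_right)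
qed

text \<open>The bracket of \<open>Bt a b r\<close> with \<open>Bt b a (-r)\<close>, see
  \<open>gbr_Bt_Bt\<close>. For even a and b with a different from b and \<open>du b\<close> it is a
  multiple of the coroot: the root takes the value 2 on it, or 1 if a or b is
  \<open>E0\<close>.\<close>

definition hco :: "idx \<Rightarrow> idx \<Rightarrow> int \<Rightarrow> ghat" where
  "hco a b r = (\<lambda>s i j. if s = 0 \<and> i = j then of_bool (i = a) - of_bool (i = du a)
      + (if odd_idx a = odd_idx b then 1 else -1) * (of_bool (i = du b) - of_bool (i = b)) else 0, of_int r, 0)"

lemma Bmat_row:
  assumes "a \<noteq> b" "a \<noteq> du b"
  shows "Bmat a b a k = of_bool (k = b)" "Bmat a b (du b) k = of_bool (k = du a) * sg a b"
proof -
  have "du b \<noteq> a" using assms by auto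
  then show "Bmat a b a k = of_bool (k = b)" "Bmat a b (du b) k = of_bool (k = du a) * sg a b"
    using assms by (simp_all add: Bmat_def)
qed

lemma sg_sg: "sg a b * sg b a = (if odd_idx a = odd_idx b then 1 else -1)"
  by (cases a; cases b) (auto simp: sg_def)

lemma mmul_Bmat:
  assumes ab: "a \<in> idxs m n" "b \<in> idxs m n" "a \<noteq> b" "a \<noteq> du b"
  shows "mmul m n (Bmat a b) (Bmat b a) i k =
    of_bool (i = a \<and> k = a) + (if odd_idx a = odd_idx b then 1 else -1) * of_bool (i = du b \<and> k = du b)"
proof -
  have ba: "b \<noteq> a" "b \<noteq> du a" using ab(3,4) by auto
  have "mmul m n (Bmat a b) (Bmat b a) i k = (if i = a then of_bool (k = a) else 0)
     + (if i = du b then sg a b * (of_bool (k = du b) * sg b a) else 0)"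
    unfolding mmul_def Bmat_sum[OF ab(1,2)] Bmat_row[OF ba] ..
  also have "\<dots> = of_bool (i = a \<and> k = a) + (sg a b * sg b a) * of_bool (i = du b \<and> k = du b)"
    by simp
  finally show ?thesis unfolding sg_sg .
qed

text \<open>All nonzero summands join the parities of a and b, so the Koszul sign depends on the
  label only and comes out of the sum.\<close>

lemma sbr_Bmat_parity:
  "sbr m n (Bmat a b) (Bmat b a) i k = mmul m n (Bmat a b) (Bmat b a) i k
     - (if odd_idx a = odd_idx b then 1 else -1) * mmul m n (Bmat b a) (Bmat a b) i k"
proof -
  have *: "(if odd_idx i \<noteq> odd_idx j \<and> odd_idx j \<noteq> odd_idx k then -1 else 1) * (Bmat b a i j * Bmat a b j k)
    = (if odd_idx a = odd_idx b then 1 else -1) * (Bmat b a i j * Bmat a b j k)" for j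
  proof (cases "Bmat b a i j * Bmat a b j k = 0")
    case False
    then have "odd_idx i = odd_idx b \<and> odd_idx j = odd_idx a \<or> odd_idx i = odd_idx a \<and> odd_idx j = odd_idx b"
      "odd_idx j = odd_idx b \<and> odd_idx k = odd_idx a \<or> odd_idx j = odd_idx a \<and> odd_idx k = odd_idx b"
      using Bmat_nz[of b a i j] Bmat_nz[of a b j k] by auto
    then show ?thesis by auto
  qed simp
  show ?thesis unfolding sbr_entry mmul_def by (simp only: * sum_subtractf sum_distrib_left)
qed

lemma gbr_Bt_Bt:
  assumes ab: "a \<in> idxs m n" "b \<in> idxs m n" "a \<noteq> b" "a \<noteq> du b" "\<not> odd_idx a"
  shows "gbr m n (Bt a b r) (Bt b a (-r)) = hco a b r"
proof (rule ghat_eqI)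
  fix s i k
  have ba: "b \<noteq> a" "b \<noteq> du a" using ab(3,4) by auto
  have "(\<Sum>t\<in>msupp (fst (Bt a b r)). sbr m n (fst (Bt a b r) t) (fst (Bt b a (-r)) (s - t)) i k)
    = sbr m n (Bmat a b) (fst (Bt b a (-r)) (s - r)) i k"
    using sum_msupp_single[of r "fst (Bt a b r)" "\<lambda>X t. sbr m n X (fst (Bt b a (-r)) (s - t)) i k"]
    by (simp add: Bt_def)
  also have "\<dots> = (if s = 0 then sbr m n (Bmat a b) (Bmat b a) i k else 0)" by (simp add: Bt_def)
  moreover have single: "of_bool (i = c \<and> k = c) = (if i = k then of_bool (i = c) else 0 :: complex)" for c by auto
  ultimately show "fst (gbr m n (Bt a b r) (Bt b a (-r))) s i k = fst (hco a b r) s i k"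
    unfolding gbr_fst sbr_Bmat_parity mmul_Bmat[OF ab(1-4)] mmul_Bmat[OF ab(2,1) ba]
    by (cases "s = 0"; cases "i = k"; cases "odd_idx a = odd_idx b") (simp_all add: hco_def single algebra_simps)
next
  have "(\<Sum>t\<in>msupp (fst (Bt a b r)). of_int t * gform m n (fst (Bt a b r) t) (fst (Bt b a (-r)) (- t)))
    = of_int r * gform m n (Bmat a b) (Bmat b a)"
    using sum_msupp_single[of r "fst (Bt a b r)" "\<lambda>X t. of_int t * gform m n X (fst (Bt b a (-r)) (- t))"]
    by (simp add: Bt_def)
  moreover have "str m n (mmul m n (Bmat a b) (Bmat b a)) = 2"
  proof -
    have "str m n (mmul m n (Bmat a b) (Bmat b a)) = (\<Sum>i\<in>idxs m n. (if i = a then 1 else 0) + (if i = du b then 1 else 0))"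
      unfolding str_def mmul_Bmat[OF ab(1-4)] using ab(5) by (intro sum.cong refl) auto
    then show ?thesis using ab by (simp add: sum.distrib)
  qed
  ultimately show "fst (snd (gbr m n (Bt a b r) (Bt b a (-r)))) = fst (snd (hco a b r))"
    by (simp add: gbr_K gform_def hco_def)
qed (simp add: gbr_d hco_def)

lemma hco_hhat:
  assumes "a \<in> idxs m n" "b \<in> idxs m n" "a \<noteq> b" "a \<noteq> du b" "\<not> odd_idx a"
  shows "hco a b r \<in> hhat m n"
proof -
  have "hco a b r \<in> ghat_set m n"
    using gbr_ghat[OF Bt_ghat Bt_ghat, of a m n b b a r "-r"] gbr_Bt_Bt[OF assms] assms by simp
  then have "osp m n (fst (hco a b r) 0)" by (rule ghat_osp)
  moreover have "\<forall>s. s \<noteq> 0 \<longrightarrow> fst (hco a b r) s = zmat" "\<forall>i j. i \<noteq> j \<longrightarrow> fst (hco a b r) 0 i j = 0"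
    by (simp_all add: hco_def zmat_def)
  ultimately show ?thesis by (simp add: hhat_def)
qed

text \<open>The grading element: it acts on \<open>Bt a b r\<close> by the integer
  \<open>l a - l b + D * r\<close>, the height attached to l and D.\<close>

definition hl :: "nat \<Rightarrow> nat \<Rightarrow> (idx \<Rightarrow> int) \<Rightarrow> int \<Rightarrow> ghat" where
  "hl m n l D = (\<lambda>s i j. if s = 0 \<and> i = j \<and> i \<in> idxs m n then of_int (l i) else 0, 0, of_int D)"

lemma hl_hhat:
  assumes "\<And>i. l (du i) = - l i"
  shows "hl m n l D \<in> hhat m n"
proof -
  have s: "sg i i = -1" for i by (cases i) (auto simp: sg_def)
  have "osp m n (fst (hl m n l D) 0)"
    unfolding osp_iff by (auto simp: hl_def s assms)
  then show ?thesis by (auto simp: hhat_def hl_def zmat_def)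
qed

lemma wt_hl: "a \<in> idxs m n \<Longrightarrow> b \<in> idxs m n \<Longrightarrow> wt (hl m n l D) a b r = of_int (l a - l b + D * r)"
  by (simp add: wt_def hl_def)

lemma gbr_gzero: "gbr m n gzero y = gzero"
proof -
  have "msupp (fst gzero) = {}" by (auto simp: msupp_def gzero_def)
  then show ?thesis by (simp add: gbr_def gzero_def zmat_def)
qed

lemma geven_godd_gzero: "geven x \<Longrightarrow> godd x \<Longrightarrow> x = gzero"
proof (rule ghat_eqI)
  fix r i j assume e: "geven x" and o: "godd x"
  have "oddp (fst x r) i j = 0" "evenp (fst x r) i j = 0" using e o by (auto simp: geven_def godd_def zmat_def)
  then show "fst x r i j = fst gzero r i j" by (auto simp: gzero_def zmat_def oddp_def evenp_def split: if_splits)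
qed (auto simp: godd_def gzero_def)

text \<open>The index set is an argument so that \<open>act_mem\<close> can assemble an arbitrary
  element one root vector at a time.\<close>

definition gcomb :: "(int \<times> idx \<times> idx) set \<Rightarrow> (int \<times> idx \<times> idx \<Rightarrow> complex) \<Rightarrow> complex \<Rightarrow> complex \<Rightarrow> ghat" where
  "gcomb A c k e = (\<lambda>s i j. \<Sum>(r,a,b)\<in>A. c (r,a,b) * fst (Bt a b r) s i j, k, e)"

lemma ghat_gcomb:
  assumes x: "x \<in> ghat_set m n"
  shows "x = gcomb (msupp (fst x) \<times> idxs m n \<times> idxs m n) (\<lambda>(r,a,b). fst x r a b / 2) (fst (snd x)) (snd (snd x))"
proof (rule ghat_eqI)
  fix s i j
  have "(\<Sum>(r,a,b)\<in>msupp (fst x) \<times> idxs m n \<times> idxs m n. fst x r a b / 2 * fst (Bt a b r) s i j)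
    = (\<Sum>r\<in>msupp (fst x). \<Sum>(a,b)\<in>idxs m n \<times> idxs m n. fst x r a b / 2 * fst (Bt a b r) s i j)"
    by (simp add: sum.cartesian_product)
  also have "\<dots> = (\<Sum>r\<in>msupp (fst x). if r = s then fst x s i j else 0)"
  proof (intro sum.cong refl)
    fix r
    show "(\<Sum>(a,b)\<in>idxs m n \<times> idxs m n. fst x r a b / 2 * fst (Bt a b r) s i j) = (if r = s then fst x s i j else 0)"
    proof (cases "r = s")
      case True
      then show ?thesis using Bmat_decomp[OF ghat_osp[OF x, of s], of i j] by (simp add: fst_Bt)
    qed (simp add: fst_Bt case_prod_beta)
  qed
  also have "\<dots> = fst x s i j"
    using ghat_fin[OF x] by (auto simp: msupp_iff)
  finally show "fst x s i j = fst (gcomb (msupp (fst x) \<times> idxs m n \<times> idxs m n) (\<lambda>(r,a,b). fst x r a b / 2) (fst (snd x)) (snd (snd x))) s i j"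
    by (simp add: gcomb_def case_prod_beta)
qed (simp_all add: gcomb_def)

lemma gcomb_empty: "gcomb {} c k e = gadd (gscale k Kel) (gscale e del)"
  by (simp add: gcomb_def gadd_def gscale_def Kel_def del_def zmat_def)

lemma gcomb_insert:
  "finite A \<Longrightarrow> (r,a,b) \<notin> A \<Longrightarrow> gcomb (insert (r,a,b) A) c k e = gadd (gscale (c (r,a,b)) (Bt a b r)) (gcomb A c k e)"
  by (simp add: gcomb_def gadd_def gscale_def)

lemma Kel_hhat: "Kel \<in> hhat m n"
  using osp_zmat by (auto simp: hhat_def Kel_def zmat_def)

lemma del_hhat: "del \<in> hhat m n"
  using osp_zmat by (auto simp: hhat_def del_def zmat_def)

lemma gbr_Kel: "x \<in> ghat_set m n \<Longrightarrow> gbr m n Kel x = gzero"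
proof -
  assume "x \<in> ghat_set m n"
  moreover have "wt Kel i k r = 0" for i k r by (simp add: wt_def Kel_def zmat_def)
  ultimately show ?thesis by (simp add: gbr_hhat[OF Kel_hhat] zmat_def gzero_def)
qed

section \<open>Modules\<close>

text \<open>Every function on indices that is odd under \<open>du\<close> grades the superalgebra,
  and this is visible from the positions of nonzero entries alone.\<close>

lemma gbr_Bt_grade:
  assumes nz: "fst (gbr m n (Bt a b r) (Bt c d s)) t i k \<noteq> 0" and phi: "\<And>i. phi (du i) = - (phi i :: int)"
  shows "phi i - phi k = (phi a - phi b) + (phi c - phi d)" "t = r + s"
proof -
  have *: "phi i - phi j = phi a - phi b" if "Bmat a b i j \<noteq> 0" for i j a b
    using Bmat_nz[OF that] phi by auto
  from gbr_nz[OF nz] obtain t' j where "fst (Bt a b r) t' i j \<noteq> 0 \<and> fst (Bt c d s) (t - t') j k \<noteq> 0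
      \<or> fst (Bt c d s) (t - t') i j \<noteq> 0 \<and> fst (Bt a b r) t' j k \<noteq> 0"
    by (auto simp only: snd_Bt)
  then have "t' = r \<and> t - t' = s \<and> (Bmat a b i j \<noteq> 0 \<and> Bmat c d j k \<noteq> 0 \<or> Bmat c d i j \<noteq> 0 \<and> Bmat a b j k \<noteq> 0)"
    by (auto simp only: fst_Bt split: if_splits)
  then show "phi i - phi k = (phi a - phi b) + (phi c - phi d)" "t = r + s"
    using *[of a b i j] *[of c d j k] *[of c d i j] *[of a b j k] by auto
qed

section \<open>Nilpotent vectors and eigenvalues of a linear operator\<close>

lemma (in vector_space) subspace_UN_chain:
  assumes "0 \<in> S 0" "\<And>i. subspace (S i)" "\<And>i j. i \<le> j \<Longrightarrow> S i \<subseteq> S j"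
  shows "subspace (\<Union>i::nat. S i)"
proof (rule subspaceI)
  show "0 \<in> (\<Union>i. S i)" using assms(1) by blast
  fix x y assume "x \<in> (\<Union>i. S i)" "y \<in> (\<Union>i. S i)"
  then obtain i j where "x \<in> S i" "y \<in> S j" by blast
  then have "x \<in> S (max i j)" "y \<in> S (max i j)"
    using assms(3)[of i "max i j"] assms(3)[of j "max i j"] by auto
  then show "x + y \<in> (\<Union>i. S i)" using subspace_add[OF assms(2)] by blast
next
  fix c x assume "x \<in> (\<Union>i. S i)"
  then show "scale c x \<in> (\<Union>i. S i)" using subspace_scale[OF assms(2)] by blast
qed

locale vs_endo = vector_space scale for scale :: "complex \<Rightarrow> 'v \<Rightarrow> 'v::ab_group_add" +
  fixes T :: "'v \<Rightarrow> 'v"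
  assumes T_add: "T (x + y) = T x + T y" and T_scale: "T (scale c x) = scale c (T x)"
begin

lemma T_0: "T 0 = 0"
  using T_scale[of 0 0] by simp

lemma T_pow: "(T ^^ N) (x + y) = (T ^^ N) x + (T ^^ N) y" "(T ^^ N) (scale c x) = scale c ((T ^^ N) x)" "(T ^^ N) 0 = 0"
  by (induction N) (auto simp: T_add T_scale T_0)

lemma subspace_nilpotent: "subspace {w. \<exists>N. (T ^^ N) w = 0}"
proof -
  have "subspace (\<Union>N. {w. (T ^^ N) w = 0})"
  proof (rule subspace_UN_chain)
    show "subspace {w. (T ^^ N) w = 0}" for N by (rule subspaceI) (auto simp: T_pow)
    show "{w. (T ^^ i) w = 0} \<subseteq> {w. (T ^^ j) w = 0}" if "i \<le> j" for i j
      using le_Suc_ex[OF that] by (auto simp: funpow_add T_pow add.commute[of i])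
  qed simp
  moreover have "(\<Union>N. {w. (T ^^ N) w = 0}) = {w. \<exists>N. (T ^^ N) w = 0}" by auto
  ultimately show ?thesis by simp
qed

fun annih :: "(nat \<Rightarrow> complex) \<Rightarrow> nat \<Rightarrow> 'v \<Rightarrow> 'v" where
  "annih f 0 w = w"
| "annih f (Suc M) w = T (annih f M w) - scale (f M) (annih f M w)"

lemma annih_add: "annih f M (x + y) = annih f M x + annih f M y"
  by (induction M) (auto simp: T_add scale_right_distrib)

lemma annih_scale: "annih f M (scale c x) = scale c (annih f M x)"
  by (induction M) (auto simp: T_scale scale_right_diff_distrib mult.commute)

lemma annih_0: "annih f M 0 = 0"
  by (induction M) (auto simp: T_0)

lemma annih_mono: "M \<le> M' \<Longrightarrow> annih f M w = 0 \<Longrightarrow> annih f M' w = 0"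
  by (induction M' rule: dec_induct) (auto simp: T_0)

lemma annih_eigen: "T w = scale \<mu> w \<Longrightarrow> annih f M w = scale (\<Prod>j<M. \<mu> - f j) w"
  by (induction M) (auto simp: T_scale scale_left_diff_distrib algebra_simps)

text \<open>The vectors killed by a product of finitely many factors T - f j form a subspace
  containing all the given eigenspaces. On an eigenvector such a product is the scalar with factors
  \<mu> - f j, so one of these factors is zero.\<close>

lemma span_eigen_eigenvalue:
  assumes "w \<in> span (\<Union>j::nat. {u. T u = scale (f j) u})" "T w = scale \<mu> w" "w \<noteq> 0"
  shows "\<exists>j. \<mu> = f j"
proof (rule ccontr)
  assume nex: "\<not> ?thesis"
  have "subspace (\<Union>M. {u. annih f M u = 0})"
  proof (rule subspace_UN_chain)
    show "subspace {w. annih f N w = 0}" for N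
      by (rule subspaceI) (auto simp: annih_add annih_scale annih_0)
  qed (use annih_mono in \<open>auto simp: annih_0\<close>)
  moreover have "u \<in> (\<Union>M. {u. annih f M u = 0})" if "T u = scale (f j) u" for u j
    using annih_eigen[OF that, of f "Suc j"] by (auto simp del: annih.simps simp: prod.lessThan_Suc)
  ultimately have "w \<in> (\<Union>M. {u. annih f M u = 0})"
    using span_minimal[of "\<Union>j. {u. T u = scale (f j) u}" "\<Union>M. {u. annih f M u = 0}"] assms(1) by blast
  then obtain M where "annih f M w = 0" by blast
  then have "(\<Prod>j<M. \<mu> - f j) = 0" using annih_eigen[OF assms(2)] assms(3) by simp
  then show False using nex by (auto simp: prod_zero_iff)
qed

end

section \<open>Modules over the affine superalgebra\<close>

locale osp_module =
  fixes m n :: nat and sc :: "complex \<Rightarrow> 'v::ab_group_add \<Rightarrow> 'v" and \<rho> :: "ghat \<Rightarrow> 'v \<Rightarrow> 'v"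
  assumes gmodule: "gmodule m n sc \<rho>"
begin

sublocale vector_space sc
  using gmodule unfolding gmodule_def vector_space_def module_def by simp

text \<open>The key identity of sl(2) theory, with the weight of \<open>E\<close> normalized to \<open>t\<close> instead of 2.\<close>
lemma sl2_string:
  assumes E: "\<And>c x. E (sc c x) = sc c (E x)" and F: "\<And>c x. F (sc c x) = sc c (F x)"
    and EF: "\<And>w. E (F w) = F (E w) + H w"
    and HF: "\<And>w \<mu>. H w = sc \<mu> w \<Longrightarrow> H (F w) = sc (\<mu> - t) (F w)"
    and w: "E w = 0" "H w = sc \<nu> w"
  shows "H ((F ^^ N) w) = sc (\<nu> - of_nat N * t) ((F ^^ N) w)"
    "E ((F ^^ Suc N) w) = sc (of_nat (Suc N) * (\<nu> - of_nat N * t / 2)) ((F ^^ N) w)"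
proof -
  show H: "H ((F ^^ N) w) = sc (\<nu> - of_nat N * t) ((F ^^ N) w)" for N
  proof (induction N)
    case (Suc N)
    from HF[OF Suc] show ?case by (simp add: algebra_simps)
  qed (simp add: w)
  have F0: "F 0 = 0" using F[of 0 0] by simp
  show "E ((F ^^ Suc N) w) = sc (of_nat (Suc N) * (\<nu> - of_nat N * t / 2)) ((F ^^ N) w)"
  proof (induction N)
    case 0
    then show ?case by (simp add: EF w F0)
  next
    case (Suc N)
    have "E ((F ^^ Suc (Suc N)) w) = F (E ((F ^^ Suc N) w)) + H ((F ^^ Suc N) w)"
      by (simp add: EF)
    also have "\<dots> = sc (of_nat (Suc N) * (\<nu> - of_nat N * t / 2)) ((F ^^ Suc N) w)
        + sc (\<nu> - of_nat (Suc N) * t) ((F ^^ Suc N) w)"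
      unfolding Suc H[of "Suc N"] by (simp add: F)
    also have "\<dots> = sc (of_nat (Suc (Suc N)) * (\<nu> - of_nat (Suc N) * t / 2)) ((F ^^ Suc N) w)"
      unfolding scale_left_distrib[symmetric] by (rule arg_cong[where f = "\<lambda>c. sc c _"]) (simp add: field_simps)
    finally show ?case .
  qed
qed

abbreviation X :: "idx \<Rightarrow> idx \<Rightarrow> int \<Rightarrow> 'v \<Rightarrow> 'v" where
  "X a b r \<equiv> \<rho> (Bt a b r)"

abbreviation I :: "idx set" where "I \<equiv> idxs m n"

lemma rho_endo: "x \<in> ghat_set m n \<Longrightarrow> vs_endo sc (\<rho> x)"
  using gmodule unfolding gmodule_def by unfold_locales auto

lemmas rho_add = vs_endo.T_add[OF rho_endo]
lemmas rho_scale = vs_endo.T_scale[OF rho_endo]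
lemmas rho_0 = vs_endo.T_0[OF rho_endo]

lemma rho_gadd: "x \<in> ghat_set m n \<Longrightarrow> y \<in> ghat_set m n \<Longrightarrow> \<rho> (gadd x y) w = \<rho> x w + \<rho> y w"
  using gmodule unfolding gmodule_def by blast

lemma rho_gscale: "x \<in> ghat_set m n \<Longrightarrow> \<rho> (gscale a x) w = sc a (\<rho> x w)"
  using gmodule unfolding gmodule_def by blast

lemma rho_gzero: "\<rho> gzero w = 0"
proof -
  have "gscale 0 gzero = gzero" by (simp add: gscale_def gzero_def zmat_def)
  then show ?thesis using rho_gscale[OF gzero_ghat, of 0 w] by simp
qed

text \<open>The scalar is 1 or -1 according to parity; leaving it unspecified treats even and odd
  root vectors at once.\<close>

lemma rho_comm:
  assumes "x \<in> ghat_set m n" "y \<in> ghat_set m n" "homog x" "homog y"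
  shows "\<exists>c. \<rho> x (\<rho> y w) = sc c (\<rho> y (\<rho> x w)) + \<rho> (gbr m n x y) w"
proof -
  have *: "\<rho> (gbr m n x y) w = (if godd x \<and> godd y then \<rho> x (\<rho> y w) + \<rho> y (\<rho> x w)
            else \<rho> x (\<rho> y w) - \<rho> y (\<rho> x w))"
    using gmodule assms unfolding gmodule_def by blast
  show ?thesis
  proof (cases "godd x \<and> godd y")
    case True
    then show ?thesis by (intro exI[of _ "-1"]) (simp add: *)
  next
    case False
    then have "\<rho> (gbr m n x y) w = \<rho> x (\<rho> y w) - \<rho> y (\<rho> x w)" unfolding * by (rule if_not_P)
    then show ?thesis by (intro exI[of _ 1]) simp
  qed
qed

lemma rho_comm_even:
  assumes "x \<in> ghat_set m n" "y \<in> ghat_set m n" "geven x" "homog y"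
  shows "\<rho> x (\<rho> y w) = \<rho> y (\<rho> x w) + \<rho> (gbr m n x y) w"
proof (cases "godd x")
  \<comment> \<open>The zero element counts both as even and as odd, and the module axiom then takes
    its anticommutator form.\<close>
  case True
  then have "x = gzero" using geven_godd_gzero assms(3) by blast
  then show ?thesis by (simp add: gbr_gzero rho_gzero rho_0 assms(2))
next
  case False
  have "\<rho> (gbr m n x y) w = (if godd x \<and> godd y then \<rho> x (\<rho> y w) + \<rho> y (\<rho> x w)
            else \<rho> x (\<rho> y w) - \<rho> y (\<rho> x w))"
    using gmodule assms unfolding gmodule_def homog_def by blast
  then show ?thesis using False by simp
qed

text \<open>Reduces an arbitrary element to root vectors, K and d. Only labels at which x has a
  nonzero entry have to be checked, so a bracket can be handled through its support without being
  computed.\<close>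

lemma act_mem:
  assumes S: "subspace S" and x: "x \<in> ghat_set m n"
    and Bt: "\<And>r a b. fst x r a b \<noteq> 0 \<Longrightarrow> a \<in> I \<Longrightarrow> b \<in> I \<Longrightarrow> X a b r w \<in> S"
    and K: "fst (snd x) \<noteq> 0 \<Longrightarrow> \<rho> Kel w \<in> S" and d: "snd (snd x) \<noteq> 0 \<Longrightarrow> \<rho> del w \<in> S"
  shows "\<rho> x w \<in> S"
proof -
  define c where "c = (\<lambda>(r,a,b). fst x r a b / 2)"
  have "gcomb A c (fst (snd x)) (snd (snd x)) \<in> ghat_set m n \<and> \<rho> (gcomb A c (fst (snd x)) (snd (snd x))) w \<in> S"
    if "finite A" "A \<subseteq> UNIV \<times> I \<times> I" for A
    using that
  proof (induction A rule: finite_induct)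
    case empty
    have "sc (fst (snd x)) (\<rho> Kel w) \<in> S" "sc (snd (snd x)) (\<rho> del w) \<in> S"
      using K d subspace_scale[OF S] subspace_0[OF S] by (metis scale_zero_left)+
    then show ?case unfolding gcomb_empty
      using Kel_hhat[THEN hhat_ghat] del_hhat[THEN hhat_ghat]
      by (simp add: ghat_add ghat_scale rho_gadd rho_gscale subspace_add[OF S])
  next
    case (insert p A)
    obtain r a b where p: "p = (r,a,b)" by (cases p)
    have ab: "a \<in> I" "b \<in> I" using insert.prems p by auto
    have "sc (c (r,a,b)) (X a b r w) \<in> S"
      using Bt[OF _ ab, of r] subspace_scale[OF S] subspace_0[OF S] by (cases "fst x r a b = 0") (auto simp: c_def)
    then show ?case using insert ab unfolding p
      by (simp add: gcomb_insert ghat_add ghat_scale rho_gadd rho_gscale subspace_add[OF S] Bt_ghat)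
  qed
  from this[of "msupp (fst x) \<times> I \<times> I"] have "\<rho> (gcomb (msupp (fst x) \<times> I \<times> I) c (fst (snd x)) (snd (snd x))) w \<in> S"
    using ghat_fin[OF x] by fastforce
  then show ?thesis using ghat_gcomb[OF x] unfolding c_def by simp
qed

definition wtv :: "(ghat \<Rightarrow> complex) \<Rightarrow> 'v \<Rightarrow> bool" where
  "wtv \<mu> w \<longleftrightarrow> (\<forall>h\<in>hhat m n. \<rho> h w = sc (\<mu> h) w)"

lemma wtvD: "wtv \<mu> w \<Longrightarrow> h \<in> hhat m n \<Longrightarrow> \<rho> h w = sc (\<mu> h) w"
  by (simp add: wtv_def)

lemma hhat_X:
  assumes "h \<in> hhat m n" "a \<in> I" "b \<in> I"
  shows "\<rho> h (X a b r w) = X a b r (\<rho> h w) + sc (wt h a b r) (X a b r w)"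
  using rho_comm_even[OF hhat_ghat[OF assms(1)] Bt_ghat[OF assms(2,3)] geven_hhat[OF assms(1)] homog_Bt]
  by (simp add: gbr_hhat_Bt[OF assms] rho_gscale Bt_ghat assms)

lemma wtv_X:
  assumes "wtv \<mu> w" "a \<in> I" "b \<in> I"
  shows "wtv (\<lambda>h. \<mu> h + wt h a b r) (X a b r w)"
  unfolding wtv_def using hhat_X[OF _ assms(2,3)] wtvD[OF assms(1)]
  by (simp add: rho_scale[OF Bt_ghat[OF assms(2,3)]] scale_left_distrib)

lemma wtv_X_pow:
  assumes "wtv \<mu> w" "a \<in> I" "b \<in> I"
  shows "wtv (\<lambda>h. \<mu> h + of_nat N * wt h a b r) ((X a b r ^^ N) w)"
proof (induction N)
  case (Suc N)
  from wtv_X[OF Suc assms(2,3), of r] show ?case by (simp add: algebra_simps)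
qed (use assms in simp)

lemma Kel_comm: "x \<in> ghat_set m n \<Longrightarrow> homog x \<Longrightarrow> \<rho> Kel (\<rho> x w) = \<rho> x (\<rho> Kel w)"
  using rho_comm_even[OF hhat_ghat[OF Kel_hhat] _ geven_hhat[OF Kel_hhat], of x w]
  by (simp add: gbr_Kel rho_gzero)

lemma homog_Kel_del: "homog Kel" "homog del"
  using geven_hhat[OF Kel_hhat] geven_hhat[OF del_hhat] by (auto simp: homog_def)

end

lemma Bt_gzero: "Bmat a b = zmat \<Longrightarrow> Bt a b r = gzero"
  by (simp add: Bt_def gzero_def fun_eq_iff)

lemma Bt_diag_hhat:
  assumes "a \<in> idxs m n"
  shows "Bt a a 0 \<in> hhat m n"
proof -
  have "Bmat a a i j = 0" if "i \<noteq> j" for i j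
    using Bmat_nz[of a a i j] that by metis
  then show ?thesis using osp_Bmat[OF assms assms] by (simp add: hhat_def Bt_def)
qed

lemma Bt_dual: "Bt (du b) (du a) r = gscale (sg (du b) (du a)) (Bt a b r)"
proof -
  have "Bmat (du b) (du a) i j = sg (du b) (du a) * Bmat a b i j" for i j
  proof -
    define p q where "p \<longleftrightarrow> i = a \<and> j = b" and "q \<longleftrightarrow> i = du b \<and> j = du a"
    have "sg (du b) (du a) * sg a b = 1" by (rule sg_du)
    then have "(if q then 1 else 0) + (if p then sg (du b) (du a) else 0)
        = sg (du b) (du a) * ((if p then 1 else 0) + (if q then sg a b else 0))"
      by (cases p; cases q; simp only: if_True if_False) (simp_all add: distrib_left)
    then show ?thesis unfolding Bmat_def p_def q_def by (simp only: du_du)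
  qed
  then have "Bmat (du b) (du a) = (\<lambda>i j. sg (du b) (du a) * Bmat a b i j)" by blast
  then show ?thesis by (auto simp: Bt_def gscale_def zmat_def fun_eq_iff)
qed

lemma wt_swap: "wt h b a (-r) = - wt h a b r"
  by (simp add: wt_def)

lemma wt_hco:
  assumes "a \<noteq> b" "a \<noteq> du b" "\<not> odd_idx a" "\<not> odd_idx b"
  shows "wt (hco a b r) a b r = 2 - of_bool (a = E0) - of_bool (b = E0)"
proof -
  have "b \<noteq> a" "b \<noteq> du a" using assms by auto
  moreover have "a = du a \<longleftrightarrow> a = E0" "b = du b \<longleftrightarrow> b = E0"
    using assms(3,4) by (cases a; cases b; simp)+
  ultimately show ?thesis using assms by (simp add: wt_def hco_def)
qed

lemma first_nilpotent:
  fixes f :: "'v::zero \<Rightarrow> 'v"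
  assumes "(f ^^ M) w = 0" "w \<noteq> 0"
  obtains N where "(f ^^ N) w \<noteq> 0" "(f ^^ Suc N) w = 0"
proof -
  define N where "N = (LEAST N. (f ^^ N) w = 0)"
  have N: "(f ^^ N) w = 0" unfolding N_def using assms(1) by (rule LeastI)
  then obtain N' where N': "N = Suc N'" using assms(2) by (cases N) auto
  have "(f ^^ N') w \<noteq> 0" using not_less_Least[of N' "\<lambda>N. (f ^^ N) w = 0"] N' unfolding N_def by simp
  then show ?thesis using that N N' by blast
qed

section \<open>Strings of sl(2), reflections of weights and local nilpotency\<close>

context osp_module begin

lemma span_act:
  assumes x: "x \<in> ghat_set m n" and u: "u \<in> span B" and B: "\<And>u. u \<in> B \<Longrightarrow> \<rho> x u \<in> span B'"
  shows "\<rho> x u \<in> span B'"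
proof -
  have "subspace {u. \<rho> x u \<in> span B'}"
    using x by (auto intro!: subspaceI simp: rho_add rho_scale rho_0 span_zero span_add span_scale)
  then show ?thesis using span_minimal[of B "{u. \<rho> x u \<in> span B'}"] B u by blast
qed

lemma X_comm:
  assumes "a \<in> I" "b \<in> I" "c \<in> I" "d \<in> I" "odd_idx a = odd_idx b"
  shows "X a b r (X c d s w) = X c d s (X a b r w) + \<rho> (gbr m n (Bt a b r) (Bt c d s)) w"
  using assms by (intro rho_comm_even Bt_ghat geven_Bt homog_Bt)

lemma X_dual:
  assumes "a \<in> I" "b \<in> I"
  shows "X (du b) (du a) r w = sc (sg (du b) (du a)) (X a b r w)"
  unfolding Bt_dual by (rule rho_gscale[OF Bt_ghat[OF assms]])

lemma sl2_rel:
  assumes ab: "a \<in> I" "b \<in> I" "a \<noteq> b" "a \<noteq> du b" "\<not> odd_idx a" "\<not> odd_idx b" and w: "X a b r w = 0" "wtv \<mu> w"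
  shows "X a b r ((X b a (-r) ^^ Suc N) w) =
    sc (of_nat (Suc N) * (\<mu> (hco a b r) - of_nat N * wt (hco a b r) a b r / 2)) ((X b a (-r) ^^ N) w)"
proof (rule sl2_string(2)[where H = "\<rho> (hco a b r)"])
  note h = hco_hhat[OF ab(1-5), of r]
  show "X a b r (X b a (-r) w) = X b a (-r) (X a b r w) + \<rho> (hco a b r) w" for w
    using X_comm[OF ab(1,2,2,1), of r "-r" w] ab by (simp add: gbr_Bt_Bt)
  show "\<rho> (hco a b r) (X b a (-r) w) = sc (\<mu> - wt (hco a b r) a b r) (X b a (-r) w)"
    if "\<rho> (hco a b r) w = sc \<mu> w" for w \<mu>
    using hhat_X[OF h ab(2,1), of "-r" w] that
    by (simp add: wt_swap rho_scale Bt_ghat ab scale_left_diff_distrib)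
  show "\<rho> (hco a b r) w = sc (\<mu> (hco a b r)) w" using wtvD[OF w(2) h] .
qed (use w ab in \<open>simp_all add: rho_scale Bt_ghat\<close>)

text \<open>Raising the zero vector at the end of the string gives a multiple of the last nonzero
  one, so the coefficient in \<open>sl2_rel\<close> is zero.\<close>

lemma hw_integral:
  assumes ab: "a \<in> I" "b \<in> I" "a \<noteq> b" "a \<noteq> du b" "\<not> odd_idx a" "\<not> odd_idx b" and w: "X a b r w = 0" "wtv \<mu> w"
    and N: "(X b a (-r) ^^ N) w \<noteq> 0" "(X b a (-r) ^^ Suc N) w = 0"
  shows "\<mu> (hco a b r) = of_nat N * wt (hco a b r) a b r / 2"
  using sl2_rel[OF ab w, of N] N(1) unfolding N(2) rho_0[OF Bt_ghat[OF ab(1,2)]]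
  by (auto simp: simp del: of_nat_Suc)

text \<open>The new weight vector is not found by lowering w directly: w is first raised to the top
  u of a string and u is then lowered, which makes nonvanishing immediate.\<close>

lemma weight_string:
  assumes ab: "a \<in> I" "b \<in> I" "a \<noteq> b" "a \<noteq> du b" "\<not> odd_idx a" "\<not> odd_idx b" and w: "w \<noteq> 0" "wtv \<mu> w"
    and nil: "\<And>w. \<exists>N. (X a b r ^^ N) w = 0" "\<And>w. \<exists>N. (X b a (-r) ^^ N) w = 0"
  shows "\<exists>p::int. 2 * \<mu> (hco a b r) = of_int p * wt (hco a b r) a b r
    \<and> (p \<ge> 0 \<longrightarrow> (\<exists>w'. w' \<noteq> 0 \<and> wtv (\<lambda>h. \<mu> h - of_int p * wt h a b r) w'))"
proof -
  let ?e = "X a b r" and ?f = "X b a (-r)" and ?h = "hco a b r"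
  obtain M where "(?e ^^ M) w = 0" using nil(1) by blast
  from first_nilpotent[OF this w(1)] obtain j where j: "(?e ^^ j) w \<noteq> 0" "(?e ^^ Suc j) w = 0" by blast
  define u where "u = (?e ^^ j) w"
  have u: "u \<noteq> 0" "?e u = 0" using j by (simp_all add: u_def)
  have wu: "wtv (\<lambda>h. \<mu> h + of_nat j * wt h a b r) u"
    unfolding u_def by (rule wtv_X_pow[OF w(2) ab(1,2)])
  obtain M where "(?f ^^ M) u = 0" using nil(2) by blast
  from first_nilpotent[OF this u(1)] obtain N where N: "(?f ^^ N) u \<noteq> 0" "(?f ^^ Suc N) u = 0" by blast
  from hw_integral[OF ab u(2) wu N]
  have eq: "\<mu> ?h + of_nat j * wt ?h a b r = of_nat N * wt ?h a b r / 2" .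
  \<comment> \<open>With alpha the root of (a, b, r), u has weight \<mu> + j alpha and admits N
    nonzero lowerings. After N - j of them the weight is \<mu> - (N - 2j) alpha.\<close>
  define p where "p = int N - 2 * int j"
  have "2 * \<mu> ?h = of_int p * wt ?h a b r" using eq unfolding p_def by (simp add: field_simps)
  moreover have "\<exists>w'. w' \<noteq> 0 \<and> wtv (\<lambda>h. \<mu> h - of_int p * wt h a b r) w'" if "p \<ge> 0"
  proof (intro exI conjI)
    have Nj: "N = j + (N - j)" "j \<le> N" using that p_def by auto
    show "(?f ^^ (N - j)) u \<noteq> 0"
    proof
      assume "(?f ^^ (N - j)) u = 0"
      then have "(?f ^^ (j + (N - j))) u = 0"
        by (simp only: funpow_add o_def vs_endo.T_pow(3)[OF rho_endo[OF Bt_ghat[OF ab(2,1)]]])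
      then show False using N(1) Nj(1) by simp
    qed
    have "(\<lambda>h. \<mu> h + of_nat j * wt h a b r + of_nat (N - j) * wt h b a (-r)) = (\<lambda>h. \<mu> h - of_int p * wt h a b r)"
      unfolding wt_swap p_def using Nj(2) by (auto simp: of_nat_diff algebra_simps)
    then show "wtv (\<lambda>h. \<mu> h - of_int p * wt h a b r) ((?f ^^ (N - j)) u)"
      using wtv_X_pow[OF wu ab(2,1), of "N - j" "-r"] by simp
  qed
  ultimately show ?thesis by blast
qed

definition is_weight :: "(ghat \<Rightarrow> complex) \<Rightarrow> bool" where
  "is_weight \<mu> \<longleftrightarrow> (\<exists>w. w \<noteq> 0 \<and> wtv \<mu> w)"

lemma weight_reflection:
  assumes ab: "a \<in> I" "b \<in> I" "a \<noteq> b" "a \<noteq> du b" "\<not> odd_idx a" "\<not> odd_idx b" and w: "is_weight \<mu>"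
    and nil: "\<And>w. \<exists>N. (X a b r ^^ N) w = 0" "\<And>w. \<exists>N. (X b a (-r) ^^ N) w = 0"
  shows "is_weight (\<lambda>h. \<mu> h - 2 * \<mu> (hco a b r) / wt (hco a b r) a b r * wt h a b r)"
proof -
  obtain w where w: "w \<noteq> 0" "wtv \<mu> w" using assms(7) by (auto simp: is_weight_def)
  have ba: "b \<noteq> a" "b \<noteq> du a" using ab by auto
  let ?h = "hco a b r" and ?h' = "hco b a (-r)"
  have t: "wt ?h a b r \<noteq> 0" unfolding wt_hco[OF ab(3-6)] using ab by auto
  have t': "wt ?h' b a (-r) = wt ?h a b r"
    unfolding wt_hco[OF ab(3-6)] wt_hco[OF ba ab(6,5)] by simp
  have "sc (\<mu> ?h') w = \<rho> (gbr m n (Bt b a (-r)) (Bt a b r)) w"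
    using gbr_Bt_Bt[OF ab(2,1) ba ab(6), of "-r"] wtvD[OF w(2) hco_hhat[OF ab(2,1) ba ab(6), of "-r"]] by simp
  \<comment> \<open>The two commutation relations of the same pair of root vectors show that
    \<open>hco b a (-r)\<close> acts on w as minus \<open>hco a b r\<close>. This reduces negative p
    to the string with a and b exchanged.\<close>
  also have "\<rho> (gbr m n (Bt a b r) (Bt b a (-r))) w + \<rho> (gbr m n (Bt b a (-r)) (Bt a b r)) w = 0"
    using X_comm[OF ab(1,2,2,1), of r "-r" w] X_comm[OF ab(2,1,1,2), of "-r" r w] ab(5,6)
    by (simp add: algebra_simps)
  then have "\<rho> (gbr m n (Bt b a (-r)) (Bt a b r)) w = - \<rho> (gbr m n (Bt a b r) (Bt b a (-r))) w"
    by (simp only: add_eq_0_iff)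
  also have "\<dots> = sc (- \<mu> ?h) w"
    using gbr_Bt_Bt[OF ab(1-5), of r] wtvD[OF w(2) hco_hhat[OF ab(1-5), of r]] by simp
  finally have neg: "\<mu> ?h' = - \<mu> ?h" using w(1) by (simp only: scale_cancel_right simp_thms)
  obtain p where p: "2 * \<mu> ?h = of_int p * wt ?h a b r"
      "p \<ge> 0 \<longrightarrow> (\<exists>w'. w' \<noteq> 0 \<and> wtv (\<lambda>h. \<mu> h - of_int p * wt h a b r) w')"
    using weight_string[OF ab w nil] by blast
  have c: "2 * \<mu> ?h / wt ?h a b r = of_int p" using p(1) t by simp
  show ?thesis
  proof (cases "p \<ge> 0")
    case True
    then show ?thesis unfolding c is_weight_def using p(2) by simp
  next
    case False
    obtain q where q: "2 * \<mu> ?h' = of_int q * wt ?h' b a (-r)"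
      "q \<ge> 0 \<longrightarrow> (\<exists>w'. w' \<noteq> 0 \<and> wtv (\<lambda>h. \<mu> h - of_int q * wt h b a (-r)) w')"
      using weight_string[OF ab(2,1) ba ab(6,5) w, of "-r"] nil by auto
    have "of_int q * wt ?h a b r = of_int (-p) * wt ?h a b r" using q(1) p(1) unfolding neg t' by simp
    then have "of_int q = (of_int (-p) :: complex)" using t by (simp only: mult_cancel_right simp_thms)
    then have "q = -p" by (simp only: of_int_eq_iff)
    then show ?thesis unfolding c is_weight_def using q(2) False by (simp add: wt_swap)
  qed
qed

text \<open>Let y be the operator of (c, d, s). The induction runs over the degree of a root vector
  X under phi, and inside it over the nilpotency order N of w. In y X w = X (y w) + [y, X] w the
  first term has smaller N and the second smaller degree, because y lowers phi. The degree ignores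
  powers of t and is therefore bounded.\<close>

lemma nilpotent_closed:
  assumes cd: "c \<in> I" "d \<in> I" "odd_idx c = odd_idx d"
    and phi: "\<And>i. phi (du i) = - (phi i :: int)" "phi c < phi d"
    and x: "x \<in> ghat_set m n" and w: "\<exists>N. (X c d s ^^ N) w = 0"
  shows "\<exists>N. (X c d s ^^ N) (\<rho> x w) = 0"
proof -
  let ?y = "X c d s"
  define S where "S = {w. \<exists>N. (?y ^^ N) w = 0}"
  have S: "subspace S" unfolding S_def
    by (rule vs_endo.subspace_nilpotent[OF rho_endo[OF Bt_ghat[OF cd(1,2)]]])
  have Sy: "w \<in> S" if "?y w \<in> S" for w
  proof -
    from that obtain N where "(?y ^^ N) (?y w) = 0" unfolding S_def by blast
    then have "(?y ^^ Suc N) w = 0" by (simp add: funpow_swap1)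
    then show ?thesis unfolding S_def by blast
  qed
  have yS: "?y w \<in> S" if "w \<in> S" for w
  proof -
    from that obtain N where N: "(?y ^^ N) w = 0" unfolding S_def by blast
    have "(?y ^^ N) (?y w) = ?y ((?y ^^ N) w)" by (simp add: funpow_swap1)
    then show ?thesis unfolding S_def using rho_0[OF Bt_ghat[OF cd(1,2)]] N by auto
  qed
  have KS: "\<rho> Kel w \<in> S" if "w \<in> S" for w
  proof -
    have "(?y ^^ N) (\<rho> Kel w) = \<rho> Kel ((?y ^^ N) w)" for N
      by (induction N) (simp_all add: Kel_comm Bt_ghat cd homog_Bt)
    moreover from that obtain N where "(?y ^^ N) w = 0" unfolding S_def by blast
    ultimately have "(?y ^^ N) (\<rho> Kel w) = 0" using rho_0[OF hhat_ghat[OF Kel_hhat]] by simp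
    then show ?thesis unfolding S_def by blast
  qed
  have dS: "\<rho> del w \<in> S" if "(?y ^^ N) w = 0" for N w
    using that
  proof (induction N arbitrary: w)
    case 0
    then show ?case using rho_0[OF hhat_ghat[OF del_hhat]] subspace_0[OF S] by simp
  next
    case (Suc N)
    then have "(?y ^^ N) (?y w) = 0" by (simp add: funpow_swap1)
    then have "\<rho> del (?y w) \<in> S" "?y w \<in> S" using Suc.IH unfolding S_def by blast+
    moreover have "?y (\<rho> del w) = \<rho> del (?y w) - sc (wt del c d s) (?y w)"
      using hhat_X[OF del_hhat cd(1,2), of s w] by simp
    ultimately have "?y (\<rho> del w) \<in> S" by (simp add: subspace_diff[OF S] subspace_scale[OF S])
    then show ?case by (rule Sy)
  qed
  \<comment> \<open>Degrees of root vectors lie between -2B and 2B, so the induction starts at the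
    empty range below -2B.\<close>
  define B where "B = (\<Sum>i\<in>I. \<bar>phi i\<bar>)"
  have B: "\<bar>phi i\<bar> \<le> B" if "i \<in> I" for i unfolding B_def using that by (intro member_le_sum) auto
  have XS: "\<forall>a b r N w. a \<in> I \<longrightarrow> b \<in> I \<longrightarrow> phi a - phi b \<le> -2 * B - 1 + int k \<longrightarrow> (?y ^^ N) w = 0 \<longrightarrow> X a b r w \<in> S" for k
  proof (induction k)
    case 0
    show ?case
    proof (intro allI impI)
      fix a b r N w assume "a \<in> I" "b \<in> I" and *: "phi a - phi b \<le> -2 * B - 1 + int 0"
      then have "\<bar>phi a\<bar> \<le> B" "\<bar>phi b\<bar> \<le> B" using B by auto
      with * show "X a b r w \<in> S" by linarith
    qed
  next
    case (Suc k)
    show ?case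
    proof (intro allI impI)
      fix a b r N w
      assume ab: "a \<in> I" "b \<in> I" and deg: "phi a - phi b \<le> -2 * B - 1 + int (Suc k)" and "(?y ^^ N) w = 0"
      then show "X a b r w \<in> S"
      proof (induction N arbitrary: w)
        case 0
        then show ?case using rho_0[OF Bt_ghat[OF ab]] subspace_0[OF S] by simp
      next
        case (Suc N)
        have N: "(?y ^^ N) (?y w) = 0" using Suc.prems(4) by (simp add: funpow_swap1)
        have w: "w \<in> S" unfolding S_def using Suc.prems(4) by blast
        have "X a b r (?y w) \<in> S" using Suc.IH[OF ab deg N] .
        moreover have "\<rho> (gbr m n (Bt c d s) (Bt a b r)) w \<in> S"
        proof (rule act_mem[OF S])
          show "gbr m n (Bt c d s) (Bt a b r) \<in> ghat_set m n" by (intro gbr_ghat Bt_ghat cd ab)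
          fix t i j assume "fst (gbr m n (Bt c d s) (Bt a b r)) t i j \<noteq> 0" and ij: "i \<in> I" "j \<in> I"
          from gbr_Bt_grade(1)[where phi = phi, OF this(1) phi(1)] have "phi i - phi j \<le> -2 * B - 1 + int k"
            using deg phi(2) by simp
          then show "X i j t w \<in> S" using \<open>\<forall>a b r N w. _\<close> ij Suc.prems(4) by blast
        qed (simp_all add: KS w gbr_d)
        ultimately have "?y (X a b r w) \<in> S"
          unfolding X_comm[OF cd(1,2) ab cd(3)] by (rule subspace_add[OF S])
        then show ?case by (rule Sy)
      qed
    qed
  qed
  have "\<rho> x w \<in> S"
  proof (rule act_mem[OF S x])
    obtain N where N: "(?y ^^ N) w = 0" using w by blast
    show "X a b r w \<in> S" if "a \<in> I" "b \<in> I" for r a b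
    proof -
      have "phi a - phi b \<le> -2 * B - 1 + int (nat (phi a - phi b + 2 * B + 1))" by simp
      then show ?thesis using XS that N by blast
    qed
    show "\<rho> del w \<in> S" using dS[OF N] .
    show "\<rho> Kel w \<in> S" using KS N unfolding S_def by blast
  qed
  then show ?thesis unfolding S_def by blast
qed

end

section \<open>Irreducible modules: gradings and singular vectors\<close>

locale osp_irreducible = osp_module m n sc \<rho>
  for m n :: nat and sc :: "complex \<Rightarrow> 'v::ab_group_add \<Rightarrow> 'v" and \<rho> :: "ghat \<Rightarrow> 'v \<Rightarrow> 'v" +
  assumes irr: "irreducible_mod m n sc \<rho>"
begin

lemma invariant_UNIV:
  assumes S: "subspace S" "w \<in> S" "w \<noteq> 0" and inv: "\<And>x u. x \<in> ghat_set m n \<Longrightarrow> u \<in> S \<Longrightarrow> \<rho> x u \<in> S"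
  shows "S = UNIV"
proof -
  have "0 \<in> S \<and> (\<forall>a\<in>S. \<forall>b\<in>S. a + b \<in> S) \<and> (\<forall>c. \<forall>a\<in>S. sc c a \<in> S) \<and> (\<forall>x\<in>ghat_set m n. \<forall>a\<in>S. \<rho> x a \<in> S)"
    by (intro conjI ballI allI subspace_0[OF S(1)] subspace_add[OF S(1)] subspace_scale[OF S(1)] inv)
  then have "S = {0} \<or> S = UNIV"
    by (rule irr[unfolded irreducible_mod_def, THEN conjunct2, THEN spec, THEN mp])
  then show ?thesis using S(2,3) by blast
qed

lemma weights_span:
  assumes "is_weight \<mu>"
  shows "span {w. \<exists>\<mu>. wtv \<mu> w} = UNIV"
proof -
  from assms obtain v where v: "v \<noteq> 0" "wtv \<mu> v" by (auto simp: is_weight_def)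
  let ?B = "{w. \<exists>\<mu>. wtv \<mu> w}"
  show ?thesis
  proof (rule invariant_UNIV[OF subspace_span _ v(1)])
    show "v \<in> span ?B" using v(2) by (auto intro: span_base)
    fix x u assume x: "x \<in> ghat_set m n" and u: "u \<in> span ?B"
    show "\<rho> x u \<in> span ?B"
    proof (rule span_act[OF x u])
      fix w assume "w \<in> ?B"
      then obtain \<mu> where w: "wtv \<mu> w" by blast
      show "\<rho> x w \<in> span ?B"
      proof (rule act_mem[OF subspace_span x])
        show "X a b r w \<in> span ?B" if "a \<in> I" "b \<in> I" for r a b
          using wtv_X[OF w that] by (auto intro: span_base)
        have wB: "w \<in> span ?B" using w by (auto intro: span_base)
        show "\<rho> Kel w \<in> span ?B" "\<rho> del w \<in> span ?B"
          unfolding wtvD[OF w Kel_hhat] wtvD[OF w del_hhat] using wB by (auto intro: span_scale)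
      qed
    qed
  qed
qed

lemma nilpotent_all:
  assumes cd: "c \<in> I" "d \<in> I" "odd_idx c = odd_idx d"
    and phi: "\<And>i. phi (du i) = - (phi i :: int)" "phi c < phi d"
    and w: "w \<noteq> 0" "(X c d s ^^ N) w = 0"
  shows "\<exists>N. (X c d s ^^ N) u = 0"
proof -
  have "{w. \<exists>N. (X c d s ^^ N) w = 0} = UNIV"
    using w nilpotent_closed[where phi = phi, OF cd phi]
    by (intro invariant_UNIV[of _ w] vs_endo.subspace_nilpotent rho_endo Bt_ghat cd) auto
  then show ?thesis by blast
qed

text \<open>A Z-grading of the affine superalgebra whose part of degree zero is the Cartan
  subalgebra. Every base in the proof is represented by such a grading.\<close>

definition height :: "(idx \<Rightarrow> int) \<Rightarrow> int \<Rightarrow> bool" where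
  "height l D \<longleftrightarrow> (\<forall>i. l (du i) = - l i) \<and>
     (\<forall>a\<in>I. \<forall>b\<in>I. \<forall>r. Bmat a b \<noteq> zmat \<longrightarrow> l a - l b + D * r = 0 \<longrightarrow> a = b \<and> r = 0)"

definition singular :: "(idx \<Rightarrow> int) \<Rightarrow> int \<Rightarrow> 'v \<Rightarrow> bool" where
  "singular l D u \<longleftrightarrow> (\<forall>a\<in>I. \<forall>b\<in>I. \<forall>r. l a - l b + D * r > 0 \<longrightarrow> X a b r u = 0)"

text \<open>The labels \<open>(c, d)\<close> and \<open>(du d, du c)\<close> name the same root vector up to sign, so both are excepted.\<close>
definition singular_except :: "(idx \<Rightarrow> int) \<Rightarrow> int \<Rightarrow> idx \<Rightarrow> idx \<Rightarrow> int \<Rightarrow> 'v \<Rightarrow> bool" where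
  "singular_except l D c d s u \<longleftrightarrow> (\<forall>a\<in>I. \<forall>b\<in>I. \<forall>r. l a - l b + D * r > 0 \<longrightarrow>
     \<not> (r = s \<and> (a = c \<and> b = d \<or> a = du d \<and> b = du c)) \<longrightarrow> X a b r u = 0)"

text \<open>This is U(n_-) u, where n_- is spanned by the root vectors of negative height.\<close>

inductive_set nspan :: "(idx \<Rightarrow> int) \<Rightarrow> int \<Rightarrow> 'v \<Rightarrow> 'v set" for l D u where
  base: "u \<in> nspan l D u"
| neg: "w \<in> nspan l D u \<Longrightarrow> a \<in> I \<Longrightarrow> b \<in> I \<Longrightarrow> l a - l b + D * r < 0 \<Longrightarrow> X a b r w \<in> nspan l D u"
| add: "w \<in> nspan l D u \<Longrightarrow> w' \<in> nspan l D u \<Longrightarrow> w + w' \<in> nspan l D u"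
| scl: "w \<in> nspan l D u \<Longrightarrow> sc c w \<in> nspan l D u"

lemma subspace_nspan: "subspace (nspan l D u)"
proof (rule subspaceI)
  have "sc 0 u \<in> nspan l D u" by (intro nspan.intros)
  then show "0 \<in> nspan l D u" by simp
qed (auto intro: nspan.intros)

text \<open>Moving z past a lowering operator leaves a bracket acting on a vector built with one
  lowering less. Since the induction hypothesis speaks of all elements at once, no ordering of
  monomials is involved.\<close>

lemma nspan_act:
  assumes h: "height l D" and s: "singular l D u" and u: "wtv \<mu> u" and w: "w \<in> nspan l D u"
  shows "\<forall>x\<in>ghat_set m n. \<rho> x w \<in> nspan l D u"
  using w
proof (induction rule: nspan.induct)
  case base
  show ?case
  proof (rule ballI, rule act_mem[OF subspace_nspan])
    fix x r a b assume "x \<in> ghat_set m n" and ab: "a \<in> I" "b \<in> I"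
    consider "l a - l b + D * r > 0" | "l a - l b + D * r < 0" | "l a - l b + D * r = 0" by linarith
    then show "X a b r u \<in> nspan l D u"
    proof cases
      case 1
      then have "X a b r u = 0" using s ab unfolding singular_def by blast
      then show ?thesis using subspace_0[OF subspace_nspan] by simp
    next
      case 2
      then show ?thesis using ab by (intro nspan.intros)
    next
      case 3
      show ?thesis
      proof (cases "Bmat a b = zmat")
        case True
        then show ?thesis using subspace_0[OF subspace_nspan] by (simp add: Bt_gzero rho_gzero)
      next
        case False
        with 3 h ab have "a = b" "r = 0" unfolding height_def by blast+
        then show ?thesis using wtvD[OF u Bt_diag_hhat[OF ab(1)]] by (auto intro: nspan.intros)
      qed
    qed
  qed (auto simp: wtvD[OF u Kel_hhat] wtvD[OF u del_hhat] intro: nspan.intros)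
next
  case (neg w a b r)
  have hom: "\<rho> z (X a b r w) \<in> nspan l D u" if z: "z \<in> ghat_set m n" "homog z" for z
  proof -
    have B: "Bt a b r \<in> ghat_set m n" using neg Bt_ghat by blast
    obtain c where "\<rho> z (X a b r w) = sc c (X a b r (\<rho> z w)) + \<rho> (gbr m n z (Bt a b r)) w"
      using rho_comm[OF z(1) B z(2) homog_Bt] by blast
    moreover have "X a b r (\<rho> z w) \<in> nspan l D u" using neg z by (intro nspan.neg) auto
    moreover have "\<rho> (gbr m n z (Bt a b r)) w \<in> nspan l D u" using neg z B gbr_ghat by blast
    ultimately show ?thesis by (auto intro: nspan.intros)
  qed
  show ?case
    by (rule ballI, rule act_mem[OF subspace_nspan])
(auto intro!: hom simp: Bt_ghat homog_Bt hhat_ghat[OF Kel_hhat] hhat_ghat[OF del_hhat] homog_Kel_del)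
qed (auto simp: rho_add rho_scale intro: nspan.intros)

text \<open>By irreducibility the module is U(n_-) u, and each lowering operator decreases the
  eigenvalue of the grading element by a positive integer.\<close>

lemma eigen_below:
  assumes h: "height l D" and s: "singular l D u" and u: "wtv \<mu> u" "u \<noteq> 0"
    and w: "w \<noteq> 0" "\<rho> (hl m n l D) w = sc c w"
  shows "\<exists>j::nat. c = \<mu> (hl m n l D) - of_nat j"
proof -
  let ?H = "hl m n l D"
  have H: "?H \<in> hhat m n" using h hl_hhat unfolding height_def by blast
  define f where "f = (\<lambda>j::nat. \<mu> ?H - of_nat j)"
  let ?B = "\<Union>j. {u. \<rho> ?H u = sc (f j) u}"
  have "nspan l D u = UNIV"
    using nspan_act[OF h s u(1)] by (intro invariant_UNIV[OF subspace_nspan nspan.base u(2)]) auto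
  moreover have "w \<in> span ?B" if "w \<in> nspan l D u" for w
    using that
  proof (induction rule: nspan.induct)
    case base
    then show ?case using wtvD[OF u(1) H] by (intro span_base) (auto simp: f_def intro!: exI[of _ 0])
  next
    case (neg w a b r)
    define k where "k = nat (- (l a - l b + D * r))"
    have k: "of_int (l a - l b + D * r) = - (of_nat k :: complex)" using neg(4) by (simp add: k_def)
    show ?case
    proof (rule span_act[OF Bt_ghat[OF neg(2,3)] neg(5)])
      fix u assume "u \<in> ?B"
      then obtain j where "\<rho> ?H u = sc (f j) u" by blast
      then have "\<rho> ?H (X a b r u) = sc (f j) (X a b r u) + sc (- of_nat k) (X a b r u)"
        using hhat_X[OF H neg(2,3), of r u] unfolding wt_hl[OF neg(2,3)] k
        by (simp only: rho_scale[OF Bt_ghat[OF neg(2,3)]])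
      also have "\<dots> = sc (f (j + k)) (X a b r u)"
        unfolding scale_left_distrib[symmetric] by (simp add: f_def)
      finally have "\<rho> ?H (X a b r u) = sc (f (j + k)) (X a b r u)" .
      then show "X a b r u \<in> span ?B" by (intro span_base) blast
    qed
  qed (auto intro: span_add span_scale)
  ultimately have "w \<in> span ?B" by blast
  from vs_endo.span_eigen_eigenvalue[OF rho_endo[OF hhat_ghat[OF H]] this w(2,1)]
  show ?thesis unfolding f_def .
qed

text \<open>A nonzero u would itself generate the module, so \<open>eigen_below\<close> would place
  the eigenvalue of v at or below that of u, although it is larger by k + 1.\<close>

lemma lower_singular_zero:
  assumes h: "height l D" and v: "singular l D v" "wtv \<mu> v" "v \<noteq> 0"
    and u: "singular l D u" "wtv \<nu> u" and k: "\<nu> (hl m n l D) = \<mu> (hl m n l D) - of_nat (Suc k)"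
  shows "u = 0"
proof (rule ccontr)
  assume u0: "u \<noteq> 0"
  have H: "hl m n l D \<in> hhat m n" using h hl_hhat unfolding height_def by blast
  obtain j where "\<mu> (hl m n l D) = \<nu> (hl m n l D) - of_nat j"
    using eigen_below[OF h u u0 v(3) wtvD[OF v(2) H]] by blast
  then have "\<mu> (hl m n l D) = \<mu> (hl m n l D) - (of_nat (Suc k) + of_nat j)" unfolding k diff_diff_eq .
  then have "of_nat (Suc k) + of_nat j = (0 :: complex)"
    by (metis add.right_neutral diff_add_cancel add_left_cancel add.commute)
  then have "of_nat (Suc k + j) = (0 :: complex)" by (simp only: of_nat_add)
  then show False unfolding of_nat_eq_0_iff by simp
qed

text \<open>Let alpha be the root of (c, d, s), of height 1, f the root vector of -alpha, and e a
  raising operator not belonging to alpha. Then [e, f] has height at least 0, and it is again a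
  combination of raising operators not belonging to alpha, so e f u = 0. The last hypothesis on c
  and d excludes odd alpha with 2 alpha a root, such as delta_j.\<close>

lemma singular_except_step:
  assumes h: "height l D" and cd: "c \<in> I" "d \<in> I" "c \<noteq> du c" "c \<noteq> d" "d = du d \<Longrightarrow> \<not> odd_idx c"
    and ht: "l c - l d + D * s = 1" and u: "singular_except l D c d s u"
  shows "singular_except l D c d s (X d c (-s) u)"
  unfolding singular_except_def
proof (intro ballI allI impI)
  fix a b r
  assume ab: "a \<in> I" "b \<in> I" and pos: "l a - l b + D * r > 0"
    and ne: "\<not> (r = s \<and> (a = c \<and> b = d \<or> a = du d \<and> b = du c))"
  have du: "l (du i) = - l i" for i using h unfolding height_def by blast
  let ?g = "gbr m n (Bt a b r) (Bt d c (-s))"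
  have x0: "X a b r u = 0" using u ab pos ne unfolding singular_except_def by blast
  have ab_nz: "\<not> (r = s \<and> (i = c \<and> j = d \<or> i = du d \<and> j = du c))" if "Bmat a b i j \<noteq> 0" for i j
    using Bmat_nz[OF that] ne by (metis du_du)
  have no_cc: "Bmat a b c (du c) = 0" if "d = du d"
    using osp_even_dual_zero[OF osp_Bmat[OF ab]] cd(5)[OF that] by blast
  have "\<rho> ?g u \<in> {0}"
  proof (rule act_mem)
    show "?g \<in> ghat_set m n" by (intro gbr_ghat Bt_ghat ab cd)
    fix t i k assume nz: "fst ?g t i k \<noteq> 0" and ik: "i \<in> I" "k \<in> I"
    have t: "t = r - s" using gbr_Bt_grade(2)[where phi = l, OF nz du] by simp
    have "l i - l k = (l a - l b) + (l d - l c)" using gbr_Bt_grade(1)[where phi = l, OF nz du] .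
    then have ht': "l i - l k + D * t = l a - l b + D * r - 1" using ht unfolding t by (simp add: algebra_simps)
    obtain j where j: "Bmat a b i j \<noteq> 0 \<and> Bmat d c j k \<noteq> 0 \<or> Bmat d c i j \<noteq> 0 \<and> Bmat a b j k \<noteq> 0"
      using gbr_nz[OF nz] by (auto simp only: snd_Bt fst_Bt split: if_splits)
    \<comment> \<open>A component in the Cartan subalgebra would force e to be the excepted root
      vector opposite to f.\<close>
    have ne1: "\<not> (i = k \<and> t = 0)"
    proof
      assume "i = k \<and> t = 0"
      then have ik': "i = k" "r = s" using t by auto
      from j show False
      proof (elim disjE conjE)
        assume "Bmat a b i j \<noteq> 0" "Bmat d c j k \<noteq> 0"
        then show False using ab_nz[of i j] Bmat_nz[of d c j k] ik' by blast
      next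
        assume "Bmat d c i j \<noteq> 0" "Bmat a b j k \<noteq> 0"
        then show False using ab_nz[of j k] Bmat_nz[of d c i j] ik' by blast
      qed
    qed
    \<comment> \<open>A component along alpha would force e to have root 2 alpha. This needs d =
      \<open>du d\<close> and a nonzero entry at (c, \<open>du c\<close>), which
      \<open>no_cc\<close> rules out.\<close>
    have ne2: "\<not> (t = s \<and> (i = c \<and> k = d \<or> i = du d \<and> k = du c))"
    proof
      assume "t = s \<and> (i = c \<and> k = d \<or> i = du d \<and> k = du c)"
      then have e: "i = c \<and> k = d \<or> i = du d \<and> k = du c" by blast
      from j show False
      proof (elim disjE conjE)
        assume nz: "Bmat a b i j \<noteq> 0" "Bmat d c j k \<noteq> 0"
        from Bmat_nz[OF nz(2)] e cd(3,4) have "k = du d \<and> j = du c \<and> i = c \<and> d = du d"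
          by (metis du_du)
        then show False using nz(1) no_cc by simp
      next
        assume nz: "Bmat d c i j \<noteq> 0" "Bmat a b j k \<noteq> 0"
        from Bmat_nz[OF nz(1)] e cd(3,4) have "i = d \<and> j = c \<and> k = du c \<and> d = du d"
          by (metis du_du)
        then show False using nz(2) no_cc by simp
      qed
    qed
    show "X i k t u \<in> {0}"
    proof (cases "Bmat i k = zmat")
      case True
      then show ?thesis by (simp add: Bt_gzero rho_gzero)
    next
      case False
      have "l i - l k + D * t \<noteq> 0" using h ik False ne1 unfolding height_def by blast
      then have "l i - l k + D * t > 0" using ht' pos by linarith
      then show ?thesis using u ik ne2 unfolding singular_except_def by blast
    qed
  next
    assume "fst (snd ?g) \<noteq> 0"
    from gbr_K_nz[OF this] obtain t i j where "fst (Bt a b r) t i j \<noteq> 0 \<and> fst (Bt d c (-s)) (-t) j i \<noteq> 0" by blast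
    then have "Bmat a b i j \<noteq> 0" "Bmat d c j i \<noteq> 0" "r = s" by (auto simp only: fst_Bt split: if_splits)
    then show "\<rho> Kel u \<in> {0}" using ab_nz[of i j] Bmat_nz[of d c j i] by blast
  qed (simp_all add: gbr_d subspace_single_0)
  moreover obtain k where "X a b r (X d c (-s) u) = sc k (X d c (-s) (X a b r u)) + \<rho> ?g u"
    using rho_comm[OF Bt_ghat[OF ab] Bt_ghat[OF cd(2,1)] homog_Bt homog_Bt] by blast
  ultimately show "X a b r (X d c (-s) u) = 0"
    using x0 by (simp add: rho_0 Bt_ghat cd)
qed

lemma singular_exceptI:
  assumes "singular_except l D c d s u" "c \<in> I" "d \<in> I" "X c d s u = 0"
  shows "singular l D u"
  unfolding singular_def
proof (intro ballI allI impI)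
  fix a b r assume ab: "a \<in> I" "b \<in> I" and pos: "l a - l b + D * r > 0"
  have "X (du d) (du c) s u = 0" using X_dual[OF assms(2,3)] assms(4) by simp
  then show "X a b r u = 0" using assms ab pos unfolding singular_except_def by metis
qed

lemma singular_except_of_singular: "singular l D u \<Longrightarrow> singular_except l D c d s u"
  unfolding singular_def singular_except_def by blast

text \<open>All raising operators but that of (a, b, r) are covered by
  \<open>singular_except_step\<close>; for the remaining one, \<open>q\<close> makes the coefficient
  in \<open>sl2_rel\<close> vanish.\<close>

lemma simple_power_zero:
  assumes h: "height l D" and v: "singular l D v" "wtv \<mu> v" "v \<noteq> 0"
    and ab: "a \<in> I" "b \<in> I" "a \<noteq> b" "a \<noteq> du b" "\<not> odd_idx a" "\<not> odd_idx b" "a \<noteq> E0"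
    and ht: "l a - l b + D * r = 1"
    and q: "\<mu> (hco a b r) = of_nat N * wt (hco a b r) a b r / 2"
  shows "(X b a (-r) ^^ Suc N) v = 0"
proof (rule lower_singular_zero[OF h v])
  have aa: "a \<noteq> du a" using ab(5,7) by (cases a) auto
  have "singular_except l D a b r ((X b a (-r) ^^ k) v)" for k
  proof (induction k)
    case (Suc k)
    from singular_except_step[OF h ab(1,2) aa ab(3) ab(5) ht Suc] show ?case by simp
  qed (use singular_except_of_singular[OF v(1)] in simp)
  moreover have "X a b r v = 0" using v(1) ab ht unfolding singular_def by simp
  then have "X a b r ((X b a (-r) ^^ Suc N) v) = 0"
    using sl2_rel[OF ab(1-6) _ v(2), of r N] unfolding q by simp
  ultimately show "singular l D ((X b a (-r) ^^ Suc N) v)" using singular_exceptI ab(1,2) by blast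
  show "wtv (\<lambda>h. \<mu> h + of_nat (Suc N) * wt h b a (-r)) ((X b a (-r) ^^ Suc N) v)"
    by (rule wtv_X_pow[OF v(2) ab(2,1)])
  have "wt (hl m n l D) b a (-r) = - of_int (l a - l b + D * r)" using wt_hl[OF ab(1,2)] wt_swap by metis
  then show "\<mu> (hl m n l D) + of_nat (Suc N) * wt (hl m n l D) b a (-r) = \<mu> (hl m n l D) - of_nat (Suc N)"
    unfolding ht by simp
qed

section \<open>From strings of weights to local nilpotency\<close>

lemma is_weight_cong: "(\<And>h. h \<in> hhat m n \<Longrightarrow> \<mu> h = \<nu> h) \<Longrightarrow> is_weight \<mu> \<longleftrightarrow> is_weight \<nu>"
  by (simp add: is_weight_def wtv_def)

text \<open>For a root this implies local nilpotency of its root space. It mentions only the set of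
  weights, so it can be carried along simple reflections.\<close>

definition leaves_weights :: "(ghat \<Rightarrow> complex) \<Rightarrow> bool" where
  "leaves_weights a \<longleftrightarrow> (\<forall>\<mu>. is_weight \<mu> \<longrightarrow> (\<exists>M. \<forall>N\<ge>M. \<not> is_weight (\<lambda>h. \<mu> h + of_nat N * a h)))"

lemma leaves_weights_cong:
  assumes "\<And>h. h \<in> hhat m n \<Longrightarrow> a h = a' h"
  shows "leaves_weights a \<longleftrightarrow> leaves_weights a'"
proof -
  have "is_weight (\<lambda>h. \<mu> h + of_nat N * a h) \<longleftrightarrow> is_weight (\<lambda>h. \<mu> h + of_nat N * a' h)" for \<mu> N
    using assms by (intro is_weight_cong) simp
  then show ?thesis by (simp add: leaves_weights_def)
qed

text \<open>Here x is any member of the root space. All its nonzero entries have weight a, and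
  components along K and d force a to vanish on the Cartan subalgebra.\<close>

lemma wtv_rootsp:
  assumes x: "x \<in> rootsp m n a" and w: "wtv \<mu> w"
  shows "wtv (\<lambda>h. \<mu> h + a h) (\<rho> x w)"
proof -
  have xg: "x \<in> ghat_set m n" using x by (simp add: rootsp_def)
  have root: "wt h i k r * fst x r i k = a h * fst x r i k" "a h * fst (snd x) = 0" "a h * snd (snd x) = 0"
    if "h \<in> hhat m n" for h r i k
  proof -
    have "gbr m n h x = gscale (a h) x" using x that by (simp add: rootsp_def)
    then have e: "(\<lambda>r i k. wt h i k r * fst x r i k, 0, 0) = gscale (a h) x" using gbr_hhat[OF that xg] by simp
    show "wt h i k r * fst x r i k = a h * fst x r i k" "a h * fst (snd x) = 0" "a h * snd (snd x) = 0"
      using arg_cong[OF e, of "\<lambda>y. fst y r i k"] arg_cong[OF e, of "\<lambda>y. fst (snd y)"]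
        arg_cong[OF e, of "\<lambda>y. snd (snd y)"] by (simp_all add: gscale_def)
  qed
  let ?S = "{u. wtv (\<lambda>h. \<mu> h + a h) u}"
  have S: "subspace ?S"
    by (rule subspaceI) (auto simp: wtv_def rho_0 rho_add rho_scale hhat_ghat scale_right_distrib mult.commute)
  have "\<rho> x w \<in> ?S"
  proof (rule act_mem[OF S xg])
    fix r i k assume nz: "fst x r i k \<noteq> 0" and ik: "i \<in> I" "k \<in> I"
    then have "wt h i k r = a h" if "h \<in> hhat m n" for h using root(1)[OF that, of i k r] by simp
    then show "X i k r w \<in> ?S" using wtv_X[OF w ik, of r] by (simp add: wtv_def)
  next
    have *: "sc c w \<in> ?S" if "\<And>h. h \<in> hhat m n \<Longrightarrow> a h = 0" for c
      using subspace_scale[OF S] w that by (simp add: wtv_def)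
    show "\<rho> Kel w \<in> ?S" if "fst (snd x) \<noteq> 0" unfolding wtvD[OF w Kel_hhat] using root(2) that by (intro *) auto
    show "\<rho> del w \<in> ?S" if "snd (snd x) \<noteq> 0" unfolding wtvD[OF w del_hhat] using root(3) that by (intro *) auto
  qed
  then show ?thesis by simp
qed

lemma nilpotent_of_leaves:
  assumes a: "leaves_weights a" and x: "x \<in> rootsp m n a" and v: "is_weight \<mu>0"
  shows "\<exists>N. (\<rho> x ^^ N) w = 0"
proof -
  have xg: "x \<in> ghat_set m n" using x by (simp add: rootsp_def)
  let ?S = "{w. \<exists>N. (\<rho> x ^^ N) w = 0}"
  have "w \<in> ?S" if w: "wtv \<mu> w" for w \<mu>
  proof (cases "w = 0")
    case True
    then show ?thesis by (auto intro: exI[of _ 0])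
  next
    case False
    then obtain M where M: "\<not> is_weight (\<lambda>h. \<mu> h + of_nat M * a h)"
      using a w unfolding leaves_weights_def is_weight_def by blast
    have "wtv (\<lambda>h. \<mu> h + of_nat N * a h) ((\<rho> x ^^ N) w)" for N
    proof (induction N)
      case (Suc N)
      from wtv_rootsp[OF x Suc] show ?case by (simp add: algebra_simps)
    qed (use w in simp)
    then have "(\<rho> x ^^ M) w = 0" using M unfolding is_weight_def by blast
    then show ?thesis by blast
  qed
  then have "span {w. \<exists>\<mu>. wtv \<mu> w} \<subseteq> ?S"
    by (intro span_minimal vs_endo.subspace_nilpotent[OF rho_endo[OF xg]]) blast
  then show ?thesis using weights_span[OF v] by blast
qed

text \<open>Heights of weights are bounded by that of the highest weight, while N steps along a
  climb by at least N. Weights are complex, hence the real parts.\<close>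

lemma leaves_weights_pos:
  assumes h: "height l D" and v: "singular l D v" "wtv \<mu>0 v" "v \<noteq> 0"
    and pos: "a (hl m n l D) = of_int k" "k > 0"
  shows "leaves_weights a"
  unfolding leaves_weights_def
proof (intro allI impI)
  fix \<mu> assume "is_weight \<mu>"
  let ?H = "hl m n l D"
  have H: "?H \<in> hhat m n" using h hl_hhat unfolding height_def by blast
  have bound: "Re (\<nu> ?H) \<le> Re (\<mu>0 ?H)" if \<nu>: "is_weight \<nu>" for \<nu>
  proof -
    from \<nu> obtain w where "w \<noteq> 0" "wtv \<nu> w" by (auto simp: is_weight_def)
    then obtain j where "\<nu> ?H = \<mu>0 ?H - of_nat j" using eigen_below[OF h v, of w] wtvD[OF _ H] by blast
    then show ?thesis by simp
  qed
  define M where "M = nat \<lceil>Re (\<mu>0 ?H) - Re (\<mu> ?H)\<rceil> + 1"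
  have "\<not> is_weight (\<lambda>h. \<mu> h + of_nat N * a h)" if "N \<ge> M" for N
  proof
    assume "is_weight (\<lambda>h. \<mu> h + of_nat N * a h)"
    from bound[OF this] have "real N * of_int k \<le> Re (\<mu>0 ?H) - Re (\<mu> ?H)" by (simp add: pos)
    moreover have "real N * 1 \<le> real N * of_int k" using pos(2) by (intro mult_left_mono) auto
    ultimately have "real N \<le> Re (\<mu>0 ?H) - Re (\<mu> ?H)" by simp
    moreover have "Re (\<mu>0 ?H) - Re (\<mu> ?H) < real M" unfolding M_def by linarith
    ultimately show False using that by linarith
  qed
  then show "\<exists>M. \<forall>N\<ge>M. \<not> is_weight (\<lambda>h. \<mu> h + of_nat N * a h)" by blast
qed

text \<open>The reflection is linear and maps weights to weights, so it takes a string in direction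
  \<gamma> to a string in the reflected direction.\<close>

lemma leaves_weights_reflect:
  assumes ab: "a \<in> I" "b \<in> I" "a \<noteq> b" "a \<noteq> du b" "\<not> odd_idx a" "\<not> odd_idx b"
    and nil: "\<And>w. \<exists>N. (X a b r ^^ N) w = 0" "\<And>w. \<exists>N. (X b a (-r) ^^ N) w = 0"
    and lw: "leaves_weights (\<lambda>h. \<gamma> h - 2 * \<gamma> (hco a b r) / wt (hco a b r) a b r * wt h a b r)"
  shows "leaves_weights \<gamma>"
  unfolding leaves_weights_def
proof (intro allI impI)
  let ?s = "\<lambda>\<mu> h. \<mu> h - 2 * \<mu> (hco a b r) / wt (hco a b r) a b r * wt h a b r"
  fix \<mu> assume "is_weight \<mu>"
  from weight_reflection[OF ab this nil] have "is_weight (?s \<mu>)" .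
  then obtain M where M: "\<And>N. N \<ge> M \<Longrightarrow> \<not> is_weight (\<lambda>h. ?s \<mu> h + of_nat N * ?s \<gamma> h)"
    using lw unfolding leaves_weights_def by blast
  have "\<not> is_weight (\<lambda>h. \<mu> h + of_nat N * \<gamma> h)" if "N \<ge> M" for N
  proof
    assume "is_weight (\<lambda>h. \<mu> h + of_nat N * \<gamma> h)"
    from weight_reflection[OF ab this nil] have "is_weight (?s (\<lambda>h. \<mu> h + of_nat N * \<gamma> h))" .
    also have "?s (\<lambda>h. \<mu> h + of_nat N * \<gamma> h) = (\<lambda>h. ?s \<mu> h + of_nat N * ?s \<gamma> h)"
      by (rule ext) (simp add: add_divide_distrib algebra_simps)
    finally show False using M[OF that] by simp
  qed
  then show "\<exists>M. \<forall>N\<ge>M. \<not> is_weight (\<lambda>h. \<mu> h + of_nat N * \<gamma> h)" by blast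
qed

end

section \<open>Heights and positive roots\<close>

text \<open>The weights of the natural module form one chain under the simple roots of \<open>\<Pi>\<close>;
  the height numbers its members from \<open>-(m+n)\<close> to \<open>m+n\<close>.\<close>
fun lht :: "nat \<Rightarrow> idx \<Rightarrow> int" where
  "lht n E0 = 0"
| "lht n (Ep i) = (if i \<le> n then 2 * int i else int n + int i)"
| "lht n (Em i) = - (if i \<le> n then 2 * int i else int n + int i)"
| "lht n (Fp j) = 2 * int j - 1"
| "lht n (Fm j) = - (2 * int j - 1)"

text \<open>Interchanging \<open>\<epsilon>\<^sub>p\<close> and \<open>\<delta>\<^sub>p\<close> is the odd reflection in \<open>\<beta>\<^sub>p\<close>; \<open>p = 0\<close> changes nothing.\<close>
fun sw :: "nat \<Rightarrow> idx \<Rightarrow> idx" where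
  "sw p E0 = E0"
| "sw p (Ep i) = (if i = p then Fp i else Ep i)"
| "sw p (Em i) = (if i = p then Fm i else Em i)"
| "sw p (Fp i) = (if i = p then Ep i else Fp i)"
| "sw p (Fm i) = (if i = p then Em i else Fm i)"

definition lsw :: "nat \<Rightarrow> nat \<Rightarrow> idx \<Rightarrow> int" where
  "lsw n p i = lht n (sw p i)"

lemma lsw_du: "lsw n p (du i) = - lsw n p i"
  by (cases i) (auto simp: lsw_def)

lemma lsw_inj: "a \<in> idxs m n \<Longrightarrow> b \<in> idxs m n \<Longrightarrow> p \<le> n \<Longrightarrow> lsw n p a = lsw n p b \<Longrightarrow> a = b"
  by (cases a; cases b) (auto simp: lsw_def split: if_splits, presburger+)

lemma lsw_bound:
  assumes "a \<in> idxs m n" "p \<le> n" "n < m"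
  shows "\<bar>lsw n p a\<bar> \<le> int n + int m" "\<bar>lsw n p a\<bar> = int n + int m \<Longrightarrow> a = Ep m \<or> a = Em m"
  using assms by (cases a; auto simp: lsw_def split: if_splits)+

lemma Bmat_even_dual:
  assumes "\<not> odd_idx a"
  shows "Bmat a (du a) = zmat"
proof (intro ext)
  fix i j
  have "sg a (du a) = -1" using assms by (cases a) (auto simp: sg_def)
  then show "Bmat a (du a) i j = zmat i j" by (simp add: Bmat_def zmat_def)
qed

context osp_module begin

text \<open>Heights on the natural module lie between -(m+n) and m+n. A difference of absolute value
  2(m+n) occurs only for a and b equal to \<open>Ep m\<close> and \<open>Em m\<close> in some order,
  where \<open>Bmat\<close> is zero. All other differences are smaller, which forces r = 0, and
  \<open>lsw_inj\<close> finishes.\<close>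

lemma lsw_height_zero:
  assumes ab: "a \<in> I" "b \<in> I" "Bmat a b \<noteq> zmat" and p: "p \<le> n" "n < m"
    and z: "lsw n p a - lsw n p b + (2 * (int n + int m)) * r = 0"
  shows "a = b \<and> r = 0"
proof -
  let ?D = "2 * (int n + int m)"
  note ba = lsw_bound[OF ab(1) p] and bb = lsw_bound[OF ab(2) p]
  have extremal: "x = - y \<and> \<bar>x\<bar> = N" if "\<bar>x\<bar> \<le> N" "\<bar>y\<bar> \<le> N" "\<not> \<bar>x - y\<bar> < 2 * N" for x y N :: int
    using that by presburger
  have lt: "\<bar>lsw n p a - lsw n p b\<bar> < ?D"
  proof (rule ccontr)
    assume "\<not> ?thesis"
    then have e: "lsw n p a = - lsw n p b" "\<bar>lsw n p a\<bar> = int n + int m"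
      using ba(1) bb(1) extremal[of "lsw n p a" "int n + int m" "lsw n p b"] by blast+
    then have "lsw n p a = lsw n p (du b)" by (simp add: lsw_du)
    then have "a = du b" using lsw_inj ab p by (metis du_idxs)
    then have "b = du a" by simp
    moreover have "\<not> odd_idx a" using ba(2)[OF e(2)] by auto
    ultimately show False using Bmat_even_dual ab(3) by blast
  qed
  have "?D * \<bar>r\<bar> = \<bar>?D * r\<bar>" by (simp add: abs_mult)
  also have "\<dots> < ?D * 1" using z lt by linarith
  finally have "\<bar>r\<bar> < 1" using p(2) by (simp add: mult_less_cancel_left)
  then have "r = 0" by simp
  with z have "lsw n p a = lsw n p b" by simp
  then show ?thesis using lsw_inj[OF ab(1,2) p(1)] \<open>r = 0\<close> by blast
qed

end

lemma (in osp_irreducible) height_lsw: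
  assumes "p \<le> n" "n < m"
  shows "height (lsw n p) (2 * (int n + int m))"
  unfolding height_def using lsw_du lsw_height_zero[OF _ _ _ assms] by blast

section \<open>Nonnegative combinations of simple roots\<close>

lemma finite_simple_roots: "finite (simple_roots m n)"
  unfolding simple_roots_def by simp

text \<open>The second half of \<open>pos_root\<close> by itself, so that it is closed under
  sums.\<close>

definition nneg :: "nat \<Rightarrow> nat \<Rightarrow> (ghat \<Rightarrow> complex) \<Rightarrow> bool" where
  "nneg m n a \<longleftrightarrow> (\<exists>c :: (ghat \<Rightarrow> complex) \<Rightarrow> nat. \<forall>h\<in>hhat m n.
        a h = (\<Sum>p\<in>simple_roots m n. of_nat (c p) * p h))"

lemma nneg_add:
  assumes "nneg m n a" "nneg m n b"
  shows "nneg m n (\<lambda>h. a h + b h)"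
proof -
  obtain c d where "\<forall>h\<in>hhat m n. a h = (\<Sum>p\<in>simple_roots m n. of_nat (c p) * p h)"
    "\<forall>h\<in>hhat m n. b h = (\<Sum>p\<in>simple_roots m n. of_nat (d p) * p h)"
    using assms unfolding nneg_def by blast
  then have "\<forall>h\<in>hhat m n. a h + b h = (\<Sum>p\<in>simple_roots m n. of_nat (c p + d p) * p h)"
    by (simp add: sum.distrib distrib_right)
  then show ?thesis unfolding nneg_def by (rule exI[of _ "\<lambda>p. c p + d p"])
qed

lemma nneg_0: "nneg m n (\<lambda>h. 0)"
  unfolding nneg_def by (rule exI[of _ "\<lambda>_. 0"]) simp

lemma nneg_simple:
  assumes "p \<in> simple_roots m n"
  shows "nneg m n p"
  unfolding nneg_def
proof (intro exI ballI)
  fix h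
  have "(\<Sum>q\<in>simple_roots m n. of_nat (if q = p then 1 else 0) * q h) = (\<Sum>q\<in>simple_roots m n. if q = p then q h else 0)"
    by (intro sum.cong) auto
  then show "p h = (\<Sum>q\<in>simple_roots m n. of_nat (if q = p then 1 else 0) * q h)"
    using assms finite_simple_roots by simp
qed

lemma nneg_cong: "nneg m n a \<Longrightarrow> (\<And>h. h \<in> hhat m n \<Longrightarrow> a h = b h) \<Longrightarrow> nneg m n b"
  unfolding nneg_def by auto

lemma nneg_mult: "nneg m n a \<Longrightarrow> nneg m n (\<lambda>h. of_nat k * a h)"
proof (induction k)
  case (Suc k)
  from nneg_add[OF Suc.IH[OF Suc.prems] Suc.prems] show ?case by (simp add: algebra_simps)
qed (simp add: nneg_0)

lemma hhat_Em: "h \<in> hhat m n \<Longrightarrow> fst h 0 (Em i) (Em i) = - eps i h"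
  using hhat_du[of h m n "Ep i"] by (simp add: eps_def)

lemma hhat_Fm: "h \<in> hhat m n \<Longrightarrow> fst h 0 (Fm i) (Fm i) = - dlt i h"
  using hhat_du[of h m n "Fp i"] by (simp add: dlt_def)

lemmas wt_simps = wt_def hhat_Em hhat_Fm eps_def[symmetric] dlt_def[symmetric] delt_def[symmetric]

lemma simple_roots_mem:
  "(\<lambda>x. delt x - eps m x - eps (m - 1) x) \<in> simple_roots m n"
  "n \<le> i \<Longrightarrow> i < m \<Longrightarrow> (\<lambda>x. eps (Suc i) x - eps i x) \<in> simple_roots m n"
  "1 \<le> j \<Longrightarrow> j \<le> n \<Longrightarrow> (\<lambda>x. eps j x - dlt j x) \<in> simple_roots m n"
  "1 \<le> j \<Longrightarrow> j < n \<Longrightarrow> (\<lambda>x. dlt (Suc j) x - eps j x) \<in> simple_roots m n"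
  "dlt 1 \<in> simple_roots m n"
  unfolding simple_roots_def by blast+

text \<open>The chain runs e_m, ..., e_(n+1), e_n, f_n, e_(n-1), ..., e_1, f_1, e_0 and continues
  with the dual vectors in reverse order; neighbours differ by one simple root.\<close>

lemma lht_pred:
  assumes "1 \<le> n" "n < m" "a \<in> idxs m n" "a \<noteq> Em m"
  shows "\<exists>a'\<in>idxs m n. lht n a' = lht n a - 1 \<and> nneg m n (\<lambda>h. wt h a a' 0)"
proof -
  show ?thesis
  proof (cases a)
    case E0
    then show ?thesis using assms
      by (intro bexI[of _ "Fm 1"] conjI nneg_cong[OF nneg_simple[OF simple_roots_mem(5)]]) (auto simp: wt_simps)
  next
    case (Ep i)
    show ?thesis
    proof (cases "i \<le> n")
      case True
      then show ?thesis using assms Ep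
        by (intro bexI[of _ "Fp i"] conjI nneg_cong[OF nneg_simple[OF simple_roots_mem(3)[of i]]]) (auto simp: wt_simps)
    next
      case False
      then obtain j where j: "i = Suc j" "n \<le> j" by (cases i) auto
      then show ?thesis using assms Ep
        by (intro bexI[of _ "Ep j"] conjI nneg_cong[OF nneg_simple[OF simple_roots_mem(2)[of n j]]]) (auto simp: wt_simps)
    qed
  next
    case (Em i)
    show ?thesis
    proof (cases "i < n")
      case True
      then show ?thesis using assms Em
        by (intro bexI[of _ "Fm (Suc i)"] conjI nneg_cong[OF nneg_simple[OF simple_roots_mem(4)[of i]]]) (auto simp: wt_simps)
    next
      case False
      moreover have "i < m" using assms Em by auto
      ultimately show ?thesis using assms Em
        by (intro bexI[of _ "Em (Suc i)"] conjI nneg_cong[OF nneg_simple[OF simple_roots_mem(2)[of n i]]]) (auto simp: wt_simps)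
    qed
  next
    case (Fp i)
    show ?thesis
    proof (cases "i = 1")
      case True
      then show ?thesis using assms Fp
        by (intro bexI[of _ E0] conjI nneg_cong[OF nneg_simple[OF simple_roots_mem(5)]]) (auto simp: wt_simps)
    next
      case False
      then obtain j where j: "i = Suc j" "1 \<le> j" using assms Fp by (cases i) auto
      then show ?thesis using assms Fp
        by (intro bexI[of _ "Ep j"] conjI nneg_cong[OF nneg_simple[OF simple_roots_mem(4)[of j]]]) (auto simp: wt_simps)
    qed
  next
    case (Fm i)
    then show ?thesis using assms
      by (intro bexI[of _ "Em i"] conjI nneg_cong[OF nneg_simple[OF simple_roots_mem(3)[of i]]]) (auto simp: wt_simps)
  qed
qed

lemma lht_lsw0: "a \<in> idxs m n \<Longrightarrow> lht n a = lsw n 0 a"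
  by (cases a) (auto simp: lsw_def)

lemma nneg_chain:
  assumes "1 \<le> n" "n < m" "b \<in> idxs m n"
  shows "a \<in> idxs m n \<Longrightarrow> lht n a = lht n b + int k \<Longrightarrow> nneg m n (\<lambda>h. wt h a b 0)"
proof (induction k arbitrary: a)
  case 0
  then have "a = b" using lsw_inj[of a m n b 0] assms by (simp add: lht_lsw0)
  then show ?case by (simp add: wt_def nneg_0)
next
  case (Suc k)
  have "a \<noteq> Em m"
    using Suc.prems assms lsw_bound(1)[of b m n 0] by (auto simp: lht_lsw0[of b m n, symmetric])
  then obtain a' where a': "a' \<in> idxs m n" "lht n a' = lht n a - 1" "nneg m n (\<lambda>h. wt h a a' 0)"
    using lht_pred assms Suc.prems by blast
  have "nneg m n (\<lambda>h. wt h a' b 0)" using Suc.IH[OF a'(1)] a'(2) Suc.prems by simp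
  from nneg_add[OF a'(3) this] show ?case by (rule nneg_cong) (simp add: wt_def)
qed

lemma nneg_lht_le:
  assumes "1 \<le> n" "n < m" "a \<in> idxs m n" "b \<in> idxs m n" "lht n b \<le> lht n a"
  shows "nneg m n (\<lambda>h. wt h a b 0)"
  using nneg_chain[OF assms(1,2,4,3), of "nat (lht n a - lht n b)"] assms(5) by simp

lemma lht_second:
  assumes "n < m" "a \<in> idxs m n"
  shows "a \<noteq> Em m \<Longrightarrow> lht n (Em (m - 1)) \<le> lht n a" "a \<noteq> Ep m \<Longrightarrow> lht n a \<le> lht n (Ep (m - 1))"
    "lht n (Em m) \<le> lht n a" "lht n a \<le> lht n (Ep m)"
  using assms by (cases a; auto; fail)+

text \<open>The root is delta - theta plus a descent from a to \<open>Em (m - 1)\<close> and one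
  from \<open>Ep m\<close> to b. For a = \<open>Em m\<close> the first is impossible, but then b is
  not \<open>Ep m\<close>, and one descent from \<open>Ep (m - 1)\<close> to b suffices.\<close>

lemma nneg_delta1:
  assumes nm: "1 \<le> n" "n < m" and ab: "a \<in> idxs m n" "b \<in> idxs m n" "Bmat a b \<noteq> zmat"
  shows "nneg m n (\<lambda>h. wt h a b 1)"
proof -
  have m: "Ep m \<in> idxs m n" "Em m \<in> idxs m n" "Ep (m - 1) \<in> idxs m n" "Em (m - 1) \<in> idxs m n"
    using nm by auto
  note S0 = nneg_simple[OF simple_roots_mem(1)[of m n]]
  show ?thesis
  proof (cases "a = Em m")
    case False
    from nneg_add[OF S0 nneg_add[OF nneg_lht_le[OF nm ab(1) m(4) lht_second(1)[OF nm(2) ab(1) False]]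
        nneg_lht_le[OF nm m(1) ab(2) lht_second(4)[OF nm(2) ab(2)]]]]
    show ?thesis by (rule nneg_cong) (simp add: wt_simps)
  next
    case True
    have "b \<noteq> Ep m" using True ab(3) Bmat_even_dual[of "Em m"] by auto
    from nneg_add[OF S0 nneg_lht_le[OF nm m(3) ab(2) lht_second(2)[OF nm(2) ab(2) this]]]
    show ?thesis by (rule nneg_cong) (simp add: True wt_simps)
  qed
qed

lemma nneg_delta:
  assumes "1 \<le> n" "n < m"
  shows "nneg m n delt"
proof -
  \<comment> \<open>delta is obtained as the sum of delta - eps_1 and eps_1.\<close>
  have "Bmat E0 (Ep 1) E0 (Ep 1) = 1" by (simp add: Bmat_def)
  then have "Bmat E0 (Ep 1) \<noteq> zmat" by (auto simp: zmat_def)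
  then have "nneg m n (\<lambda>h. wt h E0 (Ep 1) 1)" using assms by (intro nneg_delta1) auto
  moreover have "nneg m n (\<lambda>h. wt h (Ep 1) E0 0)" using assms by (intro nneg_lht_le) auto
  ultimately have "nneg m n (\<lambda>h. wt h E0 (Ep 1) 1 + wt h (Ep 1) E0 0)" by (rule nneg_add)
  then show ?thesis by (rule nneg_cong) (simp add: wt_simps)
qed

lemma nneg_wt:
  assumes nm: "1 \<le> n" "n < m" and ab: "a \<in> idxs m n" "b \<in> idxs m n" "Bmat a b \<noteq> zmat"
    and pos: "lht n a - lht n b + 2 * (int n + int m) * r > 0"
  shows "nneg m n (\<lambda>h. wt h a b r)"
proof -
  consider "r = 0" | "r \<ge> 1" | "r \<le> -1" by linarith
  then show ?thesis
  proof cases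
    case 1
    then show ?thesis using nneg_lht_le[OF nm ab(1,2)] pos by simp
  next
    case 2
    define k where "k = nat (r - 1)"
    have k: "r = 1 + int k" using 2 by (simp add: k_def)
    from nneg_add[OF nneg_delta1[OF nm ab] nneg_mult[OF nneg_delta[OF nm], of k]]
    show ?thesis by (rule nneg_cong) (simp add: k wt_simps algebra_simps)
  next
    case 3
    \<comment> \<open>For negative r the term q outweighs every difference of heights on the natural
      module.\<close>
    define q where "q = 2 * (int n + int m) * r"
    have "q \<le> - (2 * (int n + int m))"
      unfolding q_def using mult_left_mono[OF 3, of "2 * (int n + int m)"] by simp
    moreover have "lht n a \<le> int n + int m" "- lht n b \<le> int n + int m"
      using lsw_bound(1)[of a m n 0] lsw_bound(1)[of b m n 0] ab nm by (auto simp: lht_lsw0 abs_le_iff)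
    moreover have "0 < lht n a - lht n b + q" using pos unfolding q_def .
    ultimately have False by presburger
    then show ?thesis ..
  qed
qed

lemma Bt_rootsp: "a \<in> idxs m n \<Longrightarrow> b \<in> idxs m n \<Longrightarrow> Bt a b r \<in> rootsp m n (\<lambda>h. wt h a b r)"
  by (simp add: rootsp_def Bt_ghat gbr_hhat_Bt)

lemma Bt_nonzero: "Bmat a b \<noteq> zmat \<Longrightarrow> Bt a b r \<noteq> gzero"
proof
  assume nz: "Bmat a b \<noteq> zmat" and "Bt a b r = gzero"
  then have "fst (Bt a b r) r = fst gzero r" by simp
  then show False using nz by (simp add: Bt_def gzero_def)
qed

text \<open>The bridge from heights to \<open>pos_root\<close>, through which
  \<open>hw_vector\<close> and the first clause of \<open>integrable\<close> become
  available.\<close>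

lemma pos_root_wt:
  assumes nm: "1 \<le> n" "n < m" and ab: "a \<in> idxs m n" "b \<in> idxs m n" "Bmat a b \<noteq> zmat"
    and pos: "lht n a - lht n b + 2 * (int n + int m) * r > 0"
  shows "pos_root m n (\<lambda>h. wt h a b r)"
proof -
  let ?H = "hl m n (lsw n 0) (2 * (int n + int m))"
  have "?H \<in> hhat m n" using hl_hhat lsw_du by blast
  moreover have "wt ?H a b r \<noteq> 0" unfolding wt_hl[OF ab(1,2)] using pos ab by (simp only: lht_lsw0 of_int_eq_0_iff)
  ultimately have "is_root m n (\<lambda>h. wt h a b r)"
    unfolding is_root_def using Bt_rootsp[OF ab(1,2)] Bt_nonzero[OF ab(3)] by blast
  then show ?thesis using nneg_wt[OF assms] unfolding pos_root_def nneg_def by blast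
qed

section \<open>Coordinates on the Cartan subalgebra\<close>

definition Dg :: "idx \<Rightarrow> ghat" where
  "Dg p = (\<lambda>s i j. if s = 0 \<and> i = j then of_bool (i = p) - of_bool (i = du p) else 0, 0, 0)"

lemma diag_hhat:
  assumes "\<And>i. g (du i) = - g i" "\<And>i. i \<notin> idxs m n \<Longrightarrow> g i = 0"
  shows "(\<lambda>s i j. if s = 0 \<and> i = j then g i else 0, k, e) \<in> hhat m n"
proof -
  have s: "sg i i = -1" for i by (cases i) (auto simp: sg_def)
  have "osp m n (\<lambda>i j. if i = j then g i else 0)"
    unfolding osp_iff using assms(2) by (auto simp: s assms(1))
  then show ?thesis by (simp add: hhat_def zmat_def)
qed

lemma Dg_hhat: "p \<in> idxs m n \<Longrightarrow> Dg p \<in> hhat m n"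
  unfolding Dg_def
proof (rule diag_hhat)
  assume p: "p \<in> idxs m n"
  show "of_bool (i = p) - of_bool (i = du p) = (0 :: complex)" if "i \<notin> idxs m n" for i
    using p that by (metis cancel_comm_monoid_add_class.diff_cancel du_idxs of_bool_eq(1))
qed (simp add: du_eq_swap)

lemma Eh_Dg: "Eh i = Dg (Ep i)"
  by (auto simp: Eh_def Dg_def zmat_def fun_eq_iff)

lemma Fh_Dg: "Fh i = Dg (Fp i)"
  by (auto simp: Fh_def Dg_def zmat_def fun_eq_iff)

lemma hstarD:
  assumes "hstar m n L" "h \<in> hhat m n"
  shows "h' \<in> hhat m n \<Longrightarrow> L (gadd h h') = L h + L h'" "L (gscale a h) = a * L h"
  using assms unfolding hstar_def by blast+

lemma gadd_hhat:
  assumes h: "h \<in> hhat m n" "h' \<in> hhat m n"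
  shows "gadd h h' \<in> hhat m n"
  using hhatD[OF h(1)] hhatD[OF h(2)] osp_add[OF hhatD(2)[OF h(1)] hhatD(2)[OF h(2)]]
  by (simp add: hhat_def gadd_def zmat_def fun_eq_iff)

lemma gscale_hhat:
  assumes h: "h \<in> hhat m n"
  shows "gscale c h \<in> hhat m n"
  using hhatD[OF h] osp_scale[OF hhatD(2)[OF h]]
  by (simp add: hhat_def gscale_def zmat_def fun_eq_iff)

text \<open>L is linear only on the Cartan subalgebra, so h is assembled inside it, one coordinate
  at a time; P contains at most one index of each dual pair.\<close>

lemma hstar_expand_aux:
  assumes L: "hstar m n L" and h: "h \<in> hhat m n" and P: "finite P" "P \<subseteq> Ep ` {1..m} \<union> Fp ` {1..n}"
  defines "T \<equiv> \<lambda>P. (\<lambda>s i j. if s = 0 \<and> i = j then (if i \<in> P \<or> du i \<in> P then fst h 0 i i else 0) else 0, lam0 h, delt h) :: ghat"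
  shows "T P \<in> hhat m n \<and> L (T P) = (\<Sum>p\<in>P. fst h 0 p p * L (Dg p)) + lam0 h * L Kel + delt h * L del"
  using P
proof (induction P rule: finite_induct)
  case empty
  have "T {} = gadd (gscale (lam0 h) Kel) (gscale (delt h) del)"
    by (simp add: T_def gadd_def gscale_def Kel_def del_def zmat_def fun_eq_iff)
  then show ?case
    by (simp add: hstarD[OF L] gadd_hhat gscale_hhat Kel_hhat del_hhat)
next
  case (insert p P)
  have p: "p \<in> idxs m n" "du p \<notin> insert p P" "p \<noteq> du p" using insert.prems by auto
  have IH: "T P \<in> hhat m n" "L (T P) = (\<Sum>p\<in>P. fst h 0 p p * L (Dg p)) + lam0 h * L Kel + delt h * L del"
    using insert by auto
  have "fst (T (insert p P)) s i j = fst (gadd (gscale (fst h 0 p p) (Dg p)) (T P)) s i j" for s i j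
  proof (cases "s = 0 \<and> i = j")
    case True
    consider "i = p" | "i = du p" | "i \<noteq> p" "i \<noteq> du p" by blast
    then show ?thesis
    proof cases
      case 1
      then show ?thesis using True p insert.hyps by (simp add: T_def gadd_def gscale_def Dg_def)
    next
      case 2
      then have e: "i = du p" "j = du p" "s = 0" using True by auto
      have "fst h 0 (du p) (du p) = - fst h 0 p p" by (rule hhat_du[OF h])
      then show ?thesis unfolding e using p insert.hyps by (simp add: T_def gadd_def gscale_def Dg_def)
    next
      case 3
      then have "du i \<noteq> p" by auto
      then show ?thesis using True 3 by (simp add: T_def gadd_def gscale_def Dg_def)
    qed
  next
    case False
    show ?thesis unfolding T_def gadd_def gscale_def Dg_def fst_conv if_not_P[OF False] by simp
  qed
  then have "T (insert p P) = gadd (gscale (fst h 0 p p) (Dg p)) (T P)"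
    by (rule ghat_eqI) (simp_all add: T_def gadd_def gscale_def Dg_def)
  then show ?case using IH insert.hyps Dg_hhat[OF p(1)]
    by (simp add: gadd_hhat gscale_hhat hstarD[OF L])
qed

lemma hstar_expand:
  assumes L: "hstar m n L" and h: "h \<in> hhat m n"
  shows "L h = (\<Sum>i=1..m. eps i h * L (Eh i)) + (\<Sum>j=1..n. dlt j h * L (Fh j)) + lam0 h * L Kel + delt h * L del"
proof -
  let ?P = "Ep ` {1..m} \<union> Fp ` {1..n}"
  have diag: "fst h 0 i i = 0" if "i \<notin> ?P" "du i \<notin> ?P" for i
  proof (rule ccontr)
    assume nz: "fst h 0 i i \<noteq> 0"
    then have "i \<in> idxs m n" using ospD[OF hhatD(2)[OF h]] by blast
    moreover have "i \<noteq> E0" using nz hhat_E0[OF h] by metis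
    ultimately show False using that by (cases i) auto
  qed
  have off: "fst h s i j = 0" if "\<not> (s = 0 \<and> i = j)" for s i j
    using that hhatD(1)[OF h, of s] hhatD(3)[OF h, of i j] by (cases "s = 0") (auto simp: zmat_def)
  have "h = (\<lambda>s i j. if s = 0 \<and> i = j then (if i \<in> ?P \<or> du i \<in> ?P then fst h 0 i i else 0) else 0, lam0 h, delt h)"
  proof (rule ghat_eqI)
    fix s i j
    have "fst h s i j = (if s = 0 \<and> i = j then (if i \<in> ?P \<or> du i \<in> ?P then fst h 0 i i else 0) else 0)"
    proof (cases "s = 0 \<and> i = j")
      case True
      then show ?thesis using diag[of i] by (cases "i \<in> ?P \<or> du i \<in> ?P") (simp_all only: if_True if_False simp_thms de_Morgan_disj)
    next
      case False
      show ?thesis by (simp only: off[OF False] if_not_P[OF False])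
    qed
    then show "fst h s i j = fst (\<lambda>s i j. if s = 0 \<and> i = j then (if i \<in> ?P \<or> du i \<in> ?P then fst h 0 i i else 0) else 0, lam0 h, delt h) s i j"
      by (simp only: fst_conv)
  qed (simp_all add: lam0_def delt_def)
  then have "L h = (\<Sum>p\<in>?P. fst h 0 p p * L (Dg p)) + lam0 h * L Kel + delt h * L del"
    using hstar_expand_aux[OF L h, of ?P] by simp
  also have "(\<Sum>p\<in>?P. fst h 0 p p * L (Dg p)) = (\<Sum>p\<in>Ep ` {1..m}. fst h 0 p p * L (Dg p)) + (\<Sum>p\<in>Fp ` {1..n}. fst h 0 p p * L (Dg p))"
    by (rule sum.union_disjoint) auto
  also have "\<dots> = (\<Sum>i=1..m. eps i h * L (Eh i)) + (\<Sum>j=1..n. dlt j h * L (Fh j))"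
    by (simp add: sum.reindex inj_on_def eps_def dlt_def Eh_Dg Fh_Dg)
  finally show ?thesis by simp
qed

lemma hco_coords:
  "hco (Ep 1) E0 0 = Eh 1"
  "hco (Ep (Suc i)) (Ep i) 0 = gadd (Eh (Suc i)) (gscale (-1) (Eh i))"
  "2 \<le> m \<Longrightarrow> hco (Em m) (Ep (m - 1)) 1 = gadd Kel (gscale (-1) (gadd (Eh m) (Eh (m - 1))))"
  "hco (Ep p) (Fp p) 0 = gadd (Eh p) (Fh p)"
  unfolding Eh_Dg Fh_Dg
  by (rule ghat_eqI; simp add: hco_def Dg_def gadd_def gscale_def Kel_def zmat_def)+

lemma hstar_hco:
  assumes hstar: "hstar m n L" and m: "2 \<le> m"
  shows "L (hco (Ep 1) E0 0) = L (Eh 1)"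
  "1 \<le> i \<Longrightarrow> i < m \<Longrightarrow> L (hco (Ep (Suc i)) (Ep i) 0) = L (Eh (Suc i)) - L (Eh i)"
  "L (hco (Em m) (Ep (m - 1)) 1) = L Kel - L (Eh m) - L (Eh (m - 1))"
proof -
  have E: "Eh i \<in> hhat m n" if "1 \<le> i" "i \<le> m" for i unfolding Eh_Dg using that by (auto intro: Dg_hhat)
  show "L (hco (Ep 1) E0 0) = L (Eh 1)" unfolding hco_coords ..
  show "L (hco (Ep (Suc i)) (Ep i) 0) = L (Eh (Suc i)) - L (Eh i)" if "1 \<le> i" "i < m"
    unfolding hco_coords using E[of i] E[of "Suc i"] that by (simp add: hstarD[OF hstar] gscale_hhat)
  show "L (hco (Em m) (Ep (m - 1)) 1) = L Kel - L (Eh m) - L (Eh (m - 1))"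
    using m E[of m] E[of "m - 1"] unfolding hco_coords(3)[OF m]
    by (simp add: hstarD[OF hstar] gscale_hhat gadd_hhat Kel_hhat)
qed

section \<open>Highest weight modules annihilated by the isotropic simple roots\<close>

locale osp_hw = osp_irreducible m n sc \<rho>
  for m n :: nat and sc :: "complex \<Rightarrow> 'v::ab_group_add \<Rightarrow> 'v" and \<rho> :: "ghat \<Rightarrow> 'v \<Rightarrow> 'v" +
  fixes L :: "ghat \<Rightarrow> complex" and v :: 'v
  assumes n1: "1 \<le> n" and nm: "n < m" and hstar: "hstar m n L"
    and iso: "\<forall>i\<in>{1..n}. hsform m n L (beta i) = 0" and hw: "hw_vector m n sc \<rho> L v"
begin

abbreviation DD :: int where "DD \<equiv> 2 * (int n + int m)"

lemma v_nz: "v \<noteq> 0" and v_wt: "wtv L v"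
  using hw by (auto simp: hw_vector_def wtv_def)

lemma L_weight: "is_weight L"
  using v_nz v_wt by (auto simp: is_weight_def)

lemma v_singular: "singular (lsw n 0) DD v"
  unfolding singular_def
proof (intro ballI allI impI)
  fix a b r assume ab: "a \<in> I" "b \<in> I" and pos: "lsw n 0 a - lsw n 0 b + DD * r > 0"
  show "X a b r v = 0"
  proof (cases "Bmat a b = zmat")
    case True
    then show ?thesis by (simp add: Bt_gzero rho_gzero)
  next
    case False
    have "pos_root m n (\<lambda>h. wt h a b r)"
      using pos_root_wt[OF n1 nm ab False] pos by (simp add: lht_lsw0[OF ab(1)] lht_lsw0[OF ab(2)])
    then show ?thesis using hw Bt_rootsp[OF ab] unfolding hw_vector_def by blast
  qed
qed

lemma L_Fh: "1 \<le> i \<Longrightarrow> i \<le> n \<Longrightarrow> L (Fh i) = - L (Eh i)"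
proof -
  assume i: "1 \<le> i" "i \<le> n"
  have b: "beta i (Eh j) = of_bool (j = i)" "beta i (Fh j) = - of_bool (j = i)" for j
    by (auto simp: beta_def eps_def dlt_def Eh_def Fh_def)
  have "(\<Sum>j=1..m. L (Eh j) * beta i (Eh j)) = L (Eh i)"
    unfolding b using i nm by (simp add: of_bool_def if_distrib cong: if_cong)
  moreover have "(\<Sum>j=1..n. L (Fh j) * beta i (Fh j)) = - L (Fh i)"
    unfolding b using i by (simp add: of_bool_def if_distrib sum_negf cong: if_cong)
  moreover have "beta i Kel = 0" "beta i del = 0"
    by (simp_all add: beta_def eps_def dlt_def Kel_def del_def zmat_def)
  moreover have "hsform m n L (beta i) = 0" using iso i by simp
  ultimately have "L (Eh i) + L (Fh i) = 0" unfolding hsform_def by simp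
  then show ?thesis by (simp add: eq_neg_iff_add_eq_0 add.commute)
qed

text \<open>The root vectors of beta_p and -beta_p have bracket \<open>gadd (Eh p) (Fh p)\<close>,
  on which L vanishes by \<open>L_Fh\<close>. The other raising operators fall under
  \<open>singular_except_step\<close>.\<close>

lemma isotropic_zero:
  assumes p: "1 \<le> p" "p \<le> n"
  shows "X (Fp p) (Ep p) 0 v = 0"
proof (rule lower_singular_zero[OF _ v_singular v_wt v_nz])
  let ?a = "Ep p" and ?b = "Fp p"
  have ab: "?a \<in> I" "?b \<in> I" using p nm by auto
  show h: "height (lsw n 0) DD" by (rule height_lsw) (use nm in auto)
  have "singular_except (lsw n 0) DD ?a ?b 0 (X ?b ?a (-0) v)"
    by (rule singular_except_step[OF h ab]) (use p singular_except_of_singular[OF v_singular] in \<open>auto simp: lsw_def\<close>)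
  moreover have "X ?a ?b 0 (X ?b ?a 0 v) = 0"
  proof -
    obtain c where "X ?a ?b 0 (X ?b ?a 0 v) = sc c (X ?b ?a 0 (X ?a ?b 0 v)) + \<rho> (gbr m n (Bt ?a ?b 0) (Bt ?b ?a 0)) v"
      using rho_comm[OF Bt_ghat[OF ab] Bt_ghat[OF ab(2,1)] homog_Bt homog_Bt] by blast
    moreover have "X ?a ?b 0 v = 0" using v_singular ab p unfolding singular_def by (auto simp: lsw_def)
    moreover have "gbr m n (Bt ?a ?b 0) (Bt ?b ?a 0) = gadd (Eh p) (Fh p)"
      using gbr_Bt_Bt[OF ab, of 0] by (simp add: hco_coords)
    moreover have "\<rho> (gadd (Eh p) (Fh p)) v = 0"
    proof -
      have E: "Eh p \<in> hhat m n" "Fh p \<in> hhat m n" unfolding Eh_Dg Fh_Dg using ab by (auto intro: Dg_hhat)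
      show ?thesis using wtvD[OF v_wt gadd_hhat[OF E]] hstarD(1)[OF hstar E] L_Fh[OF p] by simp
    qed
    ultimately show ?thesis using rho_0[OF Bt_ghat[OF ab(2,1)]] by simp
  qed
  ultimately show "singular (lsw n 0) DD (X ?b ?a 0 v)" using singular_exceptI ab by simp
  show "wtv (\<lambda>h. L h + wt h ?b ?a 0) (X ?b ?a 0 v)" by (rule wtv_X[OF v_wt ab(2,1)])
  show "L (hl m n (lsw n 0) DD) + wt (hl m n (lsw n 0) DD) ?b ?a 0 = L (hl m n (lsw n 0) DD) - of_nat (Suc 0)"
    unfolding wt_hl[OF ab(2,1)] using p by (simp add: lsw_def)
qed

lemma lsw_diff: "p \<le> n \<Longrightarrow> a \<in> I \<Longrightarrow> lsw n p a = lsw n 0 a + of_bool (a = Fp p) + of_bool (a = Em p)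
    - of_bool (a = Ep p) - of_bool (a = Fm p)"
  by (cases a) (auto simp: lsw_def)

text \<open>Interchanging eps_p and delta_p makes -beta_p the only new positive root, and its root
  vector kills v by \<open>isotropic_zero\<close>.\<close>

lemma v_singular_odd:
  assumes p: "p \<le> n"
  shows "singular (lsw n p) DD v"
proof (cases "p = 0")
  case True
  then show ?thesis using v_singular by simp
next
  case False
  then have p1: "1 \<le> p" by simp
  show ?thesis
    unfolding singular_def
  proof (intro ballI allI impI)
    fix a b r assume ab: "a \<in> I" "b \<in> I" and pos: "lsw n p a - lsw n p b + DD * r > 0"
    let ?H = "lsw n 0 a - lsw n 0 b + DD * r"
    consider "?H > 0" | "Bmat a b = zmat" | "?H \<le> 0" "Bmat a b \<noteq> zmat" by linarith
    then show "X a b r v = 0"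
    proof cases
      case 1
      then show ?thesis using v_singular ab unfolding singular_def by blast
    next
      case 2
      then show ?thesis by (simp add: Bt_gzero rho_gzero)
    next
      case 3
      have "?H \<noteq> 0"
      proof
        assume "?H = 0"
        then have "a = b" "r = 0" using lsw_height_zero[OF ab 3(2) _ nm, of 0 r] by auto
        then show False using pos by simp
      qed
      then have H: "?H \<le> -1" using 3(1) by linarith
      define q where "q = (int n + int m) * r"
      have q: "DD * r = 2 * q" by (simp add: q_def)
      \<comment> \<open>The interchange raises a height by at most 2. As \<open>?H\<close> is at
        most -1, it equals -1 and both indices contribute.\<close>
      have "a = Fp p \<or> a = Em p" "b = Ep p \<or> b = Fm p" "?H = -1"
        using H pos unfolding lsw_diff[OF p ab(1)] lsw_diff[OF p ab(2)] q
        by (auto simp: of_bool_def split: if_splits)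
      \<comment> \<open>Since \<open>DD * r\<close> is even, parity leaves only the two labels of
        -beta_p among the four combinations.\<close>
      then consider "a = Fp p" "b = Ep p" "q = 0" | "a = Em p" "b = Fm p" "q = 0"
        unfolding q using p p1 by (auto simp: lsw_def; presburger)
      then show ?thesis
      proof cases
        case 1
        then have "r = 0" using nm by (simp add: q_def)
        then show ?thesis using 1 isotropic_zero[OF p1 p] by simp
      next
        case 2
        then have "r = 0" using nm by (simp add: q_def)
        then show ?thesis using 2 isotropic_zero[OF p1 p] X_dual[of "Fp p" "Ep p" 0 v] p p1 nm by simp
      qed
    qed
  qed
qed

lemma nil_pair:
  assumes ab: "a \<in> I" "b \<in> I" "a \<noteq> b" "a \<noteq> du b" "\<not> odd_idx a" "\<not> odd_idx b" "a \<noteq> E0"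
    and p: "p \<le> n" and ht: "lsw n p a - lsw n p b + DD * r = 1"
    and q: "L (hco a b r) = of_nat N * wt (hco a b r) a b r / 2"
  shows "\<exists>M. (X a b r ^^ M) w = 0" "\<exists>M. (X b a (-r) ^^ M) w = 0"
proof -
  note s = v_singular_odd[OF p] and h = height_lsw[OF p nm]
  have ne: "lsw n 0 a \<noteq> lsw n 0 b" using lsw_inj[OF ab(1,2)] ab(3) by blast
  \<comment> \<open>\<open>nilpotent_all\<close> asks for a grading that the operator strictly
    lowers; either \<open>lsw n 0\<close> or its negative is one.\<close>
  have nil: "\<exists>M. (X c d r' ^^ M) w = 0"
    if cd: "c \<in> I" "d \<in> I" "\<not> odd_idx c" "\<not> odd_idx d" "lsw n 0 c \<noteq> lsw n 0 d" "(X c d r' ^^ M) v = 0" for c d r' M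
  proof -
    have du: "lsw n 0 (du i) = - lsw n 0 i" "- lsw n 0 (du i) = - (- lsw n 0 i)" for i by (simp_all add: lsw_du)
    have o: "odd_idx c = odd_idx d" using cd by simp
    show ?thesis
    proof (cases "lsw n 0 c < lsw n 0 d")
      case True
      show ?thesis by (rule nilpotent_all[where phi = "lsw n 0", OF cd(1,2) o du(1) True v_nz cd(6)])
    next
      case False
      then have "- lsw n 0 c < - lsw n 0 d" using cd(5) by simp
      then show ?thesis by (intro nilpotent_all[where phi = "\<lambda>i. - lsw n 0 i", OF cd(1,2) o du(2) _ v_nz cd(6)])
    qed
  qed
  have "(X a b r ^^ 1) v = 0" using s ab ht unfolding singular_def by simp
  then show "\<exists>M. (X a b r ^^ M) w = 0" using nil ab ne by blast
  have "(X b a (-r) ^^ Suc N) v = 0" by (rule simple_power_zero[OF h s v_wt v_nz ab ht q])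
  then show "\<exists>M. (X b a (-r) ^^ M) w = 0" using nil ab ne[symmetric] by blast
qed

lemma integral_of_nil:
  assumes ab: "a \<in> I" "b \<in> I" "a \<noteq> b" "a \<noteq> du b" "\<not> odd_idx a" "\<not> odd_idx b"
    and pos: "lsw n 0 a - lsw n 0 b + DD * r > 0"
    and nil: "(X b a (-r) ^^ M) v = 0"
  shows "\<exists>N::nat. L (hco a b r) = of_nat N * wt (hco a b r) a b r / 2"
proof -
  have e: "X a b r v = 0" using v_singular ab pos unfolding singular_def by blast
  obtain N where "(X b a (-r) ^^ N) v \<noteq> 0" "(X b a (-r) ^^ Suc N) v = 0" using first_nilpotent[OF nil v_nz] .
  then show ?thesis using hw_integral[OF ab e v_wt] by blast
qed

text \<open>The triples \<open>(a, b, r)\<close> whose root vectors \<open>Bt a b r\<close> span the simple root spaces of the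
  affine algebra of \<open>so(2m+1)\<close>.\<close>
definition simple_triple :: "idx \<Rightarrow> idx \<Rightarrow> int \<Rightarrow> bool" where
  "simple_triple a b r \<longleftrightarrow> a = Ep 1 \<and> b = E0 \<and> r = 0 \<or> (\<exists>i. 1 \<le> i \<and> i < m \<and> a = Ep (Suc i) \<and> b = Ep i \<and> r = 0)
     \<or> a = Em m \<and> b = Ep (m - 1) \<and> r = 1"

lemma simple_tripleD:
  assumes "simple_triple a b r"
  shows "a \<in> I" "b \<in> I" "a \<noteq> b" "a \<noteq> du b" "\<not> odd_idx a" "\<not> odd_idx b" "a \<noteq> E0"
    "lsw n 0 a - lsw n 0 b + DD * r > 0"
  using assms n1 nm unfolding simple_triple_def by (auto simp: lsw_def)

text \<open>The interchange lowers eps_p by one and leaves eps_(p-1) in place. So p is 1 for eps_1,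
  i + 1 for eps_(i+1) - eps_i with i < n, and 0 for the roots that are simple from the
  start.\<close>

lemma simple_triple_height:
  assumes "simple_triple a b r"
  shows "\<exists>p\<le>n. lsw n p a - lsw n p b + DD * r = 1"
proof -
  from assms consider "a = Ep 1" "b = E0" "r = 0" | i where "1 \<le> i" "i < m" "a = Ep (Suc i)" "b = Ep i" "r = 0"
    | "a = Em m" "b = Ep (m - 1)" "r = 1" unfolding simple_triple_def by blast
  then show ?thesis
  proof cases
    case 1
    then show ?thesis using n1 by (intro exI[of _ 1]) (simp add: lsw_def)
  next
    case 2
    show ?thesis
    proof (cases "i < n")
      case True
      then show ?thesis using 2 by (intro exI[of _ "Suc i"]) (simp add: lsw_def)
    next
      case False
      then show ?thesis using 2 by (intro exI[of _ 0]) (auto simp: lsw_def)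
    qed
  next
    case 3
    then show ?thesis using n1 nm by (intro exI[of _ 0]) (auto simp: lsw_def)
  qed
qed

text \<open>The factor \<open>wt (hco a b r) a b r / 2\<close> corrects the normalization of
  \<open>hco\<close>, so that N is the value of L on the coroot.\<close>

definition dominant :: bool where
  "dominant \<longleftrightarrow> (\<forall>a b r. simple_triple a b r \<longrightarrow> (\<exists>N::nat. L (hco a b r) = of_nat N * wt (hco a b r) a b r / 2))"

lemma simple_nilpotent:
  assumes dominant "simple_triple a b r"
  shows "\<exists>M. (X a b r ^^ M) w = 0" "\<exists>M. (X b a (-r) ^^ M) w = 0"
proof -
  obtain p where "p \<le> n" "lsw n p a - lsw n p b + DD * r = 1" using simple_triple_height[OF assms(2)] by blast
  moreover obtain N where "L (hco a b r) = of_nat N * wt (hco a b r) a b r / 2" using assms unfolding dominant_def by blast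
  ultimately show "\<exists>M. (X a b r ^^ M) w = 0" "\<exists>M. (X b a (-r) ^^ M) w = 0"
    using nil_pair[OF simple_tripleD(1-7)[OF assms(2)]] by blast+
qed

text \<open>A lattice that contains the real roots of the affine algebra of so(2m+1) and is stable
  under its simple reflections, which act on the coordinates x and s.\<close>

definition vec :: "(nat \<Rightarrow> int) \<Rightarrow> int \<Rightarrow> ghat \<Rightarrow> complex" where
  "vec x s h = (\<Sum>i=1..m. of_int (x i) * eps i h) + of_int s * delt h"

lemma vec_upd:
  assumes "j \<in> {1..m}"
  shows "vec (x(j := y)) s h = vec x s h + of_int (y - x j) * eps j h"
proof -
  have "(\<Sum>i=1..m. of_int ((x(j := y)) i) * eps i h) = (\<Sum>i=1..m. of_int (x i) * eps i h + (if i = j then of_int (y - x j) * eps j h else 0))"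
    by (intro sum.cong) (auto simp: algebra_simps)
  then show ?thesis using assms by (simp add: vec_def sum.distrib)
qed

lemma eps_Dg: "eps i (Dg (Ep j)) = of_bool (i = j)"
  by (simp add: eps_def Dg_def)

lemma vec_Eh: "i \<in> {1..m} \<Longrightarrow> vec x s (Eh i) = of_int (x i)"
  by (simp add: vec_def eps_Dg Eh_Dg delt_def Dg_def[of "Ep i", THEN arg_cong, of "\<lambda>y. snd (snd y)"] of_bool_def if_distrib cong: if_cong)

lemma hstar_vec: "hstar m n (vec x s)"
  unfolding hstar_def vec_def
  by (simp add: eps_def delt_def gadd_def gscale_def sum.distrib sum_distrib_left algebra_simps)

end

section \<open>Descent by simple reflections\<close>

context osp_hw begin

lemma m2: "2 \<le> m"
  using n1 nm by simp

lemma vec_Kel: "vec x s Kel = 0"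
  by (simp add: vec_def eps_def delt_def Kel_def zmat_def)

lemma vec_hl: "vec x s (hl m n (lsw n 0) DD) = of_int ((\<Sum>i=1..m. x i * lsw n 0 (Ep i)) + s * DD)"
  by (simp add: vec_def eps_def delt_def hl_def)

text \<open>The simple coroots satisfy a positive linear relation modulo \<open>K\<close>, so their pairings with a
  nonzero vector cannot all be nonnegative.\<close>
lemma ex_negative_pairing:
  assumes "\<exists>j\<in>{1..m}. x j \<noteq> (0::int)"
  shows "x 1 < 0 \<or> (\<exists>i. 1 \<le> i \<and> i < m \<and> x (Suc i) < x i) \<or> x m + x (m - 1) > 0"
proof (rule ccontr)
  assume "\<not> ?thesis"
  then have x1: "0 \<le> x 1" and mono: "\<And>i. 1 \<le> i \<Longrightarrow> i < m \<Longrightarrow> x i \<le> x (Suc i)" and top: "x m + x (m - 1) \<le> 0"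
    by (auto simp: not_less)
  have le: "x i \<le> x j" if "1 \<le> i" "i \<le> j" "j \<le> m" for i j
    using that(2,1,3)
  proof (induction j rule: dec_induct)
    case (step j)
    then have "x i \<le> x j" "x j \<le> x (Suc j)" using mono[of j] by auto
    then show ?case by (rule order_trans)
  qed simp
  have "1 \<le> m - 1" "m - 1 \<le> m" using m2 by linarith+
  then have "0 \<le> x (m - 1)" using le[of 1 "m - 1"] x1 by linarith
  then have "x m \<le> 0" using top by simp
  have "x j = 0" if "j \<in> {1..m}" for j
    using le[of 1 j] le[of j m] that x1 \<open>x m \<le> 0\<close> by auto
  then show False using assms by blast
qed

text \<open>The reflections negate x 1, exchange neighbouring coordinates, or replace (x (m-1), x m)
  by (- x m, - x (m-1)) while shifting s. As signed permutations they keep x nonzero.\<close>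

lemma vec_reflect:
  assumes x: "\<exists>j\<in>{1..m}. x j \<noteq> 0"
  shows "\<exists>a b r x' s' p. simple_triple a b r \<and> p < 0 \<and> 2 * vec x s (hco a b r) / wt (hco a b r) a b r = of_int p
    \<and> (\<forall>h\<in>hhat m n. vec x' s' h = vec x s h - of_int p * wt h a b r) \<and> (\<exists>j\<in>{1..m}. x' j \<noteq> 0)"
proof -
  obtain j where j: "j \<in> {1..m}" "x j \<noteq> 0" using x by blast
  note hc = hstar_hco[OF hstar_vec[of x s] m2]
  from ex_negative_pairing[OF x] consider "x 1 < 0" | i where "1 \<le> i" "i < m" "x (Suc i) < x i" | "x m + x (m - 1) > 0"
    by blast
  then show ?thesis
  proof cases
    case 1
    have t: "simple_triple (Ep 1) E0 0" by (simp add: simple_triple_def)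
    have w: "wt (hco (Ep 1) E0 0) (Ep 1) E0 0 = 1" by (subst wt_hco) auto
    have p: "2 * vec x s (hco (Ep 1) E0 0) / wt (hco (Ep 1) E0 0) (Ep 1) E0 0 = of_int (2 * x 1)"
      unfolding w hc(1) using vec_Eh[of 1] m2 by simp
    have "vec (x(1 := - x 1)) s h = vec x s h - of_int (2 * x 1) * wt h (Ep 1) E0 0" if "h \<in> hhat m n" for h
      using m2 that by (subst vec_upd) (auto simp: wt_simps)
    moreover have "\<exists>j\<in>{1..m}. (x(1 := - x 1)) j \<noteq> 0" using 1 m2 by (intro bexI[of _ 1]) auto
    ultimately show ?thesis using t p 1
      by (intro exI[of _ "Ep 1"] exI[of _ E0] exI[of _ 0] exI[of _ "x(1 := - x 1)"] exI[of _ s] exI[of _ "2 * x 1"]) auto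
  next
    case 2
    let ?a = "Ep (Suc i)" and ?b = "Ep i"
    define y where "y = x(Suc i := x i)"
    define z where "z = y(i := x (Suc i))"
    have y: "y i = x i" by (simp add: y_def)
    have t: "simple_triple ?a ?b 0" using 2 by (auto simp: simple_triple_def)
    have w: "wt (hco ?a ?b 0) ?a ?b 0 = 2" by (subst wt_hco) auto
    have p: "2 * vec x s (hco ?a ?b 0) / wt (hco ?a ?b 0) ?a ?b 0 = of_int (x (Suc i) - x i)"
      unfolding w hc(2)[OF 2(1,2)] using vec_Eh[of i] vec_Eh[of "Suc i"] 2 by simp
    have "vec z s h = vec x s h - of_int (x (Suc i) - x i) * wt h ?a ?b 0" if "h \<in> hhat m n" for h
    proof -
      have "vec z s h = vec y s h + of_int (x (Suc i) - y i) * eps i h"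
        unfolding z_def using 2 by (intro vec_upd) auto
      also have "vec y s h = vec x s h + of_int (x i - x (Suc i)) * eps (Suc i) h"
        unfolding y_def using 2 by (intro vec_upd) auto
      finally show ?thesis by (simp add: wt_simps y algebra_simps)
    qed
    moreover have "z i = x (Suc i)" "z (Suc i) = x i" by (simp_all add: z_def y_def)
    then have "\<exists>j\<in>{1..m}. z j \<noteq> 0"
    proof -
      assume "z i = x (Suc i)" "z (Suc i) = x i"
      then have "z i \<noteq> 0 \<or> z (Suc i) \<noteq> 0" using 2 by auto
      moreover have "i \<in> {1..m}" "Suc i \<in> {1..m}" using 2 by auto
      ultimately show ?thesis by blast
    qed
    ultimately show ?thesis using t p 2
      by (intro exI[of _ ?a] exI[of _ ?b] exI[of _ 0] exI[of _ z] exI[of _ s] exI[of _ "x (Suc i) - x i"]) auto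
  next
    case 3
    let ?a = "Em m" and ?b = "Ep (m - 1)"
    \<comment> \<open>The pairing with the coroot of delta - theta; K contributes nothing because
      \<open>vec\<close> has level zero.\<close>
    define p where "p = - (x m + x (m - 1))"
    define y where "y = x(m := - x (m - 1))"
    define z where "z = y(m - 1 := - x m)"
    have ne: "m - 1 \<noteq> m" "m - 1 \<in> {1..m}" "m \<in> {1..m}" using m2 by auto
    have t: "simple_triple ?a ?b 1" by (simp add: simple_triple_def)
    have w: "wt (hco ?a ?b 1) ?a ?b 1 = 2" using ne by (subst wt_hco) auto
    have pe: "2 * vec x s (hco ?a ?b 1) / wt (hco ?a ?b 1) ?a ?b 1 = of_int p"
      unfolding w hc(3) vec_Kel vec_Eh[OF ne(2)] vec_Eh[OF ne(3)] by (simp add: p_def)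
    have y: "y (m - 1) = x (m - 1)" using ne by (simp add: y_def)
    have "vec z (s - p) h = vec x s h - of_int p * wt h ?a ?b 1" if h: "h \<in> hhat m n" for h
    proof -
      have 1: "vec z (s - p) h = vec y (s - p) h + of_int (- x m - y (m - 1)) * eps (m - 1) h"
        unfolding z_def using ne by (intro vec_upd)
      have 2: "vec y (s - p) h = vec x (s - p) h + of_int (- x (m - 1) - x m) * eps m h"
        unfolding y_def using ne by (intro vec_upd)
      have 3: "vec x (s - p) h = vec x s h - of_int p * delt h" by (simp add: vec_def algebra_simps)
      have 4: "wt h ?a ?b 1 = - eps m h - eps (m - 1) h + delt h" using h by (simp add: wt_simps)
      show ?thesis unfolding 1 2 3 4 y by (simp add: p_def algebra_simps)
    qed
    moreover have "z (m - 1) = - x m" "z m = - x (m - 1)" using ne by (simp_all add: z_def y_def)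
    then have "\<exists>j\<in>{1..m}. z j \<noteq> 0"
    proof -
      assume "z (m - 1) = - x m" "z m = - x (m - 1)"
      then have "z (m - 1) \<noteq> 0 \<or> z m \<noteq> 0" using 3 by auto
      then show ?thesis using ne by blast
    qed
    moreover have "p < 0" using 3 by (simp add: p_def)
    ultimately show ?thesis using t pe
      by (intro exI[of _ ?a] exI[of _ ?b] exI[of _ 1] exI[of _ z] exI[of _ "s - p"] exI[of _ p]) auto
  qed
qed

text \<open>Induction on how far the height lies below 1. A simple reflection with negative pairing
  p adds -p times the height of the simple root, hence at least 1, and
  \<open>leaves_weights_pos\<close> applies once the height is positive. Neither the statement nor
  the descent asks that the vector be a root.\<close>

lemma leaves_vec:
  assumes d: dominant and x: "\<exists>j\<in>{1..m}. x j \<noteq> 0"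
  shows "leaves_weights (vec x s)"
proof -
  let ?H = "hl m n (lsw n 0) DD"
  define ht where "ht x s = (\<Sum>i=1..m. x i * lsw n 0 (Ep i)) + s * DD" for x s
  have H: "?H \<in> hhat m n" using hl_hhat lsw_du by blast
  have "\<exists>j\<in>{1..m}. x j \<noteq> 0 \<Longrightarrow> ht x s \<ge> 1 - int k \<Longrightarrow> leaves_weights (vec x s)" for k
  proof (induction k arbitrary: x s)
    case 0
    show ?case
    proof (rule leaves_weights_pos[OF height_lsw v_singular v_wt v_nz])
      show "vec x s ?H = of_int (ht x s)" by (simp only: vec_hl ht_def)
    qed (use 0 nm in auto)
  next
    case (Suc k)
    from vec_reflect[OF Suc.prems(1), of s] obtain a b r x' s' p where t: "simple_triple a b r" and p: "p < 0"
      "2 * vec x s (hco a b r) / wt (hco a b r) a b r = of_int p"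
      and x': "\<forall>h\<in>hhat m n. vec x' s' h = vec x s h - of_int p * wt h a b r" "\<exists>j\<in>{1..m}. x' j \<noteq> 0"
      by blast
    note ab = simple_tripleD[OF t]
    let ?w = "lsw n 0 a - lsw n 0 b + DD * r"
    have "of_int (ht x' s') = (of_int (ht x s - p * ?w) :: complex)"
      using x'(1)[rule_format, OF H] unfolding vec_hl ht_def[symmetric] wt_hl[OF ab(1,2)] by simp
    then have "ht x' s' = ht x s + (- p) * ?w" unfolding of_int_eq_iff by simp
    moreover have "1 \<le> (- p) * ?w" using p(1) ab(8) by (smt (verit) mult_pos_pos)
    ultimately have "leaves_weights (vec x' s')" using Suc.prems(2) by (intro Suc.IH x'(2)) simp
    then have "leaves_weights (\<lambda>h. vec x s h - of_int p * wt h a b r)"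
      using leaves_weights_cong[of "vec x' s'" "\<lambda>h. vec x s h - of_int p * wt h a b r"] x'(1) by simp
    then show ?case
      using leaves_weights_reflect[OF ab(1-6) simple_nilpotent[OF d t], of "vec x s"] unfolding p(2) by blast
  qed
  from this[of "nat (1 - ht x s)"] show ?thesis using x by simp
qed

fun ev :: "idx \<Rightarrow> nat \<Rightarrow> int" where
  "ev (Ep i) j = of_bool (j = i)" | "ev (Em i) j = - of_bool (j = i)" | "ev _ j = 0"

lemma diag_vec:
  assumes h: "h \<in> hhat m n" and i: "i \<in> I" "\<not> odd_idx i"
  shows "fst h 0 i i = vec (ev i) 0 h"
proof (cases i)
  case (Ep j)
  then have "(\<Sum>k=1..m. of_int (ev i k) * eps k h) = (\<Sum>k=1..m. if k = j then eps k h else 0)"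
    by (intro sum.cong) auto
  then show ?thesis using Ep i by (simp add: vec_def eps_def)
next
  case (Em j)
  then have "(\<Sum>k=1..m. of_int (ev i k) * eps k h) = (\<Sum>k=1..m. if k = j then - eps k h else 0)"
    by (intro sum.cong) auto
  then show ?thesis using Em i hhat_Em[OF h] by (simp add: vec_def)
qed (use i h in \<open>auto simp: vec_def\<close>)

lemma ev_inj:
  assumes "i \<in> I" "k \<in> I" "\<not> odd_idx i" "\<not> odd_idx k" "i \<noteq> k"
  shows "\<exists>j\<in>{1..m}. ev i j - ev k j \<noteq> 0"
proof (rule ccontr)
  assume "\<not> ?thesis"
  then have eq: "ev i j = ev k j" if "1 \<le> j" "j \<le> m" for j using that by auto
  \<comment> \<open>The coordinate at which \<open>ev i\<close> is nonzero; for \<open>E0\<close>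
    the value 0 lies outside the coordinate range.\<close>
  define pos where "pos i = (case i of Ep a \<Rightarrow> a | Em a \<Rightarrow> a | _ \<Rightarrow> 0)" for i
  show False
    using assms eq[of "pos i"] eq[of "pos k"] by (cases i; cases k) (auto simp: pos_def of_bool_def split: if_splits)
qed

lemma leaves_root:
  assumes d: dominant and ik: "i \<in> I" "k \<in> I" "\<not> odd_idx i" "\<not> odd_idx k" "i \<noteq> k"
  shows "leaves_weights (\<lambda>h. wt h i k s)"
proof -
  have "wt h i k s = vec (\<lambda>j. ev i j - ev k j) s h" if "h \<in> hhat m n" for h
    unfolding wt_def diag_vec[OF that ik(1,3)] diag_vec[OF that ik(2,4)]
    by (simp add: vec_def delt_def sum_subtractf algebra_simps)
  from leaves_weights_cong[of "\<lambda>h. wt h i k s", OF this] show ?thesis using leaves_vec[OF d ev_inj[OF ik]] by simp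
qed

text \<open>Any nonzero entry of a root vector already determines the root.\<close>

lemma sharp_rootE:
  assumes "sharp_root m n a"
  obtains i k where "i \<in> I" "k \<in> I" "\<not> odd_idx i" "\<not> odd_idx k" "i \<noteq> k" "\<And>h. h \<in> hhat m n \<Longrightarrow> a h = wt h i k 0"
proof -
  obtain Y where Y: "Y \<noteq> zmat" "osp m n Y" "\<And>i j. Y i j \<noteq> 0 \<Longrightarrow> \<not> odd_idx i \<and> \<not> odd_idx j"
    "(\<lambda>r. if r = 0 then Y else zmat, 0, 0) \<in> rootsp m n a" (is "?x \<in> _")
    using assms unfolding sharp_root_def by blast
  obtain h0 where h0: "h0 \<in> hhat m n" "a h0 \<noteq> 0" using assms unfolding sharp_root_def by blast
  obtain i k where ik: "Y i k \<noteq> 0" using Y(1) zmat_nz by blast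
  have a: "a h = wt h i k 0" if h: "h \<in> hhat m n" for h
  proof -
    have x: "gbr m n h ?x = gscale (a h) ?x" "?x \<in> ghat_set m n" using Y(4) h unfolding rootsp_def by blast+
    have "wt h i k 0 * Y i k = fst (gbr m n h ?x) 0 i k" by (simp add: gbr_hhat[OF h x(2)])
    also have "\<dots> = a h * Y i k" unfolding x(1) by (simp add: gscale_def)
    finally show ?thesis using ik by simp
  qed
  have "i \<noteq> k" using a[OF h0(1)] h0(2) by (auto simp: wt_def)
  then show ?thesis using that[of i k] ospD[OF Y(2) ik] Y(3)[OF ik] a by blast
qed

lemma integrable_if_dominant:
  assumes d: dominant
  shows "integrable m n \<rho>"
proof -
  \<comment> \<open>The case s = 0 yields the first clause of \<open>integrable\<close>, positive s
    the second.\<close>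
  have *: "gamma_integrable m n \<rho> (\<lambda>h. a h + of_int s * delt h)" if sharp: "sharp_root m n a" for a s
    unfolding gamma_integrable_def
  proof (intro ballI allI)
    fix x w assume x: "x \<in> rootsp m n (\<lambda>h. - (a h + of_int s * delt h))"
    obtain i k where ik: "i \<in> I" "k \<in> I" "\<not> odd_idx i" "\<not> odd_idx k" "i \<noteq> k"
      and a: "\<And>h. h \<in> hhat m n \<Longrightarrow> a h = wt h i k 0" using sharp_rootE[OF sharp] by blast
    have "leaves_weights (\<lambda>h. wt h k i (-s))" using leaves_root[OF d ik(2,1,4,3)] ik(5) by blast
    moreover have eq: "wt h k i (-s) = - (a h + of_int s * delt h)" if "h \<in> hhat m n" for h
      using a[OF that] by (simp add: wt_def delt_def)
    ultimately have "leaves_weights (\<lambda>h. - (a h + of_int s * delt h))"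
      using leaves_weights_cong[of "\<lambda>h. wt h k i (-s)", OF eq] by simp
    then show "\<exists>N. (\<rho> x ^^ N) w = 0" using nilpotent_of_leaves x L_weight by blast
  qed
  show ?thesis unfolding integrable_def using *[of _ 0] *[of _ "int _"] by simp
qed

lemma dominant_if_integrable:
  assumes int: "integrable m n \<rho>"
  shows dominant
  unfolding dominant_def
proof (intro allI impI)
  fix a b r assume t: "simple_triple a b r"
  note ab = simple_tripleD[OF t]
  let ?H = "hl m n (lsw n 0) DD"
  have "?H \<in> hhat m n" using hl_hhat lsw_du by blast
  moreover have "lsw n 0 a - lsw n 0 b \<noteq> 0" using lsw_inj[OF ab(1,2)] ab(3) by auto
  then have "wt ?H a b 0 \<noteq> 0" unfolding wt_hl[OF ab(1,2)] by simp
  moreover have nz: "Bmat a b \<noteq> zmat"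
  proof
    assume "Bmat a b = zmat"
    then have "Bmat a b a b = 0" by (simp add: zmat_def)
    then show False unfolding Bmat_row(1)[OF ab(3,4)] by simp
  qed
  moreover have "\<not> odd_idx i \<and> \<not> odd_idx j" if "Bmat a b i j \<noteq> 0" for i j
    using Bmat_nz[OF that] ab(5,6) by auto
  ultimately have sharp: "sharp_root m n (\<lambda>h. wt h a b 0)"
    unfolding sharp_root_def using osp_Bmat[OF ab(1,2)] Bt_rootsp[OF ab(1,2), of 0] unfolding Bt_def by blast
  have gam: "\<exists>M. (X b a (-r) ^^ M) v = 0" if "gamma_integrable m n \<rho> (\<lambda>h. wt h a b r)"
  proof -
    have "Bt b a (-r) \<in> rootsp m n (\<lambda>h. - wt h a b r)" using Bt_rootsp[OF ab(2,1), of "-r"] by (simp add: wt_swap)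
    then show ?thesis using that unfolding gamma_integrable_def by blast
  qed
  \<comment> \<open>The finite simple roots fall under the first clause of
    \<open>integrable\<close>; delta - theta falls under the second, with the root -theta of
    so(2m+1) and r = 1.\<close>
  have "r = 0 \<or> r = 1" using t unfolding simple_triple_def by blast
  then have "gamma_integrable m n \<rho> (\<lambda>h. wt h a b r)"
  proof
    assume r: "r = 0"
    have "pos_root m n (\<lambda>h. wt h a b r)"
      using pos_root_wt[OF n1 nm ab(1,2) nz] ab(8) by (simp add: lht_lsw0[OF ab(1)] lht_lsw0[OF ab(2)])
    then show ?thesis
      using spec[OF int[unfolded integrable_def, THEN conjunct1], of "\<lambda>h. wt h a b r"] sharp unfolding r by simp
  next
    assume r: "r = 1"
    have "gamma_integrable m n \<rho> (\<lambda>h. wt h a b 0 + of_nat 1 * delt h)"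
      using spec[OF spec[OF int[unfolded integrable_def, THEN conjunct2], of "\<lambda>h. wt h a b 0"], of 1] sharp by simp
    moreover have "(\<lambda>h. wt h a b 0 + of_nat 1 * delt h) = (\<lambda>h. wt h a b r)"
      by (rule ext) (simp add: r wt_def delt_def)
    ultimately show ?thesis by simp
  qed
  from gam[OF this] show "\<exists>N::nat. L (hco a b r) = of_nat N * wt (hco a b r) a b r / 2"
    using integral_of_nil[OF ab(1-6,8)] by blast
qed

section \<open>The criterion in coordinates\<close>

lemma dominant_iff:
  "dominant \<longleftrightarrow> (\<exists>N::nat. L (Eh 1) = of_nat N / 2)
     \<and> (\<forall>i. 1 \<le> i \<and> i < m \<longrightarrow> (\<exists>N::nat. L (Eh (Suc i)) - L (Eh i) = of_nat N))
     \<and> (\<exists>N::nat. L Kel - L (Eh m) - L (Eh (m - 1)) = of_nat N)"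
proof -
  note hc = hstar_hco[OF hstar m2]
  have w1: "wt (hco (Ep 1) E0 0) (Ep 1) E0 0 = 1" by (subst wt_hco) auto
  have w2: "wt (hco (Ep (Suc i)) (Ep i) 0) (Ep (Suc i)) (Ep i) 0 = 2" for i by (subst wt_hco) auto
  have w3: "wt (hco (Em m) (Ep (m - 1)) 1) (Em m) (Ep (m - 1)) 1 = 2" using m2 by (subst wt_hco) auto
  have "dominant \<longleftrightarrow> (\<exists>N::nat. L (hco (Ep 1) E0 0) = of_nat N * wt (hco (Ep 1) E0 0) (Ep 1) E0 0 / 2)
     \<and> (\<forall>i. 1 \<le> i \<and> i < m \<longrightarrow> (\<exists>N::nat. L (hco (Ep (Suc i)) (Ep i) 0) = of_nat N * wt (hco (Ep (Suc i)) (Ep i) 0) (Ep (Suc i)) (Ep i) 0 / 2))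
     \<and> (\<exists>N::nat. L (hco (Em m) (Ep (m - 1)) 1) = of_nat N * wt (hco (Em m) (Ep (m - 1)) 1) (Em m) (Ep (m - 1)) 1 / 2)"
    unfolding dominant_def simple_triple_def by blast
  also have "\<dots> \<longleftrightarrow> (\<exists>N::nat. L (Eh 1) = of_nat N / 2)
     \<and> (\<forall>i. 1 \<le> i \<and> i < m \<longrightarrow> (\<exists>N::nat. L (Eh (Suc i)) - L (Eh i) = of_nat N))
     \<and> (\<exists>N::nat. L Kel - L (Eh m) - L (Eh (m - 1)) = of_nat N)"
    unfolding w1 w2 w3 hc(1,3) by (auto simp: hc(2))
  finally show ?thesis .
qed

lemma L_form:
  assumes h: "h \<in> hhat m n"
  shows "L h = L Kel * lam0 h + (\<Sum>i=1..n. L (Eh i) * beta i h) + (\<Sum>i=Suc n..m. L (Eh i) * eps i h) + L del * delt h"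
proof -
  have "{1..m} = {1..n} \<union> {Suc n..m}" using nm by auto
  then have "(\<Sum>i=1..m. eps i h * L (Eh i)) = (\<Sum>i\<in>{1..n} \<union> {Suc n..m}. eps i h * L (Eh i))" by (simp only:)
  also have "\<dots> = (\<Sum>i=1..n. eps i h * L (Eh i)) + (\<Sum>i=Suc n..m. eps i h * L (Eh i))"
    by (rule sum.union_disjoint) auto
  finally have 1: "(\<Sum>i=1..m. eps i h * L (Eh i)) = (\<Sum>i=1..n. eps i h * L (Eh i)) + (\<Sum>i=Suc n..m. eps i h * L (Eh i))" .
  have 2: "(\<Sum>j=1..n. dlt j h * L (Fh j)) = (\<Sum>j=1..n. - (dlt j h * L (Eh j)))"
    by (intro sum.cong) (auto simp: L_Fh)
  have "(\<Sum>i=1..n. eps i h * L (Eh i)) + (\<Sum>j=1..n. dlt j h * L (Fh j)) = (\<Sum>i=1..n. L (Eh i) * beta i h)"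
    unfolding 2 sum.distrib[symmetric] by (intro sum.cong) (auto simp: beta_def algebra_simps)
  then show ?thesis using hstar_expand[OF hstar h] unfolding 1 by (simp add: algebra_simps)
qed

lemma form_if_dominant:
  assumes d: dominant and K: "L Kel \<noteq> 0"
  shows "\<exists>(c::complex) (ks::nat \<Rightarrow> real) (k::nat).
        L Kel = of_nat k \<and> k > 0
      \<and> (\<exists>j::nat. ks 1 = real j / 2)
      \<and> (\<forall>i\<in>{2..m}. \<exists>d::nat. ks i - ks 1 = real d)
      \<and> (\<forall>i\<in>{1..<m}. ks i \<le> ks (Suc i))
      \<and> ks m + ks (m - 1) \<le> real k
      \<and> (\<forall>h\<in>hhat m n. L h = of_nat k * lam0 h
            + (\<Sum>i=1..n. complex_of_real (ks i) * beta i h)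
            + (\<Sum>i=Suc n..m. complex_of_real (ks i) * eps i h)
            + c * delt h)"
proof -
  obtain N1 N0 :: nat where N1: "L (Eh 1) = of_nat N1 / 2" and N0: "L Kel - L (Eh m) - L (Eh (m - 1)) = of_nat N0"
    and incr: "\<And>i. 1 \<le> i \<Longrightarrow> i < m \<Longrightarrow> \<exists>N::nat. L (Eh (Suc i)) - L (Eh i) = of_nat N"
    using d unfolding dominant_iff by blast
  have "\<exists>e::nat. L (Eh i) = of_nat N1 / 2 + of_nat e" if "1 \<le> i" "i \<le> m" for i
    using that
  proof (induction i rule: dec_induct)
    case base
    show ?case using N1 by (intro exI[of _ 0]) simp
  next
    case (step i)
    obtain e :: nat where "L (Eh i) = of_nat N1 / 2 + of_nat e" using step by auto
    moreover obtain N :: nat where "L (Eh (Suc i)) - L (Eh i) = of_nat N" using incr[of i] step by auto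
    ultimately show ?case by (intro exI[of _ "e + N"]) (simp add: diff_eq_eq)
  qed
  then obtain e :: "nat \<Rightarrow> nat" where e: "\<And>i. 1 \<le> i \<Longrightarrow> i \<le> m \<Longrightarrow> L (Eh i) = of_nat N1 / 2 + of_nat (e i)" by metis
  define ks where "ks i = real N1 / 2 + real (e i)" for i
  have ks: "L (Eh i) = complex_of_real (ks i)" if "1 \<le> i" "i \<le> m" for i
    using e[OF that] by (simp add: ks_def)
  have e1: "e 1 = 0" using e[of 1] N1 m2 by simp
  \<comment> \<open>k_m + k_(m-1) equals N1 + e m + e (m - 1), since the two halves of N1 add up,
    and N0 is the difference to the level.\<close>
  define k where "k = N0 + N1 + e m + e (m - 1)"
  have Kk: "L Kel = of_nat k" using N0 e[of m] e[of "m - 1"] m2 by (simp add: k_def diff_eq_eq)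
  have "e i \<le> e (Suc i)" if i: "1 \<le> i" "i < m" for i
  proof -
    obtain N :: nat where "L (Eh (Suc i)) - L (Eh i) = of_nat N" using incr[OF i] by blast
    then have "(of_nat (e (Suc i)) :: complex) = of_nat (e i + N)" using e[of i] e[of "Suc i"] i by (simp add: diff_eq_eq)
    then have "e (Suc i) = e i + N" by (simp only: of_nat_eq_iff)
    then show ?thesis by simp
  qed
  moreover have "L h = of_nat k * lam0 h + (\<Sum>i=1..n. complex_of_real (ks i) * beta i h)
            + (\<Sum>i=Suc n..m. complex_of_real (ks i) * eps i h) + L del * delt h" if "h \<in> hhat m n" for h
  proof -
    have "(\<Sum>i=1..n. complex_of_real (ks i) * beta i h) = (\<Sum>i=1..n. L (Eh i) * beta i h)"
      using ks nm by (intro sum.cong) auto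
    moreover have "(\<Sum>i=Suc n..m. complex_of_real (ks i) * eps i h) = (\<Sum>i=Suc n..m. L (Eh i) * eps i h)"
      using ks by (intro sum.cong) auto
    ultimately show ?thesis using L_form[OF that] Kk by simp
  qed
  \<comment> \<open>Dominance makes k a natural number; positivity comes from the assumption that
    the level is not zero.\<close>
  moreover have "k > 0" using K Kk by (cases k) auto
  ultimately show ?thesis using Kk e1
    by (intro exI[of _ "L del"] exI[of _ ks] exI[of _ k]) (auto simp: ks_def k_def)
qed

lemma dominant_if_form:
  fixes ks :: "nat \<Rightarrow> real" and k j :: nat
  assumes K: "L Kel = of_nat k" and j: "ks 1 = real j / 2"
    and int: "\<forall>i\<in>{2..m}. \<exists>d::nat. ks i - ks 1 = real d" and mono: "\<forall>i\<in>{1..<m}. ks i \<le> ks (Suc i)"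
    and top: "ks m + ks (m - 1) \<le> real k"
    and form: "\<forall>h\<in>hhat m n. L h = of_nat k * lam0 h
            + (\<Sum>i=1..n. complex_of_real (ks i) * beta i h)
            + (\<Sum>i=Suc n..m. complex_of_real (ks i) * eps i h)
            + c * delt h"
  shows dominant
proof -
  have ks: "L (Eh i) = complex_of_real (ks i)" if i: "1 \<le> i" "i \<le> m" for i
  proof -
    have "Eh i \<in> hhat m n" unfolding Eh_Dg using i by (auto intro: Dg_hhat)
    moreover have "lam0 (Eh i) = 0" "delt (Eh i) = 0" by (simp_all add: lam0_def delt_def Eh_def)
    moreover have "(\<Sum>a=1..n. complex_of_real (ks a) * beta a (Eh i)) = (\<Sum>a=1..n. if a = i then complex_of_real (ks a) else 0)"
      by (intro sum.cong) (auto simp: beta_def eps_def dlt_def Eh_def)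
    moreover have "(\<Sum>a=Suc n..m. complex_of_real (ks a) * eps a (Eh i)) = (\<Sum>a=Suc n..m. if a = i then complex_of_real (ks a) else 0)"
      by (intro sum.cong) (auto simp: eps_def Eh_def)
    ultimately have "L (Eh i) = (\<Sum>a=1..n. if a = i then complex_of_real (ks a) else 0) + (\<Sum>a=Suc n..m. if a = i then complex_of_real (ks a) else 0)"
      using form by simp
    then show ?thesis using i by auto
  qed
  have "\<exists>d::nat. ks i = real j / 2 + real d" if i: "1 \<le> i" "i \<le> m" for i
  proof (cases "i = 1")
    case True
    then show ?thesis using j by (intro exI[of _ 0]) simp
  next
    case False
    then obtain d :: nat where "ks i - ks 1 = real d" using int i by force
    then show ?thesis using j by (intro exI[of _ d]) simp
  qed
  then obtain e :: "nat \<Rightarrow> nat" where e: "\<And>i. 1 \<le> i \<Longrightarrow> i \<le> m \<Longrightarrow> ks i = real j / 2 + real (e i)" by metis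
  have "\<exists>N::nat. L (Eh (Suc i)) - L (Eh i) = of_nat N" if "1 \<le> i" "i < m" for i
  proof -
    have "ks i \<le> ks (Suc i)" using mono that by auto
    then have "e i \<le> e (Suc i)" using e[of i] e[of "Suc i"] that by simp
    then have "L (Eh (Suc i)) - L (Eh i) = of_nat (e (Suc i) - e i)"
      using ks[of i] ks[of "Suc i"] e[of i] e[of "Suc i"] that by (simp add: of_nat_diff)
    then show ?thesis by blast
  qed
  moreover have "\<exists>N::nat. L Kel - L (Eh m) - L (Eh (m - 1)) = of_nat N"
  proof -
    \<comment> \<open>The two halves of j add up, which turns the bound on k_m + k_(m-1) into an
      inequality of natural numbers.\<close>
    have "real (j + e m + e (m - 1)) \<le> real k" using top e[of m] e[of "m - 1"] m2 by simp
    then have le: "j + e m + e (m - 1) \<le> k" by (simp only: of_nat_le_iff)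
    have "L Kel - L (Eh m) - L (Eh (m - 1)) = of_nat (k - (j + e m + e (m - 1)))"
      unfolding of_nat_diff[OF le] K using ks[of m] ks[of "m - 1"] e[of m] e[of "m - 1"] m2 by simp
    then show ?thesis by blast
  qed
  moreover have "L (Eh 1) = complex_of_real (ks 1)" using ks[of 1] m2 by simp
  then have "L (Eh 1) = of_nat j / 2" unfolding j by simp
  ultimately show ?thesis unfolding dominant_iff by blast
qed

end

theorem theorem5p6:
  fixes m n :: nat and L :: "ghat \<Rightarrow> complex"
    and sc :: "complex \<Rightarrow> 'v::ab_group_add \<Rightarrow> 'v" and \<rho> :: "ghat \<Rightarrow> 'v \<Rightarrow> 'v" and v :: 'v
  assumes "1 \<le> n" and "n < m"
    and "hstar m n L" and "L Kel \<noteq> 0"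
    and "\<forall>i\<in>{1..n}. hsform m n L (beta i) = 0"
    and "gmodule m n sc \<rho>" and "irreducible_mod m n sc \<rho>" and "hw_vector m n sc \<rho> L v"
  shows "integrable m n \<rho> \<longleftrightarrow>
    (\<exists>(c::complex) (ks::nat \<Rightarrow> real) (k::nat).
        L Kel = of_nat k \<and> k > 0
      \<and> (\<exists>j::nat. ks 1 = real j / 2)
      \<and> (\<forall>i\<in>{2..m}. \<exists>d::nat. ks i - ks 1 = real d)
      \<and> (\<forall>i\<in>{1..<m}. ks i \<le> ks (Suc i))
      \<and> ks m + ks (m - 1) \<le> real k
      \<and> (\<forall>h\<in>hhat m n. L h = of_nat k * lam0 h
            + (\<Sum>i=1..n. complex_of_real (ks i) * beta i h)
            + (\<Sum>i=Suc n..m. complex_of_real (ks i) * eps i h)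
            + c * delt h))"
    (is "_ \<longleftrightarrow> ?form")
proof -
  interpret osp_hw m n sc \<rho> L v
    using assms by unfold_locales
  show ?thesis
  proof
    assume "integrable m n \<rho>"
    then show ?form using form_if_dominant[OF dominant_if_integrable assms(4)] by blast
  next
    assume ?form
    then have dominant by (elim exE conjE) (rule dominant_if_form)
    then show "integrable m n \<rho>" by (rule integrable_if_dominant)
  qed
qed

end
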